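(* Let $\tau_0,\rho,\kappa\in\mathbb{R}_{>0}$, $\mu_1,\mu_2\in\mathbb{R}$ with $\mu_2>-\mu_1$, and let $\Omega\subseteq\mathbb{R}^3$ be non-empty and open. Let $C=C^{*}\in L(\mathbb{C}^{3\times3},\mathbb{C}^{3\times3})$ be strictly positive definite such that $\left(\kappa^{-1}\mu_1\Delta+\kappa^{-1}\mu_2\operatorname{grad}\operatorname{div}\right)\phi=\operatorname{div}C\operatorname{grad}\phi$ for all $\phi\in C_\infty(\overline{\Omega})^3$. Let $c\in L(L^2(\Omega))$ be selfadjoint and strictly positive definite, and let $A\colon D(A)\subseteq L^2(\Omega)^3\oplus L^2(\Omega)\oplus L^2(\Omega)^{3\times3}\to L^2(\Omega)^3\oplus L^2(\Omega)\oplus L^2(\Omega)^{3\times3}$ be given by $$A\psi=\begin{pmatrix}0&\begin{pmatrix}\operatorname{grad}&-\operatorname{div}\end{pmatrix}\\ \begin{pmatrix}\mathring{\operatorname{div}}\\-\mathring{\operatorname{grad}}\end{pmatrix}&0\end{pmatrix}\psi$$ for all $$\psi\in D(A):=\left\{(\psi_1,\psi_2,\psi_3)\in L^2(\Omega)^3\oplus L^2(\Omega)\oplus L^2(\Omega)^{3\times3}\;\middle|\;\psi_1\in D(\mathring{\operatorname{grad}}),\ \operatorname{grad}\psi_2-\operatorname{div}\psi_3\in L^2(\Omega)^3\right\}.$$ Then the closure of the operator $$\mathcal{T}:=\partial_0\begin{pmatrix}\tau_0\kappa^{-1}&0&0\\0&\rho c&0\\0&0&0\end{pmatrix}+\begin{pmatrix}\kappa^{-1}&0&0\\0&0&0\\0&0&C^{-1}\end{pmatrix}+A$$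 is continuously invertible in $H_{\nu,0}\left(\mathbb{R};L^2(\Omega)^3\oplus L^2(\Omega)\oplus L^2(\Omega)^{3\times3}\right)$ for all sufficiently large $\nu>0$.
   Context: $\mathring{\operatorname{grad}}$ is the closure in $L^2(\Omega)^3\to L^2(\Omega)^{3\times3}$ of the Jacobian $(\phi_i)_i\mapsto(\partial_k\phi_i)_{i,k}$ on $\mathring{C}_\infty(\Omega)^3$ (smooth compactly supported vector fields), so $D(\mathring{\operatorname{grad}})=\mathring{H}_1(\Omega)^3$, where $\mathring{H}_1(\Omega)$ is the closure of the test functions in the Sobolev space $H_1(\Omega)$. In the operator $A$, $\mathring{\operatorname{div}}\psi_1=\sum_i\partial_i\psi_{1,i}$ is applied to $\psi_1\in\mathring{H}_1(\Omega)^3$, while $\operatorname{grad}\psi_2$ (of the scalar $\psi_2\in L^2(\Omega)$) and $\operatorname{div}\psi_3$ (row-wise divergence of the matrix field $\psi_3\in L^2(\Omega)^{3\times3}$) are taken in the distributional sense, i.e. as elements of $(\mathring{H}_1(\Omega)^3)'$; only the difference $\operatorname{grad}\psi_2-\operatorname{div}\psi_3$ is required to lie in $L^2(\Omega)^3$. Thus $A\psi=(\operatorname{grad}\psi_2-\operatorname{div}\psi_3,\ \mathring{\operatorname{div}}\psi_1,\ -\mathring{\operatorname{grad}}\psi_1)$. In the identity for $C$: $\Delta$ acts componentwise on vector fields, $\operatorname{grad}\phi=(\partial_j\phi_i)_{i,j}$ on the right-hand side is the Jacobian, $C$ acts pointwise, and $\operatorname{div}$ on the right-hand side is the row-wise divergence;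 $\mathbb{C}^{3\times3}$ carries the Frobenius inner product, and $C_\infty(\overline{\Omega})$ denotes functions smooth up to the boundary. In $\mathcal{T}$, $C^{-1}$ acts pointwise on $L^2(\Omega)^{3\times3}$. For $\nu>0$ and a Hilbert space $H$, $H_{\nu,0}(\mathbb{R};H)$ is the Hilbert space of (equivalence classes of) measurable $f\colon\mathbb{R}\to H$ with $\int_{\mathbb{R}}|f(t)|_H^2e^{-2\nu t}\,\mathrm{d}t<\infty$, with inner product $\int_{\mathbb{R}}\langle f(t)|g(t)\rangle_He^{-2\nu t}\,\mathrm{d}t$. The operator $\partial_0=\partial_{0,\nu}$ is the closure of $\phi\mapsto\phi'$ on $\mathring{C}_\infty(\mathbb{R};H)$ (smooth compactly supported functions) in $H_{\nu,0}(\mathbb{R};H)$. Operators on $H$ act pointwise in time on $H_{\nu,0}(\mathbb{R};H)$, and the sum $\mathcal{T}$ has its natural domain (the intersection of the domains of its summands). *)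

theory Defs
  imports "HOL-Analysis.Analysis"
begin

section \<open>Complex inner product spaces\<close>

text \<open>Inner products are conjugate-linear in the first argument; the topology is the one of the
  underlying real inner product space, whose inner product is the real part.\<close>

class complex_inner = real_inner +
  fixes scaleC :: "complex \<Rightarrow> 'a \<Rightarrow> 'a"  (infixr "*\<^sub>C" 75)
    and cinner :: "'a \<Rightarrow> 'a \<Rightarrow> complex"
  assumes scaleC_add_right: "a *\<^sub>C (x + y) = a *\<^sub>C x + a *\<^sub>C y"
    and scaleC_add_left: "(a + b) *\<^sub>C x = a *\<^sub>C x + b *\<^sub>C x"
    and scaleC_scaleC: "a *\<^sub>C b *\<^sub>C x = (a * b) *\<^sub>C x"
    and scaleC_of_real: "complex_of_real r *\<^sub>C x = r *\<^sub>R x"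
    and cinner_commute: "cinner x y = cnj (cinner y x)"
    and cinner_add_right: "cinner x (y + z) = cinner x y + cinner x z"
    and cinner_scaleC_right: "cinner x (a *\<^sub>C y) = a * cinner x y"
    and Re_cinner: "Re (cinner x y) = inner x y"

instantiation complex :: complex_inner
begin

definition "scaleC a (z::complex) = a * z"
definition "cinner (z::complex) w = cnj z * w"

instance
  by standard (auto simp: scaleC_complex_def cinner_complex_def algebra_simps
      scaleR_conv_of_real inner_complex_def)

end

text \<open>Iterating the following instance yields the Frobenius inner product on matrices.\<close>

instantiation vec :: (complex_inner, finite) complex_inner
begin

definition "scaleC a (x::'a^'b) = (\<chi> i. a *\<^sub>C (x $ i))"
definition "cinner (x::'a^'b) y = (\<Sum>i\<in>UNIV. cinner (x $ i) (y $ i))"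

instance
proof
  fix x y z :: "'a^'b" and a b :: complex and r :: real
  show "a *\<^sub>C (x + y) = a *\<^sub>C x + a *\<^sub>C y" "(a + b) *\<^sub>C x = a *\<^sub>C x + b *\<^sub>C x"
    "a *\<^sub>C b *\<^sub>C x = (a * b) *\<^sub>C x" "complex_of_real r *\<^sub>C x = r *\<^sub>R x"
    by (simp_all add: scaleC_vec_def vec_eq_iff scaleC_add_right scaleC_add_left scaleC_scaleC
        scaleC_of_real)
  show "cinner x y = cnj (cinner y x)"
    unfolding cinner_vec_def cnj_sum by (intro sum.cong refl cinner_commute)
  show "cinner x (y + z) = cinner x y + cinner x z"
    by (simp add: cinner_vec_def cinner_add_right sum.distrib)
  show "cinner x (a *\<^sub>C y) = a * cinner x y"
    by (simp add: cinner_vec_def scaleC_vec_def cinner_scaleC_right sum_distrib_left)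
  show "Re (cinner x y) = inner x y"
    by (simp add: cinner_vec_def inner_vec_def Re_cinner)
qed

end

instantiation prod :: (complex_inner, complex_inner) complex_inner
begin

definition "scaleC a (x::'a \<times> 'b) = (a *\<^sub>C fst x, a *\<^sub>C snd x)"
definition "cinner (x::'a \<times> 'b) y = cinner (fst x) (fst y) + cinner (snd x) (snd y)"

instance
proof
  fix x y z :: "'a \<times> 'b" and a b :: complex and r :: real
  show "a *\<^sub>C (x + y) = a *\<^sub>C x + a *\<^sub>C y" "(a + b) *\<^sub>C x = a *\<^sub>C x + b *\<^sub>C x"
    "a *\<^sub>C b *\<^sub>C x = (a * b) *\<^sub>C x" "complex_of_real r *\<^sub>C x = r *\<^sub>R x"
    by (simp_all add: scaleC_prod_def prod_eq_iff scaleC_add_right scaleC_add_left scaleC_scaleC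
        scaleC_of_real)
  show "cinner x y = cnj (cinner y x)"
    unfolding cinner_prod_def by (subst (1 2) cinner_commute) simp
  show "cinner x (y + z) = cinner x y + cinner x z"
    by (simp add: cinner_prod_def cinner_add_right)
  show "cinner x (a *\<^sub>C y) = a * cinner x y"
    by (simp add: cinner_prod_def scaleC_prod_def cinner_scaleC_right algebra_simps)
  show "Re (cinner x y) = inner x y"
    by (simp add: cinner_prod_def inner_prod_def Re_cinner)
qed

end

lemma cinner_eq_Complex: "cinner x y = Complex (inner x y) (- inner x (\<i> *\<^sub>C y))"
  using Re_cinner[of x "\<i> *\<^sub>C y"] by (simp add: complex_eq_iff Re_cinner cinner_scaleC_right)

lemma linear_scaleC: "linear (\<lambda>x::'a::complex_inner. a *\<^sub>C x)"
proof
  fix x y :: 'a and r :: real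
  show "a *\<^sub>C (x + y) = a *\<^sub>C x + a *\<^sub>C y" by (rule scaleC_add_right)
  show "a *\<^sub>C (r *\<^sub>R x) = r *\<^sub>R (a *\<^sub>C x)"
    by (simp add: scaleC_scaleC mult.commute flip: scaleC_of_real)
qed

lemma cinner_self: "cinner x x = complex_of_real ((norm x)\<^sup>2)"
proof -
  have "Im (cinner x x) = - Im (cinner x x)"
    using arg_cong[OF cinner_commute[of x x], of Im] by simp
  then show ?thesis by (simp add: complex_eq_iff Re_cinner power2_norm_eq_inner)
qed

lemma norm_scaleC: "norm (a *\<^sub>C x) = cmod a * norm x"
proof -
  have "cinner (a *\<^sub>C x) (a *\<^sub>C x) = a * cnj (cinner x (a *\<^sub>C x))"
    unfolding cinner_scaleC_right[of "a *\<^sub>C x"] by (subst cinner_commute) (rule refl)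
  also have "\<dots> = (a * cnj a) * cinner x x"
    by (simp add: cinner_scaleC_right cinner_self)
  finally have "cinner (a *\<^sub>C x) (a *\<^sub>C x) = (a * cnj a) * cinner x x" .
  then have "complex_of_real ((norm (a *\<^sub>C x))\<^sup>2) = complex_of_real ((cmod a)\<^sup>2 * (norm x)\<^sup>2)"
    by (simp only: cinner_self of_real_mult complex_norm_square)
  then have "(norm (a *\<^sub>C x))\<^sup>2 = (cmod a * norm x)\<^sup>2"
    by (simp only: of_real_eq_iff power_mult_distrib)
  then show ?thesis by simp
qed

lemma measurable_scaleC:
  fixes f :: "_ \<Rightarrow> 'a::{euclidean_space, complex_inner}"
  assumes [measurable]: "f \<in> borel_measurable M"
  shows "(\<lambda>x. a *\<^sub>C f x) \<in> borel_measurable M"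
  by (rule borel_measurable_continuous_on[OF linear_continuous_on[OF
        linear_conv_bounded_linear[THEN iffD1, OF linear_scaleC]] assms])

text \<open>Bounded complex-linear operators on a subspace \<open>S\<close>; the values of \<open>T\<close> outside \<open>S\<close> are
  irrelevant.\<close>

definition bounded_op_on :: "'a::complex_inner set \<Rightarrow> ('a \<Rightarrow> 'a) \<Rightarrow> bool" where
  "bounded_op_on S T \<longleftrightarrow>
     (\<forall>x\<in>S. T x \<in> S) \<and>
     (\<forall>x\<in>S. \<forall>y\<in>S. T (x + y) = T x + T y) \<and>
     (\<forall>a. \<forall>x\<in>S. T (a *\<^sub>C x) = a *\<^sub>C T x) \<and>
     (\<exists>K. \<forall>x\<in>S. norm (T x) \<le> K * norm x)"

definition selfadjoint_on :: "'a::complex_inner set \<Rightarrow> ('a \<Rightarrow> 'a) \<Rightarrow> bool" where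
  "selfadjoint_on S T \<longleftrightarrow> (\<forall>x\<in>S. \<forall>y\<in>S. cinner (T x) y = cinner x (T y))"

definition strictly_pos_def_on :: "'a::complex_inner set \<Rightarrow> ('a \<Rightarrow> 'a) \<Rightarrow> bool" where
  "strictly_pos_def_on S T \<longleftrightarrow> (\<exists>d>0. \<forall>x\<in>S. d * (norm x)\<^sup>2 \<le> Re (cinner x (T x)))"


section \<open>The space \<open>L\<^sup>2\<close>\<close>

definition sq_integrable :: "(real^3 \<Rightarrow> 'b::euclidean_space) \<Rightarrow> bool" where
  "sq_integrable f \<longleftrightarrow>
     f \<in> borel_measurable lborel \<and> integrable lborel (\<lambda>x. (norm (f x))\<^sup>2)"

lemma sq_integrable_0: "sq_integrable (\<lambda>_. 0)"
  by (simp add: sq_integrable_def)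

lemma sq_integrable_add:
  assumes "sq_integrable f" "sq_integrable g"
  shows "sq_integrable (\<lambda>x. f x + g x)"
proof -
  have [measurable]: "f \<in> borel_measurable lborel" "g \<in> borel_measurable lborel"
    using assms by (auto simp: sq_integrable_def)
  have "integrable lborel (\<lambda>x. 2 * (norm (f x))\<^sup>2 + 2 * (norm (g x))\<^sup>2)"
    using assms by (auto simp: sq_integrable_def)
  moreover have "(norm (f x + g x))\<^sup>2 \<le> 2 * (norm (f x))\<^sup>2 + 2 * (norm (g x))\<^sup>2" for x
  proof -
    have "(norm (f x + g x))\<^sup>2 \<le> (norm (f x) + norm (g x))\<^sup>2"
      by (intro power_mono norm_triangle_ineq) auto
    also have "\<dots> \<le> 2 * (norm (f x))\<^sup>2 + 2 * (norm (g x))\<^sup>2"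
      using sum_squares_bound[of "norm (f x)" "norm (g x)"] by (simp add: power2_sum)
    finally show ?thesis .
  qed
  ultimately have "integrable lborel (\<lambda>x. (norm (f x + g x))\<^sup>2)"
    by (elim Bochner_Integration.integrable_bound) auto
  then show ?thesis by (simp add: sq_integrable_def)
qed

lemma sq_integrable_bound:
  assumes "sq_integrable f" and [measurable]: "g \<in> borel_measurable lborel"
    and "\<And>x. norm (g x) \<le> K * norm (f x)"
  shows "sq_integrable g"
proof -
  have "integrable lborel (\<lambda>x. K\<^sup>2 * (norm (f x))\<^sup>2)"
    using assms(1) by (auto simp: sq_integrable_def)
  moreover have "(norm (g x))\<^sup>2 \<le> K\<^sup>2 * (norm (f x))\<^sup>2" for x
    using power_mono[OF assms(3)[of x], of 2] by (simp add: power_mult_distrib)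
  ultimately have "integrable lborel (\<lambda>x. (norm (g x))\<^sup>2)"
    by (elim Bochner_Integration.integrable_bound) auto
  then show ?thesis by (simp add: sq_integrable_def)
qed

lemma sq_integrable_scaleR: "sq_integrable f \<Longrightarrow> sq_integrable (\<lambda>x. r *\<^sub>R f x)"
  by (rule sq_integrable_bound[where K = "\<bar>r\<bar>"]) (auto simp: sq_integrable_def)

lemma sq_integrable_uminus: "sq_integrable f \<Longrightarrow> sq_integrable (\<lambda>x. - f x)"
  by (rule sq_integrable_bound[where K = 1]) (auto simp: sq_integrable_def)

lemma sq_integrable_diff:
  "sq_integrable f \<Longrightarrow> sq_integrable g \<Longrightarrow> sq_integrable (\<lambda>x. f x - g x)"
  using sq_integrable_add[of f "\<lambda>x. - g x"] sq_integrable_uminus[of g] by simp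

lemma sq_integrable_inner:
  assumes "sq_integrable f" "sq_integrable g"
  shows "integrable lborel (\<lambda>x. norm (f x) * norm (g x))"
proof -
  have [measurable]: "f \<in> borel_measurable lborel" "g \<in> borel_measurable lborel"
    using assms by (auto simp: sq_integrable_def)
  have "integrable lborel (\<lambda>x. (norm (f x))\<^sup>2 + (norm (g x))\<^sup>2)"
    using assms by (auto simp: sq_integrable_def)
  moreover have "norm (f x) * norm (g x) \<le> (norm (f x))\<^sup>2 + (norm (g x))\<^sup>2" for x
  proof -
    have "2 * norm (f x) * norm (g x) \<le> (norm (f x))\<^sup>2 + (norm (g x))\<^sup>2"
      by (rule sum_squares_bound)
    moreover have "0 \<le> norm (f x) * norm (g x)" by simp
    ultimately show ?thesis by linarith
  qed
  ultimately show ?thesis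
    by (elim Bochner_Integration.integrable_bound) auto
qed

lemma integrable_inner_sq:
  fixes f g :: "real^3 \<Rightarrow> 'b::euclidean_space"
  assumes "sq_integrable f" "sq_integrable g"
  shows "integrable lborel (\<lambda>x. inner (f x) (g x))"
proof (rule Bochner_Integration.integrable_bound[OF sq_integrable_inner[OF assms]])
  show "(\<lambda>x. inner (f x) (g x)) \<in> borel_measurable lborel"
    using assms by (auto simp: sq_integrable_def)
qed (simp add: Cauchy_Schwarz_ineq2)

lemma sq_integrable_scaleC:
  fixes f :: "real^3 \<Rightarrow> 'b::{euclidean_space, complex_inner}"
  shows "sq_integrable f \<Longrightarrow> sq_integrable (\<lambda>x. a *\<^sub>C f x)"
  by (rule sq_integrable_bound[where K = "cmod a"])
    (auto simp: sq_integrable_def norm_scaleC measurable_scaleC)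

lemma integrable_cinner_sq:
  fixes f g :: "real^3 \<Rightarrow> 'b::{euclidean_space, complex_inner}"
  assumes "sq_integrable f" "sq_integrable g"
  shows "integrable lborel (\<lambda>x. cinner (f x) (g x))"
  unfolding cinner_eq_Complex Complex_eq
  by (intro Bochner_Integration.integrable_add integrable_mult_right integrable_of_real
      integrable_minus integrable_inner_sq assms sq_integrable_scaleC)

text \<open>The members of the type are the equivalence classes of square integrable functions on
  all of \<open>\<real>\<^sup>3\<close>.\<close>

quotient_type (overloaded) 'b L2 =
  "real^3 \<Rightarrow> 'b::{euclidean_space, complex_inner}" / partial:
  "\<lambda>f g. sq_integrable f \<and> sq_integrable g \<and> (AE x in lborel. f x = g x)"
proof (rule part_equivpI)
  show "\<exists>f::real^3 \<Rightarrow> 'b. sq_integrable f \<and> sq_integrable f \<and> (AE x in lborel. f x = f x)"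
    by (rule exI[of _ "\<lambda>_. 0"]) (simp add: sq_integrable_0)
  show "symp (\<lambda>f g::real^3 \<Rightarrow> 'b. sq_integrable f \<and> sq_integrable g \<and> (AE x in lborel. f x = g x))"
    by (auto intro!: sympI elim: AE_mp)
  show "transp (\<lambda>f g::real^3 \<Rightarrow> 'b. sq_integrable f \<and> sq_integrable g \<and> (AE x in lborel. f x = g x))"
    by (auto intro!: transpI elim: AE_mp)
qed

instantiation L2 :: ("{euclidean_space, complex_inner}") real_inner
begin

lift_definition zero_L2 :: "'a L2" is "\<lambda>_. 0"
  by (simp add: sq_integrable_0)

lift_definition plus_L2 :: "'a L2 \<Rightarrow> 'a L2 \<Rightarrow> 'a L2" is "\<lambda>f g x. f x + g x"
  by (auto intro: sq_integrable_add)

lift_definition minus_L2 :: "'a L2 \<Rightarrow> 'a L2 \<Rightarrow> 'a L2" is "\<lambda>f g x. f x - g x"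
  by (auto intro: sq_integrable_diff)

lift_definition uminus_L2 :: "'a L2 \<Rightarrow> 'a L2" is "\<lambda>f x. - f x"
  by (auto intro: sq_integrable_uminus)

lift_definition scaleR_L2 :: "real \<Rightarrow> 'a L2 \<Rightarrow> 'a L2" is "\<lambda>r f x. r *\<^sub>R f x"
  by (auto intro: sq_integrable_scaleR)

lift_definition inner_L2 :: "'a L2 \<Rightarrow> 'a L2 \<Rightarrow> real" is
  "\<lambda>f g. integral\<^sup>L lborel (\<lambda>x. inner (f x) (g x))"
  by (intro integral_cong_AE) (auto simp: sq_integrable_def)

definition norm_L2 :: "'a L2 \<Rightarrow> real" where "norm_L2 f = sqrt (inner f f)"
definition dist_L2 :: "'a L2 \<Rightarrow> 'a L2 \<Rightarrow> real" where "dist_L2 f g = norm (f - g)"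
definition sgn_L2 :: "'a L2 \<Rightarrow> 'a L2" where "sgn_L2 f = scaleR (inverse (norm f)) f"
definition uniformity_L2 :: "('a L2 \<times> 'a L2) filter" where
  "uniformity_L2 = (INF e\<in>{0<..}. principal {(f, g). dist f g < e})"
definition open_L2 :: "'a L2 set \<Rightarrow> bool" where
  "open_L2 U \<longleftrightarrow> (\<forall>f\<in>U. eventually (\<lambda>(f', g). f' = f \<longrightarrow> g \<in> U) uniformity)"

instance
proof
  fix f g h :: "'a L2" and r s :: real and U :: "'a L2 set"
  show "f + g + h = f + (g + h)" by transfer (auto simp: add.assoc intro: sq_integrable_add)
  show "f + g = g + f" by transfer (auto simp: add.commute intro: sq_integrable_add)
  show "0 + f = f" by transfer auto
  show "- f + f = 0" by transfer (auto simp: sq_integrable_0)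
  show "f - g = f + - g"
    by transfer (auto intro: sq_integrable_diff)
  show "r *\<^sub>R (f + g) = r *\<^sub>R f + r *\<^sub>R g"
    by transfer (auto simp: scaleR_add_right intro: sq_integrable_add sq_integrable_scaleR)
  show "(r + s) *\<^sub>R f = r *\<^sub>R f + s *\<^sub>R f"
    by transfer (auto simp: scaleR_add_left intro: sq_integrable_add sq_integrable_scaleR)
  show "r *\<^sub>R s *\<^sub>R f = (r * s) *\<^sub>R f"
    by transfer (auto intro: sq_integrable_scaleR)
  show "1 *\<^sub>R f = f" by transfer auto
  show "dist f g = norm (f - g)" by (rule dist_L2_def)
  show "sgn f = inverse (norm f) *\<^sub>R f" by (rule sgn_L2_def)
  show "uniformity = (INF e\<in>{0<..}. principal {(f, g). dist f (g::'a L2) < e})"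
    by (rule uniformity_L2_def)
  show "open U \<longleftrightarrow> (\<forall>f\<in>U. eventually (\<lambda>(f', g). f' = f \<longrightarrow> g \<in> U) uniformity)"
    by (rule open_L2_def)
  show "inner f g = inner g f" by transfer (auto simp: inner_commute)
  show "inner (f + g) h = inner f h + inner g h"
    by transfer (auto simp: inner_add_left integrable_inner_sq)
  show "inner (r *\<^sub>R f) g = r * inner f g"
    by transfer auto
  show "0 \<le> inner f f" by transfer auto
  show "inner f f = 0 \<longleftrightarrow> f = 0"
  proof (transfer, goal_cases)
    case (1 f)
    then have "integrable lborel (\<lambda>x. inner (f x) (f x))"
      by (auto intro: integrable_inner_sq)
    from integral_nonneg_eq_0_iff_AE[OF this] 1 show ?case
      by (auto simp: sq_integrable_0)
  qed
  show "norm f = sqrt (inner f f)" by (rule norm_L2_def)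
qed

end

instantiation L2 :: ("{euclidean_space, complex_inner}") complex_inner
begin

lift_definition scaleC_L2 :: "complex \<Rightarrow> 'a L2 \<Rightarrow> 'a L2" is "\<lambda>a f x. a *\<^sub>C f x"
  by (auto intro: sq_integrable_scaleC)

lift_definition cinner_L2 :: "'a L2 \<Rightarrow> 'a L2 \<Rightarrow> complex" is
  "\<lambda>f g. integral\<^sup>L lborel (\<lambda>x. cinner (f x) (g x))"
  by (intro integral_cong_AE borel_measurable_integrable integrable_cinner_sq) auto

instance
proof
  fix f g h :: "'a L2" and a b :: complex and r :: real
  show "a *\<^sub>C (f + g) = a *\<^sub>C f + a *\<^sub>C g"
    by transfer (auto simp: scaleC_add_right intro: sq_integrable_add sq_integrable_scaleC)
  show "(a + b) *\<^sub>C f = a *\<^sub>C f + b *\<^sub>C f"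
    by transfer (auto simp: scaleC_add_left intro: sq_integrable_add sq_integrable_scaleC)
  show "a *\<^sub>C b *\<^sub>C f = (a * b) *\<^sub>C f"
    by transfer (auto simp: scaleC_scaleC intro: sq_integrable_scaleC)
  show "complex_of_real r *\<^sub>C f = r *\<^sub>R f"
    by transfer (auto simp: scaleC_of_real intro: sq_integrable_scaleR)
  show "cinner f g = cnj (cinner g f)"
    by transfer (subst Bochner_Integration.integral_cnj[symmetric], rule Bochner_Integration.integral_cong[OF refl],
        rule cinner_commute)
  show "cinner f (g + h) = cinner f g + cinner f h"
    by transfer (auto simp: cinner_add_right integrable_cinner_sq)
  show "cinner f (a *\<^sub>C g) = a * cinner f g"
    by transfer (auto simp: cinner_scaleC_right)
  show "Re (cinner f g) = inner f g"
    by transfer (auto simp: integrable_cinner_sq Re_cinner simp flip: integral_Re)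
qed

end

text \<open>The class of \<open>f\<close>; junk value \<open>0\<close> if \<open>f\<close> is not square integrable.\<close>

lift_definition L2_class ::
  "(real^3 \<Rightarrow> 'b::{euclidean_space, complex_inner}) \<Rightarrow> 'b L2" is
  "\<lambda>f. if sq_integrable f then f else (\<lambda>_. 0)"
  by (auto simp: sq_integrable_0)

definition L2_map ::
  "('a \<Rightarrow> 'b) \<Rightarrow> 'a::{euclidean_space, complex_inner} L2 \<Rightarrow> 'b::{euclidean_space, complex_inner} L2"
  where "L2_map F f = L2_class (\<lambda>x. F (rep_L2 f x))"

text \<open>\<open>L\<^sup>2(\<Omega>)\<close> is identified, via extension by zero, with the closed subspace of those members of
  \<open>L\<^sup>2(\<real>\<^sup>3)\<close> that vanish almost everywhere outside \<open>\<Omega>\<close>. Vector and matrix fields are fields with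
  values in \<open>\<complex>\<^sup>3\<close> and \<open>\<complex>\<^sup>3\<^sup>\<times>\<^sup>3\<close>.\<close>

definition L2_on :: "(real^3) set \<Rightarrow> 'b::{euclidean_space, complex_inner} L2 set" where
  "L2_on \<Omega> = {f. AE x in lborel. x \<notin> \<Omega> \<longrightarrow> rep_L2 f x = 0}"


section \<open>Smooth functions and classical differential operators\<close>

definition dir_deriv ::
  "'a::euclidean_space \<Rightarrow> ('a \<Rightarrow> 'b::real_normed_vector) \<Rightarrow> 'a \<Rightarrow> 'b" where
  "dir_deriv v f = (\<lambda>x. frechet_derivative f (at x) v)"

definition iter_deriv ::
  "'a::euclidean_space list \<Rightarrow> ('a \<Rightarrow> 'b::real_normed_vector) \<Rightarrow> 'a \<Rightarrow> 'b" where
  "iter_deriv vs f = foldr dir_deriv vs f"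

text \<open>Infinitely differentiable functions on an open set \<open>S\<close>: all iterated partial derivatives are
  (totally) differentiable on \<open>S\<close>.\<close>

definition smooth_on :: "'a::euclidean_space set \<Rightarrow> ('a \<Rightarrow> 'b::real_normed_vector) \<Rightarrow> bool" where
  "smooth_on S f \<longleftrightarrow> (\<forall>vs. set vs \<subseteq> Basis \<longrightarrow> iter_deriv vs f differentiable_on S)"

text \<open>Smooth up to the boundary of the open set \<open>S\<close>: all derivatives extend continuously to the
  closure of \<open>S\<close>.\<close>

definition smooth_up_to_boundary ::
  "'a::euclidean_space set \<Rightarrow> ('a \<Rightarrow> 'b::real_normed_vector) \<Rightarrow> bool" where
  "smooth_up_to_boundary S f \<longleftrightarrow>
     smooth_on S f \<and>
     (\<forall>vs. set vs \<subseteq> Basis \<longrightarrow>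
        (\<exists>g. continuous_on (closure S) g \<and> (\<forall>x\<in>S. g x = iter_deriv vs f x)))"

text \<open>Smooth functions with compact support contained in \<open>S\<close>, extended by zero.\<close>

definition test_function ::
  "'a::euclidean_space set \<Rightarrow> ('a \<Rightarrow> 'b::real_normed_vector) \<Rightarrow> bool" where
  "test_function S f \<longleftrightarrow>
     smooth_on UNIV f \<and> compact (closure {x. f x \<noteq> 0}) \<and> closure {x. f x \<noteq> 0} \<subseteq> S"

definition pderiv_at :: "3 \<Rightarrow> (real^3 \<Rightarrow> 'b::real_normed_vector) \<Rightarrow> real^3 \<Rightarrow> 'b" where
  "pderiv_at k f = dir_deriv (axis k 1) f"

definition gradient :: "(real^3 \<Rightarrow> complex) \<Rightarrow> real^3 \<Rightarrow> complex^3" where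
  "gradient f x = (\<chi> k. pderiv_at k f x)"

definition jacobi_matrix :: "(real^3 \<Rightarrow> complex^3) \<Rightarrow> real^3 \<Rightarrow> complex^3^3" where
  "jacobi_matrix \<phi> x = (\<chi> i k. pderiv_at k \<phi> x $ i)"

definition divergence :: "(real^3 \<Rightarrow> complex^3) \<Rightarrow> real^3 \<Rightarrow> complex" where
  "divergence \<phi> x = (\<Sum>k\<in>UNIV. pderiv_at k \<phi> x $ k)"

definition row_divergence :: "(real^3 \<Rightarrow> complex^3^3) \<Rightarrow> real^3 \<Rightarrow> complex^3" where
  "row_divergence \<Psi> x = (\<chi> i. \<Sum>k\<in>UNIV. pderiv_at k \<Psi> x $ i $ k)"

definition laplacian :: "(real^3 \<Rightarrow> complex^3) \<Rightarrow> real^3 \<Rightarrow> complex^3" where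
  "laplacian \<phi> x = (\<Sum>k\<in>UNIV. pderiv_at k (pderiv_at k \<phi>) x)"


section \<open>The spatial operator\<close>

text \<open>Unbounded operators are represented by their graphs.\<close>

definition grad0_graph :: "(real^3) set \<Rightarrow> ((complex^3) L2 \<times> (complex^3^3) L2) set" where
  "grad0_graph \<Omega> = closure {(L2_class \<phi>, L2_class (jacobi_matrix \<phi>)) | \<phi>. test_function \<Omega> \<phi>}"

definition dom_grad0 :: "(real^3) set \<Rightarrow> (complex^3) L2 set" where
  "dom_grad0 \<Omega> = Domain (grad0_graph \<Omega>)"

definition grad0 :: "(real^3) set \<Rightarrow> (complex^3) L2 \<Rightarrow> (complex^3^3) L2" where
  "grad0 \<Omega> \<psi> = (THE \<Psi>. (\<psi>, \<Psi>) \<in> grad0_graph \<Omega>)"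

text \<open>\<open>\<Sum>\<^sub>i \<partial>\<^sub>i \<psi>\<^sub>i\<close>, where \<open>\<partial>\<^sub>i \<psi>\<^sub>i\<close> is a diagonal entry of \<open>grad0 \<Omega> \<psi>\<close>.\<close>

definition div0 :: "(real^3) set \<Rightarrow> (complex^3) L2 \<Rightarrow> complex L2" where
  "div0 \<Omega> \<psi> = L2_map trace (grad0 \<Omega> \<psi>)"

text \<open>The distributional gradient and row-wise divergence as elements of the dual of
  \<open>dom_grad0 \<Omega>\<close>. Elements of the dual are taken to be conjugate-linear, so that \<open>g \<in> L\<^sup>2(\<Omega>)\<^sup>3\<close> is the
  functional \<open>\<lambda>\<phi>. cinner \<phi> g\<close>.\<close>

definition dist_grad :: "(real^3) set \<Rightarrow> complex L2 \<Rightarrow> (complex^3) L2 \<Rightarrow> complex" where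
  "dist_grad \<Omega> \<psi> = (\<lambda>\<phi>. - cinner (div0 \<Omega> \<phi>) \<psi>)"

definition dist_div :: "(real^3) set \<Rightarrow> (complex^3^3) L2 \<Rightarrow> (complex^3) L2 \<Rightarrow> complex" where
  "dist_div \<Omega> \<psi> = (\<lambda>\<phi>. - cinner (grad0 \<Omega> \<phi>) \<psi>)"

type_synonym state = "(complex^3) L2 \<times> complex L2 \<times> (complex^3^3) L2"

definition state_space :: "(real^3) set \<Rightarrow> state set" where
  "state_space \<Omega> = L2_on \<Omega> \<times> L2_on \<Omega> \<times> L2_on \<Omega>"

definition A_graph :: "(real^3) set \<Rightarrow> (state \<times> state) set" where
  "A_graph \<Omega> = {((\<psi>1, \<psi>2, \<psi>3), (g, div0 \<Omega> \<psi>1, - grad0 \<Omega> \<psi>1)) | \<psi>1 \<psi>2 \<psi>3 g.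
     (\<psi>1, \<psi>2, \<psi>3) \<in> state_space \<Omega> \<and> \<psi>1 \<in> dom_grad0 \<Omega> \<and> g \<in> L2_on \<Omega> \<and>
     (\<forall>\<phi>\<in>dom_grad0 \<Omega>. cinner \<phi> g = dist_grad \<Omega> \<psi>2 \<phi> - dist_div \<Omega> \<psi>3 \<phi>)}"


section \<open>Exponentially weighted spaces in time\<close>

text \<open>\<open>Hnu \<nu> H\<close> consists of representatives: its members stand for their classes modulo equality
  almost everywhere, and the closed graphs formed below are invariant under it.\<close>

definition Hnu :: "real \<Rightarrow> 'h::real_normed_vector set \<Rightarrow> (real \<Rightarrow> 'h) set" where
  "Hnu \<nu> H = {f. f \<in> borel_measurable lborel \<and> (\<forall>t. f t \<in> H) \<and>
     integrable lborel (\<lambda>t. (norm (f t))\<^sup>2 * exp (- 2 * \<nu> * t))}"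

definition Hnu_norm :: "real \<Rightarrow> (real \<Rightarrow> 'h::real_normed_vector) \<Rightarrow> real" where
  "Hnu_norm \<nu> f = sqrt (LINT t|lborel. (norm (f t))\<^sup>2 * exp (- 2 * \<nu> * t))"

definition Hnu_limit ::
  "real \<Rightarrow> (nat \<Rightarrow> real \<Rightarrow> 'h::real_normed_vector) \<Rightarrow> (real \<Rightarrow> 'h) \<Rightarrow> bool" where
  "Hnu_limit \<nu> s f \<longleftrightarrow> (\<lambda>n. Hnu_norm \<nu> (\<lambda>t. s n t - f t)) \<longlonglongrightarrow> 0"

definition Hnu_closure ::
  "real \<Rightarrow> 'h::real_normed_vector set \<Rightarrow> ((real \<Rightarrow> 'h) \<times> (real \<Rightarrow> 'h)) set \<Rightarrow>
   ((real \<Rightarrow> 'h) \<times> (real \<Rightarrow> 'h)) set" where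
  "Hnu_closure \<nu> H G = {(u, f) \<in> Hnu \<nu> H \<times> Hnu \<nu> H.
     \<exists>s r. (\<forall>n. (s n, r n) \<in> G \<inter> Hnu \<nu> H \<times> Hnu \<nu> H) \<and> Hnu_limit \<nu> s u \<and> Hnu_limit \<nu> r f}"

definition time_deriv_graph ::
  "real \<Rightarrow> 'h::real_normed_vector set \<Rightarrow> ((real \<Rightarrow> 'h) \<times> (real \<Rightarrow> 'h)) set" where
  "time_deriv_graph \<nu> H = Hnu_closure \<nu> H
     {(\<phi>, \<lambda>t. vector_derivative \<phi> (at t)) | \<phi>. test_function UNIV \<phi> \<and> range \<phi> \<subseteq> H}"

definition pointwise_graph ::
  "real \<Rightarrow> 'h::real_normed_vector set \<Rightarrow> ('h \<times> 'h) set \<Rightarrow>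
   ((real \<Rightarrow> 'h) \<times> (real \<Rightarrow> 'h)) set" where
  "pointwise_graph \<nu> H R = {(u, f) \<in> Hnu \<nu> H \<times> Hnu \<nu> H. AE t in lborel. (u t, f t) \<in> R}"

definition single_valued_AE :: "((real \<Rightarrow> 'h) \<times> (real \<Rightarrow> 'h)) set \<Rightarrow> bool" where
  "single_valued_AE G \<longleftrightarrow> (\<forall>(u, f)\<in>G. \<forall>(v, g)\<in>G.
     (AE t in lborel. u t = v t) \<longrightarrow> (AE t in lborel. f t = g t))"

text \<open>\<open>G\<close> is (the graph of) an operator which is one-to-one and onto and has a bounded inverse.\<close>

definition continuously_invertible ::
  "real \<Rightarrow> 'h::real_normed_vector set \<Rightarrow> ((real \<Rightarrow> 'h) \<times> (real \<Rightarrow> 'h)) set \<Rightarrow> bool" where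
  "continuously_invertible \<nu> H G \<longleftrightarrow>
     single_valued_AE G \<and> single_valued_AE (G\<inverse>) \<and>
     Range G = Hnu \<nu> H \<and>
     (\<exists>K. \<forall>(u, f)\<in>G. Hnu_norm \<nu> u \<le> K * Hnu_norm \<nu> f)"


section \<open>The evolutionary operator\<close>

definition M0 :: "real \<Rightarrow> real \<Rightarrow> real \<Rightarrow> (complex L2 \<Rightarrow> complex L2) \<Rightarrow> state \<Rightarrow> state" where
  "M0 \<tau>0 \<rho> \<kappa> c = (\<lambda>(\<psi>1, \<psi>2, \<psi>3). ((\<tau>0 * inverse \<kappa>) *\<^sub>R \<psi>1, \<rho> *\<^sub>R c \<psi>2, 0))"

definition M1 :: "real \<Rightarrow> (complex^3^3 \<Rightarrow> complex^3^3) \<Rightarrow> state \<Rightarrow> state" where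
  "M1 \<kappa> C = (\<lambda>(\<psi>1, \<psi>2, \<psi>3). (inverse \<kappa> *\<^sub>R \<psi>1, 0, L2_map (inv C) \<psi>3))"

definition T_graph ::
  "real \<Rightarrow> real \<Rightarrow> real \<Rightarrow> (complex^3^3 \<Rightarrow> complex^3^3) \<Rightarrow> (complex L2 \<Rightarrow> complex L2) \<Rightarrow>
   (real^3) set \<Rightarrow> real \<Rightarrow> ((real \<Rightarrow> state) \<times> (real \<Rightarrow> state)) set" where
  "T_graph \<tau>0 \<rho> \<kappa> C c \<Omega> \<nu> =
     {(u, f) \<in> Hnu \<nu> (state_space \<Omega>) \<times> Hnu \<nu> (state_space \<Omega>). \<exists>v a.
        (\<lambda>t. M0 \<tau>0 \<rho> \<kappa> c (u t), v) \<in> time_deriv_graph \<nu> (state_space \<Omega>) \<and>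
        (u, a) \<in> pointwise_graph \<nu> (state_space \<Omega>) (A_graph \<Omega>) \<and>
        (AE t in lborel. f t = v t + M1 \<kappa> C (u t) + a t)}"

end

theory Submission
  imports Defs
begin

text \<open>
  On the state space \<open>H\<close> the operator \<open>A = (0, -B*; B, 0)\<close> with \<open>B = (div0, -grad0)\<close> is skew-selfadjoint,
  and \<open>\<nu> M0 + M1\<close> is strictly positive, so Picard's theorem on evolutionary equations applies. Testing
  \<open>f = (\<partial>\<^sub>0 M0 + M1 + A) u\<close> with \<open>u\<close> gives \<open>\<delta> \<parallel>u\<parallel> \<le> \<parallel>f\<parallel>\<close>, because \<open>\<langle>u, \<partial>\<^sub>0 M0 u\<rangle> = \<nu> \<langle>u, M0 u\<rangle>\<close> in the weighted
  space and \<open>\<langle>u, A u\<rangle> = 0\<close>. Testing with smooth functions of time whose values lie in the dense domain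
  of \<open>A\<close> shows that the closure is an operator. The range is dense: for a right-hand side \<open>\<xi>(t) x\<close> with
  a smooth compactly supported \<open>\<xi>\<close>, the implicit Euler steps
  \<open>(M0 / h + M1 + A) X\<^sub>0 = x\<close> and \<open>(M0 / h + M1 + A) X\<^sub>k\<^sub>+\<^sub>1 = M0 X\<^sub>k / h\<close> yield a genuine element
  \<open>\<Sum>k<n. \<xi>(t - k h) X\<^sub>k\<close> of the domain whose residual tends to \<open>0\<close> as \<open>n \<rightarrow> \<infinity>\<close> and then \<open>h \<rightarrow> 0\<close>, by a
  discrete energy estimate. The Euler
  step itself reduces to a symmetric coercive problem on the graph of \<open>grad0\<close>.
\<close>

section \<open>Square integrable functions with values in a Hilbert space\<close>

text \<open>The natural domain of the sum makes only \<open>M0 u\<close> differentiable in time, and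
  \<open>M0\<close> vanishes on the third component, so u cannot simply be approximated by test
  functions and paired with the time derivative v of \<open>M0 u\<close>. The energy identity is
  proved for w = \<open>M0 u\<close> against \<open>N w\<close> and carried back by v =
  \<open>M0 (N v)\<close>, which holds because w takes values in the range of \<open>M0\<close>. The
  same domain demands that every summand exist separately; finite sums with each state in the domain
  of A meet this without any regularisation.

  The discrete energy estimate is uniform in h only after discounting by powers of a number slightly
  below \<open>exp (- 2 * \<nu>0 * h)\<close>. The gap between \<nu> and \<nu>0 pays for this
  discount and leaves a geometric factor over. Summing the Euler states with that factor costs
  \<open>h^(-1/2)\<close>, while the difference quotient of \<xi> is accurate to order h, so the
  error is of order \<open>h^(1/2)\<close>; the tail is removed by taking n large for fixed h. The
  threshold \<nu>0 can be 1, since \<open>M0 + M1\<close> is already strictly positive: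
  \<open>M1\<close> controls the first and third components and \<open>M0\<close> the
  second.\<close>

definition square_integrable :: "'a measure \<Rightarrow> ('a \<Rightarrow> 'b::real_normed_vector) \<Rightarrow> bool" where
  "square_integrable M f \<longleftrightarrow>
     f \<in> borel_measurable M \<and> integrable M (\<lambda>x. (norm (f x))\<^sup>2)"

text \<open>A seminorm on functions rather than a norm on classes, because \<open>Hnu\<close>
  consists of representatives. The measure is arbitrary since the same calculus serves Lebesgue
  measure in space and the exponentially weighted time line.\<close>

definition l2_norm :: "'a measure \<Rightarrow> ('a \<Rightarrow> 'b::real_normed_vector) \<Rightarrow> real" where
  "l2_norm M f = sqrt (LINT x|M. (norm (f x))\<^sup>2)"

lemma square_integrable_measurable [measurable_dest]:
  "square_integrable M f \<Longrightarrow> f \<in> borel_measurable M"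
  by (simp add: square_integrable_def)

lemma square_integrableD:
  "square_integrable M f \<Longrightarrow> integrable M (\<lambda>x. (norm (f x))\<^sup>2)"
  by (simp add: square_integrable_def)

lemma l2_norm_nonneg [simp]: "0 \<le> l2_norm M f"
  by (simp add: l2_norm_def)

lemma l2_norm_power2: "(l2_norm M f)\<^sup>2 = (LINT x|M. (norm (f x))\<^sup>2)"
  by (simp add: l2_norm_def)

lemma square_integrable_zero [simp]: "square_integrable M (\<lambda>_. 0)"
  by (simp add: square_integrable_def)

lemma l2_norm_zero [simp]: "l2_norm M (\<lambda>_. 0) = 0"
  by (simp add: l2_norm_def)

lemma square_integrable_bound:
  assumes "square_integrable M f" and [measurable]: "g \<in> borel_measurable M"
    and "\<And>x. x \<in> space M \<Longrightarrow> norm (g x) \<le> K * norm (f x)"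
  shows "square_integrable M g"
proof -
  have "integrable M (\<lambda>x. K\<^sup>2 * (norm (f x))\<^sup>2)"
    using assms(1) by (auto simp: square_integrable_def)
  moreover have "(norm (g x))\<^sup>2 \<le> K\<^sup>2 * (norm (f x))\<^sup>2" if "x \<in> space M" for x
    using power_mono[OF assms(3)[OF that], of 2] by (simp add: power_mult_distrib)
  ultimately have "integrable M (\<lambda>x. (norm (g x))\<^sup>2)"
    by (elim Bochner_Integration.integrable_bound) auto
  then show ?thesis by (simp add: square_integrable_def)
qed

lemma l2_norm_bound:
  assumes "square_integrable M f" "g \<in> borel_measurable M" "0 \<le> K"
    and "\<And>x. x \<in> space M \<Longrightarrow> norm (g x) \<le> K * norm (f x)"
  shows "l2_norm M g \<le> K * l2_norm M f"
proof -
  have "(LINT x|M. (norm (g x))\<^sup>2) \<le> (LINT x|M. K\<^sup>2 * (norm (f x))\<^sup>2)"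
  proof (rule integral_mono)
    show "integrable M (\<lambda>x. (norm (g x))\<^sup>2)"
      using square_integrable_bound[OF assms(1,2,4)] by (simp add: square_integrable_def)
    show "integrable M (\<lambda>x. K\<^sup>2 * (norm (f x))\<^sup>2)"
      using assms(1) by (simp add: square_integrable_def)
    show "(norm (g x))\<^sup>2 \<le> K\<^sup>2 * (norm (f x))\<^sup>2" if "x \<in> space M" for x
      using power_mono[OF assms(4)[OF that], of 2] by (simp add: power_mult_distrib)
  qed
  also have "\<dots> = (K * l2_norm M f)\<^sup>2"
    by (simp add: power_mult_distrib l2_norm_power2)
  finally show ?thesis
    using assms(3) by (auto simp: l2_norm_def[of M g] intro!: real_le_lsqrt)
qed

context
  fixes M :: "'a measure"
begin

lemma square_integrable_add:
  fixes f g :: "'a \<Rightarrow> 'b::{real_inner, second_countable_topology}"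
  assumes "square_integrable M f" "square_integrable M g"
  shows "square_integrable M (\<lambda>x. f x + g x)"
proof -
  have [measurable]: "f \<in> borel_measurable M" "g \<in> borel_measurable M"
    using assms by (auto simp: square_integrable_def)
  have "integrable M (\<lambda>x. 2 * (norm (f x))\<^sup>2 + 2 * (norm (g x))\<^sup>2)"
    using assms by (auto simp: square_integrable_def)
  moreover have "(norm (f x + g x))\<^sup>2 \<le> 2 * (norm (f x))\<^sup>2 + 2 * (norm (g x))\<^sup>2" for x
    using inner_ge_zero[of "f x - g x"]
    by (simp add: power2_norm_eq_inner inner_add inner_diff inner_commute)
  ultimately have "integrable M (\<lambda>x. (norm (f x + g x))\<^sup>2)"
    by (elim Bochner_Integration.integrable_bound) auto
  then show ?thesis by (simp add: square_integrable_def)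
qed

lemma square_integrable_scaleR:
  fixes f :: "'a \<Rightarrow> 'b::{real_inner, second_countable_topology}"
  shows "square_integrable M f \<Longrightarrow> square_integrable M (\<lambda>x. r *\<^sub>R f x)"
  by (rule square_integrable_bound[where K = "\<bar>r\<bar>"]) auto

lemma square_integrable_uminus:
  fixes f :: "'a \<Rightarrow> 'b::{real_inner, second_countable_topology}"
  shows "square_integrable M f \<Longrightarrow> square_integrable M (\<lambda>x. - f x)"
  by (rule square_integrable_bound[where K = 1]) auto

lemma square_integrable_diff:
  fixes f g :: "'a \<Rightarrow> 'b::{real_inner, second_countable_topology}"
  assumes "square_integrable M f" "square_integrable M g"
  shows "square_integrable M (\<lambda>x. f x - g x)"
  using square_integrable_add[OF assms(1) square_integrable_uminus[OF assms(2)]] by simp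

lemma square_integrable_sum:
  fixes f :: "'i \<Rightarrow> 'a \<Rightarrow> 'b::{real_inner, second_countable_topology}"
  assumes "\<And>i. i \<in> I \<Longrightarrow> square_integrable M (f i)"
  shows "square_integrable M (\<lambda>x. \<Sum>i\<in>I. f i x)"
  using assms by (induction I rule: infinite_finite_induct) (auto intro: square_integrable_add)

lemma measurable_bounded_linear:
  assumes "bounded_linear L" "f \<in> borel_measurable M"
  shows "(\<lambda>x. L (f x)) \<in> borel_measurable M"
  by (rule borel_measurable_continuous_on[OF linear_continuous_on[OF assms(1)] assms(2)])

lemma square_integrable_bounded_linear:
  assumes "bounded_linear L" "square_integrable M f"
  shows "square_integrable M (\<lambda>x. L (f x))"
proof -
  obtain K where "\<And>x. norm (L x) \<le> norm x * K" using bounded_linear.bounded[OF assms(1)] by blast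
  then show ?thesis
    by (intro square_integrable_bound[where K = K, OF assms(2)]
        measurable_bounded_linear[OF assms(1) square_integrable_measurable[OF assms(2)]])
      (simp add: mult.commute)
qed

lemma integrable_inner:
  fixes f g :: "'a \<Rightarrow> 'b::{real_inner, second_countable_topology}"
  assumes "square_integrable M f" "square_integrable M g"
  shows "integrable M (\<lambda>x. f x \<bullet> g x)"
proof -
  have [measurable]: "f \<in> borel_measurable M" "g \<in> borel_measurable M"
    using assms by (auto simp: square_integrable_def)
  have "integrable M (\<lambda>x. (norm (f x + g x))\<^sup>2)" "integrable M (\<lambda>x. (norm (f x))\<^sup>2)"
    "integrable M (\<lambda>x. (norm (g x))\<^sup>2)"
    using square_integrable_add[OF assms] assms by (auto simp: square_integrable_def)
  then show ?thesis unfolding dot_norm by auto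
qed

lemma l2_norm_eq_inner: "(l2_norm M f)\<^sup>2 = (LINT x|M. f x \<bullet> f x)"
  for f :: "'a \<Rightarrow> 'b::real_inner"
  by (simp add: l2_norm_power2 power2_norm_eq_inner)

text \<open>The squared seminorm of f - t g is a nonnegative quadratic polynomial in t; its value at
  the minimizer b / |g|^2 gives the inequality.\<close>

lemma l2_Cauchy_Schwarz:
  fixes f g :: "'a \<Rightarrow> 'b::{real_inner, second_countable_topology}"
  assumes "square_integrable M f" "square_integrable M g"
  shows "\<bar>LINT x|M. f x \<bullet> g x\<bar> \<le> l2_norm M f * l2_norm M g"
proof -
  define b where "b = (LINT x|M. f x \<bullet> g x)"
  have *: "0 \<le> (l2_norm M f)\<^sup>2 - 2 * t * b + t\<^sup>2 * (l2_norm M g)\<^sup>2" for t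
  proof -
    have "0 \<le> (LINT x|M. (f x - t *\<^sub>R g x) \<bullet> (f x - t *\<^sub>R g x))" by simp
    also have "\<dots> = (LINT x|M. f x \<bullet> f x - (2 * t) * (f x \<bullet> g x) + t\<^sup>2 * (g x \<bullet> g x))"
      by (intro Bochner_Integration.integral_cong)
        (auto simp: inner_diff inner_commute algebra_simps power2_eq_square)
    also have "\<dots> = (l2_norm M f)\<^sup>2 - 2 * t * b + t\<^sup>2 * (l2_norm M g)\<^sup>2"
      using assms by (simp add: integrable_inner l2_norm_eq_inner b_def)
    finally show ?thesis .
  qed
  have "b\<^sup>2 \<le> (l2_norm M f * l2_norm M g)\<^sup>2"
  proof (cases "l2_norm M g = 0")
    case True
    have "b = 0"
    proof (rule ccontr)
      assume "b \<noteq> 0"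
      \<comment> \<open>When g has seminorm 0 the quadratic is affine in t, and at this t it equals
        -|f|^2 - 2.\<close>
      then show False
        using *[of "((l2_norm M f)\<^sup>2 + 1) / b"] True zero_le_power2[of "l2_norm M f"] by simp
    qed
    then show ?thesis by simp
  next
    case False
    have "0 \<le> (l2_norm M g)\<^sup>2 * ((l2_norm M f)\<^sup>2 - 2 * (b / (l2_norm M g)\<^sup>2) * b
        + (b / (l2_norm M g)\<^sup>2)\<^sup>2 * (l2_norm M g)\<^sup>2)"
      by (intro mult_nonneg_nonneg * zero_le_power2)
    also have "\<dots> = (l2_norm M f * l2_norm M g)\<^sup>2 - b\<^sup>2"
      using False by (simp add: field_simps power2_eq_square)
    finally show ?thesis by simp
  qed
  then have "\<bar>b\<bar> \<le> \<bar>l2_norm M f * l2_norm M g\<bar>" by (simp only: abs_le_square_iff)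
  then show ?thesis by (simp add: b_def abs_mult)
qed

lemma l2_norm_triangle:
  fixes f g :: "'a \<Rightarrow> 'b::{real_inner, second_countable_topology}"
  assumes "square_integrable M f" "square_integrable M g"
  shows "l2_norm M (\<lambda>x. f x + g x) \<le> l2_norm M f + l2_norm M g"
proof (rule power2_le_imp_le)
  have "(l2_norm M (\<lambda>x. f x + g x))\<^sup>2 = (LINT x|M. f x \<bullet> f x + 2 * (f x \<bullet> g x) + g x \<bullet> g x)"
    unfolding l2_norm_eq_inner by (intro Bochner_Integration.integral_cong)
      (auto simp: inner_add inner_commute)
  also have "\<dots> = (l2_norm M f)\<^sup>2 + 2 * (LINT x|M. f x \<bullet> g x) + (l2_norm M g)\<^sup>2"
    using assms by (simp add: integrable_inner l2_norm_eq_inner)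
  also have "\<dots> \<le> (l2_norm M f + l2_norm M g)\<^sup>2"
    using l2_Cauchy_Schwarz[OF assms] by (simp add: power2_sum)
  finally show "(l2_norm M (\<lambda>x. f x + g x))\<^sup>2 \<le> (l2_norm M f + l2_norm M g)\<^sup>2" .
qed simp

lemma l2_norm_scaleR: "l2_norm M (\<lambda>x. r *\<^sub>R f x) = \<bar>r\<bar> * l2_norm M f"
  by (simp add: l2_norm_def power_mult_distrib real_sqrt_mult)

lemma l2_norm_uminus: "l2_norm M (\<lambda>x. - f x) = l2_norm M f"
  by (simp add: l2_norm_def)

lemma l2_norm_minus_commute: "l2_norm M (\<lambda>x. f x - g x) = l2_norm M (\<lambda>x. g x - f x)"
  by (simp add: l2_norm_def norm_minus_commute)

lemma l2_norm_triangle_diff: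
  fixes f g h :: "'a \<Rightarrow> 'b::{real_inner, second_countable_topology}"
  assumes "square_integrable M f" "square_integrable M g" "square_integrable M h"
  shows "l2_norm M (\<lambda>x. f x - h x) \<le> l2_norm M (\<lambda>x. f x - g x) + l2_norm M (\<lambda>x. g x - h x)"
  using l2_norm_triangle[of "\<lambda>x. f x - g x" "\<lambda>x. g x - h x"] assms
  by (simp add: square_integrable_diff)

lemma l2_norm_triangle_sub:
  fixes f g :: "'a \<Rightarrow> 'b::{real_inner, second_countable_topology}"
  assumes "square_integrable M f" "square_integrable M g"
  shows "l2_norm M f \<le> l2_norm M g + l2_norm M (\<lambda>x. f x - g x)"
  using l2_norm_triangle[of g "\<lambda>x. f x - g x"] assms by (simp add: square_integrable_diff)

lemma l2_norm_sum:
  fixes f :: "'i \<Rightarrow> 'a \<Rightarrow> 'b::{real_inner, second_countable_topology}"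
  assumes "\<And>i. i \<in> I \<Longrightarrow> square_integrable M (f i)"
  shows "l2_norm M (\<lambda>x. \<Sum>i\<in>I. f i x) \<le> (\<Sum>i\<in>I. l2_norm M (f i))"
  using assms
proof (induction I rule: infinite_finite_induct)
  case (insert i I)
  have "l2_norm M (\<lambda>x. f i x + (\<Sum>i\<in>I. f i x)) \<le> l2_norm M (f i) + l2_norm M (\<lambda>x. \<Sum>i\<in>I. f i x)"
    using insert by (intro l2_norm_triangle square_integrable_sum) auto
  also have "\<dots> \<le> l2_norm M (f i) + (\<Sum>i\<in>I. l2_norm M (f i))" using insert by auto
  finally show ?case using insert by simp
qed auto

lemma l2_norm_eq_0_iff:
  assumes "square_integrable M f"
  shows "l2_norm M f = 0 \<longleftrightarrow> (AE x in M. f x = 0)"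
  using integral_nonneg_eq_0_iff_AE[OF square_integrableD[OF assms]] by (simp add: l2_norm_def)

text \<open>The difference of the pairings splits into one product of two errors and two products of
  an error with a limit, each handled by Cauchy-Schwarz. Through this lemma bilinear identities pass
  from test functions to closed graphs.\<close>

lemma tendsto_l2_inner:
  fixes f :: "nat \<Rightarrow> 'a \<Rightarrow> 'b::{real_inner, second_countable_topology}"
  assumes "\<And>n. square_integrable M (f n)" "square_integrable M f'" "\<And>n. square_integrable M (g n)"
    "square_integrable M g'"
    and f: "(\<lambda>n. l2_norm M (\<lambda>x. f n x - f' x)) \<longlonglongrightarrow> 0"
    and g: "(\<lambda>n. l2_norm M (\<lambda>x. g n x - g' x)) \<longlonglongrightarrow> 0"
  shows "(\<lambda>n. LINT x|M. f n x \<bullet> g n x) \<longlonglongrightarrow> (LINT x|M. f' x \<bullet> g' x)"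
proof (rule LIM_zero_cancel, rule Lim_null_comparison)
  let ?F = "\<lambda>n. l2_norm M (\<lambda>x. f n x - f' x)" and ?G = "\<lambda>n. l2_norm M (\<lambda>x. g n x - g' x)"
  show "(\<lambda>n. ?F n * ?G n + ?F n * l2_norm M g' + l2_norm M f' * ?G n) \<longlonglongrightarrow> 0"
    using tendsto_add[OF tendsto_add[OF tendsto_mult[OF f g] tendsto_mult_right[OF f]]
        tendsto_mult_left[OF g]] by simp
  show "\<forall>\<^sub>F n in sequentially. norm ((LINT x|M. f n x \<bullet> g n x) - (LINT x|M. f' x \<bullet> g' x))
      \<le> ?F n * ?G n + ?F n * l2_norm M g' + l2_norm M f' * ?G n"
  proof (intro always_eventually allI)
    fix n
    have df: "square_integrable M (\<lambda>x. f n x - f' x)" and dg: "square_integrable M (\<lambda>x. g n x - g' x)"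
      using assms by (auto intro: square_integrable_diff)
    have "(LINT x|M. f n x \<bullet> g n x) - (LINT x|M. f' x \<bullet> g' x) =
        (LINT x|M. f n x \<bullet> g n x - f' x \<bullet> g' x)"
      using assms by (simp add: integrable_inner)
    also have "\<dots> = (LINT x|M. (f n x - f' x) \<bullet> (g n x - g' x) + (f n x - f' x) \<bullet> g' x +
        f' x \<bullet> (g n x - g' x))"
      by (intro Bochner_Integration.integral_cong) (auto simp: algebra_simps)
    also have "\<dots> = (LINT x|M. (f n x - f' x) \<bullet> (g n x - g' x)) + (LINT x|M. (f n x - f' x) \<bullet> g' x) +
        (LINT x|M. f' x \<bullet> (g n x - g' x))"
      using assms df dg by (simp add: integrable_inner)
    finally show "norm ((LINT x|M. f n x \<bullet> g n x) - (LINT x|M. f' x \<bullet> g' x))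
      \<le> ?F n * ?G n + ?F n * l2_norm M g' + l2_norm M f' * ?G n"
      using l2_Cauchy_Schwarz[OF df dg] l2_Cauchy_Schwarz[OF df assms(4)]
        l2_Cauchy_Schwarz[OF assms(2) dg] by simp
  qed
qed

lemma tendsto_l2_norm_dominated:
  fixes f :: "nat \<Rightarrow> 'a \<Rightarrow> 'b::{real_inner, second_countable_topology}"
  assumes "\<And>n. f n \<in> borel_measurable M" "f' \<in> borel_measurable M" "square_integrable M g"
    and lim: "\<And>x. x \<in> space M \<Longrightarrow> (\<lambda>n. f n x) \<longlonglongrightarrow> f' x"
    and bound: "\<And>n x. x \<in> space M \<Longrightarrow> norm (f n x - f' x) \<le> norm (g x)"
  shows "(\<lambda>n. l2_norm M (\<lambda>x. f n x - f' x)) \<longlonglongrightarrow> 0"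
proof -
  have "(\<lambda>n. LINT x|M. (norm (f n x - f' x))\<^sup>2) \<longlonglongrightarrow> (LINT x|M. 0)"
  proof (rule integral_dominated_convergence)
    show "integrable M (\<lambda>x. (norm (g x))\<^sup>2)" using assms(3) by (rule square_integrableD)
    show "AE x in M. (\<lambda>n. (norm (f n x - f' x))\<^sup>2) \<longlonglongrightarrow> 0"
      using lim by (intro AE_I2 tendsto_eq_intros) (auto intro: tendsto_norm_zero LIM_zero)
    show "AE x in M. norm ((norm (f n x - f' x))\<^sup>2) \<le> (norm (g x))\<^sup>2" for n
      using bound by (auto intro: power_mono)
  qed (use assms in auto)
  then show ?thesis unfolding l2_norm_def using tendsto_real_sqrt by fastforce
qed

end

lemma l2_norm_diff_le:
  fixes f g :: "'a \<Rightarrow> 'b::{real_inner, second_countable_topology}"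
  assumes "square_integrable M f" "square_integrable M g"
  shows "l2_norm M (\<lambda>x. f x - g x) \<le> l2_norm M f + l2_norm M g"
  using l2_norm_triangle[OF assms(1) square_integrable_uminus[OF assms(2)]]
  by (simp add: l2_norm_uminus)

lemma tendsto_l2_norm:
  fixes s :: "nat \<Rightarrow> 'a \<Rightarrow> 'b::{real_inner, second_countable_topology}"
  assumes s: "\<And>n. square_integrable M (s n)" and u: "square_integrable M u"
    and lim: "(\<lambda>n. l2_norm M (\<lambda>x. s n x - u x)) \<longlonglongrightarrow> 0"
  shows "(\<lambda>n. l2_norm M (s n)) \<longlonglongrightarrow> l2_norm M u"
proof (rule LIM_zero_cancel, rule Lim_null_comparison[OF _ lim], rule always_eventually, rule allI)
  fix n
  have "l2_norm M (s n) \<le> l2_norm M u + l2_norm M (\<lambda>x. s n x - u x)"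
    by (rule l2_norm_triangle_sub[OF s u])
  moreover have "l2_norm M u \<le> l2_norm M (s n) + l2_norm M (\<lambda>x. s n x - u x)"
    using l2_norm_triangle_sub[OF u s[of n]] by (simp only: l2_norm_minus_commute)
  ultimately show "norm (l2_norm M (s n) - l2_norm M u) \<le> l2_norm M (\<lambda>x. s n x - u x)"
    by simp
qed

section \<open>Completeness for functions with values in a Hilbert space\<close>

text \<open>Even \<open>\<Sum>k. 2\<^sup>k \<bar>g k\<bar>\<^sup>2\<close> is integrable, and its finiteness bounds \<open>\<bar>g k\<bar>\<close> by a geometric sequence.\<close>

lemma AE_summable_norm:
  fixes g :: "nat \<Rightarrow> 'a \<Rightarrow> 'b::{real_inner, second_countable_topology}"
  assumes "\<And>k. square_integrable M (g k)" and bound: "\<And>k. l2_norm M (g k) \<le> (1/2) ^ k"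
  shows "AE x in M. summable (\<lambda>k. norm (g k x))"
proof -
  have [measurable]: "g k \<in> borel_measurable M" for k
    using assms(1) by (simp add: square_integrable_def)
  have "(\<integral>\<^sup>+ x. (\<Sum>k. ennreal (2 ^ k * (norm (g k x))\<^sup>2)) \<partial>M) =
      (\<Sum>k. (\<integral>\<^sup>+ x. ennreal (2 ^ k * (norm (g k x))\<^sup>2) \<partial>M))"
    by (rule nn_integral_suminf) measurable
  also have "\<dots> = (\<Sum>k. ennreal (2 ^ k * (l2_norm M (g k))\<^sup>2))"
    using square_integrableD[OF assms(1)] by (simp add: nn_integral_eq_integral l2_norm_power2)
  also have "\<dots> \<le> (\<Sum>k. ennreal ((1/2) ^ k))"
  proof (rule suminf_le)
    fix k
    have "2 ^ k * (l2_norm M (g k))\<^sup>2 \<le> 2 ^ k * ((1/2) ^ k)\<^sup>2"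
      using bound by (intro mult_left_mono power_mono) auto
    also have "\<dots> = (1/2) ^ k" by (simp add: power2_eq_square field_simps)
    finally show "ennreal (2 ^ k * (l2_norm M (g k))\<^sup>2) \<le> ennreal ((1/2) ^ k)"
      by (rule ennreal_leI)
  qed auto
  also have "\<dots> < \<infinity>"
    by (subst suminf_ennreal_eq[of _ "suminf (\<lambda>k. (1/2)^k)"]) (auto intro!: summable_sums summable_geometric)
  finally have "AE x in M. (\<Sum>k. ennreal (2 ^ k * (norm (g k x))\<^sup>2)) \<noteq> \<infinity>"
    by (intro nn_integral_PInf_AE) auto
  then show ?thesis
  proof eventually_elim
    case (elim x)
    then have "summable (\<lambda>k. 2 ^ k * (norm (g k x))\<^sup>2)"
      by (intro summable_suminf_not_top) auto
    then have "Bseq (\<lambda>k. 2 ^ k * (norm (g k x))\<^sup>2)"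
      by (intro convergent_imp_Bseq) (auto simp: convergent_def dest: summable_LIMSEQ_zero)
    then obtain B where B: "B > 0" "\<And>k. norm (2 ^ k * (norm (g k x))\<^sup>2) \<le> B"
      by (auto simp: Bseq_def)
    have le: "norm (norm (g k x)) \<le> sqrt B * (sqrt (1/2)) ^ k" for k
    proof -
      have "(norm (g k x))\<^sup>2 \<le> B * (1/2) ^ k" using B(2)[of k] by (simp add: field_simps)
      then have "sqrt ((norm (g k x))\<^sup>2) \<le> sqrt (B * (1/2) ^ k)" by (rule real_sqrt_le_mono)
      then show ?thesis by (simp add: real_sqrt_mult real_sqrt_power)
    qed
    have "summable (\<lambda>k. sqrt B * (sqrt (1/2)) ^ k)"
      by (intro summable_mult summable_geometric) (auto simp: real_sqrt_divide)
    then show ?case by (rule summable_comparison_test') (rule le)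
  qed
qed

text \<open>A subsequence whose increments decay geometrically converges almost everywhere, and
  Fatou's lemma upgrades this to convergence of the whole sequence in the seminorm. The closed set S
  is carried along because \<open>Hnu\<close> asks for values in the state space at every time, not
  only almost every time.\<close>

proposition l2_complete:
  fixes s :: "nat \<Rightarrow> 'a \<Rightarrow> 'b::{real_inner, banach, second_countable_topology}"
  assumes s: "\<And>n. square_integrable M (s n)"
    and Cauchy: "\<And>e. e > 0 \<Longrightarrow> \<exists>N. \<forall>m\<ge>N. \<forall>n\<ge>N. l2_norm M (\<lambda>x. s m x - s n x) < e"
    and S: "closed S" "0 \<in> S" "\<And>n x. s n x \<in> S"
  obtains f where "square_integrable M f" "(\<lambda>n. l2_norm M (\<lambda>x. s n x - f x)) \<longlonglongrightarrow> 0"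
    "\<And>x. f x \<in> S"
proof -
  have [measurable]: "s n \<in> borel_measurable M" for n
    using s by (simp add: square_integrable_def)
  have "\<exists>N. \<forall>k. (\<forall>m\<ge>N k. \<forall>n\<ge>N k. l2_norm M (\<lambda>x. s m x - s n x) < (1/2) ^ k) \<and> N k \<le> N (Suc k)"
  proof (rule dependent_nat_choice)
    show "\<exists>N. \<forall>m\<ge>N. \<forall>n\<ge>N. l2_norm M (\<lambda>x. s m x - s n x) < (1/2) ^ 0"
      using Cauchy[of 1] by simp
    fix N0 k
    obtain N where N: "\<forall>m\<ge>N. \<forall>n\<ge>N. l2_norm M (\<lambda>x. s m x - s n x) < (1/2) ^ Suc k"
      using Cauchy[of "(1/2) ^ Suc k"] by auto
    show "\<exists>N. (\<forall>m\<ge>N. \<forall>n\<ge>N. l2_norm M (\<lambda>x. s m x - s n x) < (1/2) ^ Suc k) \<and> N0 \<le> N"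
      by (rule exI[of _ "max N N0"]) (use N in auto)
  qed
  then obtain r where r: "\<And>k m n. m \<ge> r k \<Longrightarrow> n \<ge> r k \<Longrightarrow> l2_norm M (\<lambda>x. s m x - s n x) < (1/2) ^ k"
    and r_mono: "\<And>k. r k \<le> r (Suc k)" by blast
  have "AE x in M. summable (\<lambda>k. norm (s (r (Suc k)) x - s (r k) x))"
    using r r_mono by (intro AE_summable_norm square_integrable_diff s less_imp_le) auto
  then have conv: "AE x in M. convergent (\<lambda>k. s (r k) x)"
  proof eventually_elim
    case (elim x)
    have "summable (\<lambda>k. s (r (Suc k)) x - s (r k) x)"
      using elim by (rule summable_norm_cancel)
    then have "(\<lambda>n. \<Sum>k<n. s (r (Suc k)) x - s (r k) x) \<longlonglongrightarrow> (\<Sum>k. s (r (Suc k)) x - s (r k) x)"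
      by (rule summable_LIMSEQ)
    then have "(\<lambda>n. s (r n) x - s (r 0) x) \<longlonglongrightarrow> (\<Sum>k. s (r (Suc k)) x - s (r k) x)"
      by (simp only: sum_lessThan_telescope[of "\<lambda>n. s (r n) x"])
    from tendsto_add[OF this tendsto_const[of "s (r 0) x"]]
    show ?case by (auto simp: convergent_def)
  qed
  \<comment> \<open>On the null set without convergence the value 0 is taken, which lies in S and
    keeps f measurable.\<close>
  define f where "f x = (if convergent (\<lambda>k. s (r k) x) then lim (\<lambda>k. s (r k) x) else 0)" for x
  have [measurable]: "f \<in> borel_measurable M"
    unfolding f_def Cauchy_convergent_iff[symmetric] by measurable
  have lim: "(\<lambda>k. s (r k) x) \<longlonglongrightarrow> f x" if "convergent (\<lambda>k. s (r k) x)" for x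
    using that by (simp add: f_def convergent_LIMSEQ_iff)
  have fS: "f x \<in> S" for x
  proof (cases "convergent (\<lambda>k. s (r k) x)")
    case True
    then show ?thesis using closed_sequentially[OF S(1) _ lim] S(3) by auto
  qed (use S in \<open>simp add: f_def\<close>)
  \<comment> \<open>The bound for \<open>s n - s (r j)\<close> is uniform in j beyond k, so it
    survives the limit inferior over j, where \<open>s (r j)\<close> has become f.\<close>
  have Fatou: "(\<integral>\<^sup>+ x. ennreal ((norm (s n x - f x))\<^sup>2) \<partial>M) \<le> ennreal (((1/2) ^ k)\<^sup>2)"
    if n: "n \<ge> r k" for n k
  proof -
    have "(\<integral>\<^sup>+ x. ennreal ((norm (s n x - f x))\<^sup>2) \<partial>M) =
        (\<integral>\<^sup>+ x. liminf (\<lambda>j. ennreal ((norm (s n x - s (r j) x))\<^sup>2)) \<partial>M)"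
    proof (rule nn_integral_cong_AE)
      show "AE x in M. ennreal ((norm (s n x - f x))\<^sup>2) =
          liminf (\<lambda>j. ennreal ((norm (s n x - s (r j) x))\<^sup>2))"
        using conv
      proof eventually_elim
        case (elim x)
        have "(\<lambda>j. ennreal ((norm (s n x - s (r j) x))\<^sup>2)) \<longlonglongrightarrow> ennreal ((norm (s n x - f x))\<^sup>2)"
          by (intro tendsto_ennrealI tendsto_intros lim elim)
        then show ?case using lim_imp_Liminf[OF sequentially_bot] by metis
      qed
    qed
    also have "\<dots> \<le> liminf (\<lambda>j. \<integral>\<^sup>+ x. ennreal ((norm (s n x - s (r j) x))\<^sup>2) \<partial>M)"
      by (rule nn_integral_liminf) measurable
    also have "\<dots> \<le> ennreal (((1/2) ^ k)\<^sup>2)"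
    proof (rule Liminf_le)
      show "\<forall>\<^sub>F j in sequentially. (\<integral>\<^sup>+ x. ennreal ((norm (s n x - s (r j) x))\<^sup>2) \<partial>M) \<le> ennreal (((1/2) ^ k)\<^sup>2)"
        using eventually_ge_at_top[of k]
      proof eventually_elim
        case (elim j)
        have "r k \<le> r j" using elim r_mono by (rule lift_Suc_mono_le[rotated])
        then have "l2_norm M (\<lambda>x. s n x - s (r j) x) < (1/2) ^ k" using n by (intro r) auto
        then have "(l2_norm M (\<lambda>x. s n x - s (r j) x))\<^sup>2 \<le> ((1/2) ^ k)\<^sup>2"
          by (intro power_mono) auto
        then show ?case
          using square_integrableD[OF square_integrable_diff[OF s s]]
          by (simp add: nn_integral_eq_integral l2_norm_power2 ennreal_leI)
      qed
    qed auto
    finally show ?thesis .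
  qed
  have diff: "square_integrable M (\<lambda>x. s n x - f x)" "l2_norm M (\<lambda>x. s n x - f x) \<le> (1/2) ^ k"
    if n: "n \<ge> r k" for n k
  proof -
    have i: "integrable M (\<lambda>x. (norm (s n x - f x))\<^sup>2)"
      using Fatou[OF n] by (intro integrableI_bounded) (auto simp: less_top[symmetric] top_unique)
    then show "square_integrable M (\<lambda>x. s n x - f x)" by (simp add: square_integrable_def)
    have "(l2_norm M (\<lambda>x. s n x - f x))\<^sup>2 \<le> ((1/2) ^ k)\<^sup>2"
      using Fatou[OF n] i by (simp add: nn_integral_eq_integral l2_norm_power2)
    then show "l2_norm M (\<lambda>x. s n x - f x) \<le> (1/2) ^ k"
      by (rule power2_le_imp_le) simp
  qed
  have "square_integrable M f"
    using square_integrable_diff[OF s diff(1)[of 0 "r 0"], of "r 0"] by simp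
  moreover have "(\<lambda>n. l2_norm M (\<lambda>x. s n x - f x)) \<longlonglongrightarrow> 0"
  proof (rule LIMSEQ_I)
    fix e :: real assume "e > 0"
    then obtain k where k: "(1/2) ^ k < e" using real_arch_pow_inv[of e "1/2"] by auto
    show "\<exists>no. \<forall>n\<ge>no. norm (l2_norm M (\<lambda>x. s n x - f x) - 0) < e"
      using diff(2)[of k] k by (intro exI[of _ "r k"]) (auto intro: le_less_trans)
  qed
  ultimately show ?thesis using fS that by blast
qed

section \<open>Approximation in the seminorm by step functions on boxes\<close>

definition l2_approx ::
  "'a measure \<Rightarrow> ('a \<Rightarrow> 'b::real_normed_vector) set \<Rightarrow> ('a \<Rightarrow> 'b) \<Rightarrow> bool" where
  "l2_approx M G f \<longleftrightarrow> square_integrable M f \<and> (\<forall>e>0. \<exists>g\<in>G. l2_norm M (\<lambda>x. f x - g x) < e)"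

lemma l2_approx_add:
  fixes G :: "('a \<Rightarrow> 'b::{real_inner, second_countable_topology}) set"
  assumes "l2_approx M G f" "l2_approx M G h"
    and G: "\<And>g. g \<in> G \<Longrightarrow> square_integrable M g"
    and add: "\<And>g h. g \<in> G \<Longrightarrow> h \<in> G \<Longrightarrow> (\<lambda>x. g x + h x) \<in> G"
  shows "l2_approx M G (\<lambda>x. f x + h x)"
  unfolding l2_approx_def
proof (intro conjI allI impI)
  show "square_integrable M (\<lambda>x. f x + h x)"
    using assms by (auto simp: l2_approx_def intro: square_integrable_add)
  fix e :: real assume "e > 0"
  then obtain f' h' where f': "f' \<in> G" "l2_norm M (\<lambda>x. f x - f' x) < e / 2"
    and h': "h' \<in> G" "l2_norm M (\<lambda>x. h x - h' x) < e / 2"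
    using assms(1,2) unfolding l2_approx_def by (meson half_gt_zero)
  have "l2_norm M (\<lambda>x. (f x - f' x) + (h x - h' x))
      \<le> l2_norm M (\<lambda>x. f x - f' x) + l2_norm M (\<lambda>x. h x - h' x)"
    using assms(1,2) G[OF f'(1)] G[OF h'(1)]
    by (intro l2_norm_triangle square_integrable_diff) (auto simp: l2_approx_def)
  then have "l2_norm M (\<lambda>x. (f x + h x) - (f' x + h' x)) < e"
    using f' h' by (simp add: algebra_simps)
  then show "\<exists>g\<in>G. l2_norm M (\<lambda>x. (f x + h x) - g x) < e"
    by (intro bexI[of _ "\<lambda>x. f' x + h' x"] add f' h')
qed

lemma l2_approx_lim:
  fixes G :: "('a \<Rightarrow> 'b::{real_inner, second_countable_topology}) set"
  assumes s: "\<And>n::nat. l2_approx M G (s n)" and f: "square_integrable M f"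
    and lim: "(\<lambda>n. l2_norm M (\<lambda>x. s n x - f x)) \<longlonglongrightarrow> 0"
    and G: "\<And>g. g \<in> G \<Longrightarrow> square_integrable M g"
  shows "l2_approx M G f"
  unfolding l2_approx_def
proof (intro conjI allI impI f)
  fix e :: real assume e: "e > 0"
  have "\<forall>\<^sub>F n in sequentially. l2_norm M (\<lambda>x. s n x - f x) < e / 2"
    using order_tendstoD(2)[OF lim, of "e / 2"] e by simp
  then obtain n where n: "l2_norm M (\<lambda>x. s n x - f x) < e / 2"
    by (auto dest: eventually_happens)
  obtain g where g: "g \<in> G" "l2_norm M (\<lambda>x. s n x - g x) < e / 2"
    using s[of n] e unfolding l2_approx_def by (meson half_gt_zero)
  have "l2_norm M (\<lambda>x. f x - g x) \<le> l2_norm M (\<lambda>x. f x - s n x) + l2_norm M (\<lambda>x. s n x - g x)"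
    using s[of n] f G[OF g(1)] by (intro l2_norm_triangle_diff) (auto simp: l2_approx_def)
  then show "\<exists>g\<in>G. l2_norm M (\<lambda>x. f x - g x) < e"
    using n g by (auto simp: l2_norm_minus_commute[of M f] intro!: bexI[of _ g])
qed

lemma square_integrable_indicator:
  fixes y :: "'b::real_inner"
  assumes "E \<in> sets M" "emeasure M E < \<infinity>"
  shows "square_integrable M (\<lambda>x. indicator E x *\<^sub>R y)"
  unfolding square_integrable_def
proof
  have "(\<lambda>x. (norm (indicator E x *\<^sub>R y))\<^sup>2) = (\<lambda>x. indicator E x * (norm y)\<^sup>2)"
    by (auto simp: indicator_def)
  then show "integrable M (\<lambda>x. (norm (indicator E x *\<^sub>R y))\<^sup>2)"
    using assms by (simp add: integrable_real_indicator)
  show "(\<lambda>x. indicator E x *\<^sub>R y) \<in> borel_measurable M"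
    using assms(1) by (intro borel_measurable_continuous_on[OF linear_continuous_on
          [OF bounded_linear_scaleR_left]] borel_measurable_indicator)
qed

lemma l2_norm_indicator_scaleR:
  assumes "E \<in> sets M"
  shows "l2_norm M (\<lambda>x. indicator E x *\<^sub>R y) = sqrt (measure M E) * norm y"
proof -
  have "(\<lambda>x. (norm (indicator E x *\<^sub>R y))\<^sup>2) = (\<lambda>x. indicator E x * (norm y)\<^sup>2)"
    by (auto simp: indicator_def)
  then show ?thesis
    using assms sets.sets_into_space[OF assms]
    by (simp add: l2_norm_def real_sqrt_mult Int_absorb2)
qed

text \<open>Indicators of boxes suffice, by Dynkin's \<open>\<pi>\<close>-\<open>\<lambda>\<close> argument. The values are confined to the
  range of a projection \<open>P\<close>.\<close>

proposition l2_approx_boxes: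
  fixes M :: "'a::euclidean_space measure"
    and G :: "('a \<Rightarrow> 'b::{real_inner, banach, second_countable_topology}) set"
  assumes sets_M: "sets M = sets borel" and fin: "\<And>a b. emeasure M (box a b) < \<infinity>"
    and "open \<Omega>" and P: "bounded_linear P"
    and G: "\<And>g. g \<in> G \<Longrightarrow> square_integrable M g"
    and add: "\<And>g h. g \<in> G \<Longrightarrow> h \<in> G \<Longrightarrow> (\<lambda>x. g x + h x) \<in> G"
    and box: "\<And>a b y e. box a b \<subseteq> \<Omega> \<Longrightarrow> y \<in> D \<Longrightarrow> e > 0 \<Longrightarrow>
        \<exists>g\<in>G. l2_norm M (\<lambda>x. indicator (box a b) x *\<^sub>R y - g x) < e"
    and dense: "\<And>y e. y \<in> range P \<Longrightarrow> e > 0 \<Longrightarrow> \<exists>z\<in>D. norm (y - z) < e"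
    and f: "square_integrable M f" "\<And>x. P (f x) = f x" "\<And>x. x \<notin> \<Omega> \<Longrightarrow> f x = 0"
  shows "l2_approx M G f"
proof -
  note [measurable] = sets_M
  have space_M [simp]: "space M = UNIV" using sets_eq_imp_space_eq[OF sets_M] by simp
  let ?ind = "\<lambda>E y x. indicator E x *\<^sub>R y"
  have box_sets: "box a b \<in> sets M" for a b by (simp add: sets_M)
  have finsub: "emeasure M E < \<infinity>" if "E \<subseteq> F" "F \<in> sets M" "emeasure M F < \<infinity>" for E F
    using emeasure_mono[OF that(1,2)] that(3) by (rule le_less_trans)
  note appr_add = l2_approx_add[OF _ _ G add]
  have boxes: "l2_approx M G (?ind (box a b) y)" if ab: "box a b \<subseteq> \<Omega>" and y: "y \<in> range P" for a b y
    unfolding l2_approx_def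
  proof (intro conjI allI impI square_integrable_indicator box_sets fin)
    fix e :: real assume e: "e > 0"
    define m where "m = sqrt (measure M (box a b))"
    have m: "m \<ge> 0" by (simp add: m_def)
    obtain z where z: "z \<in> D" "norm (y - z) < e / (2 * (m + 1))"
      using dense[OF y, of "e / (2 * (m + 1))"] e m by auto
    obtain g where g: "g \<in> G" "l2_norm M (\<lambda>x. ?ind (box a b) z x - g x) < e / 2"
      using box[OF ab z(1), of "e / 2"] e by auto
    have "l2_norm M (\<lambda>x. ?ind (box a b) y x - g x)
        \<le> l2_norm M (\<lambda>x. ?ind (box a b) y x - ?ind (box a b) z x) + l2_norm M (\<lambda>x. ?ind (box a b) z x - g x)"
      by (intro l2_norm_triangle_diff square_integrable_indicator box_sets fin G g)
    also have "l2_norm M (\<lambda>x. ?ind (box a b) y x - ?ind (box a b) z x) = m * norm (y - z)"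
      using l2_norm_indicator_scaleR[OF box_sets, of a b "y - z"]
      by (simp add: m_def scaleR_diff_right)
    also have "m * norm (y - z) \<le> (m + 1) * (e / (2 * (m + 1)))"
      using m z(2) by (intro mult_mono) auto
    also have "\<dots> = e / 2" using m by (simp add: divide_simps)
    finally show "\<exists>g\<in>G. l2_norm M (\<lambda>x. ?ind (box a b) y x - g x) < e"
      using g by (intro bexI[of _ g]) auto
  qed
  \<comment> \<open>Complements are formed by subtraction, but G is only known to be closed under
    sums; so -y has to be an admissible value along with y.\<close>
  have range_uminus: "- y \<in> range P" if y: "y \<in> range P" for y
  proof -
    obtain x where "y = P x" using y by blast
    then have "- y = P (- x)" by (simp add: linear_neg[OF bounded_linear.linear[OF P]])
    then show ?thesis by (rule range_eqI)
  qed
  have zero: "l2_approx M G (\<lambda>_. 0)"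
    using boxes[of 0 0 "P 0"] by (simp add: box_eq_empty)
  have disj_union: "l2_approx M G (?ind (\<Union>i. F i) y)"
    if F: "\<And>i::nat. F i \<in> sets M" "disjoint_family F" "emeasure M (\<Union>i. F i) < \<infinity>"
      and appr: "\<And>i. l2_approx M G (?ind (F i) y)" for F y
  proof (rule l2_approx_lim[where s = "\<lambda>n. ?ind (\<Union>i<n. F i) y"])
    have U: "(\<Union>i. F i) \<in> sets M" using F(1) by blast
    show "l2_approx M G (?ind (\<Union>i<n. F i) y)" for n
    proof (induction n)
      case (Suc n)
      have "F n \<inter> F i = {}" if "i < n" for i
        using F(2) that unfolding disjoint_family_on_def by (metis UNIV_I less_irrefl)
      then have "F n \<inter> (\<Union>i<n. F i) = {}" by blast
      then have "(\<Union>i<n. F i) \<inter> F n = {}" by (simp only: Int_commute)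
      moreover have "(\<Union>i<Suc n. F i) = (\<Union>i<n. F i) \<union> F n"
        by (simp only: lessThan_Suc UN_insert Un_commute)
      ultimately have "?ind (\<Union>i<Suc n. F i) y = (\<lambda>x. ?ind (\<Union>i<n. F i) y x + ?ind (F n) y x)"
        by (metis (no_types) indicator_add scaleR_add_left)
      then show ?case using appr_add[OF Suc.IH appr[of n]] by metis
    qed (use zero in simp)
    show "square_integrable M (?ind (\<Union>i. F i) y)"
      by (rule square_integrable_indicator[OF U F(3)])
    show "(\<lambda>n. l2_norm M (\<lambda>x. ?ind (\<Union>i<n. F i) y x - ?ind (\<Union>i. F i) y x)) \<longlonglongrightarrow> 0"
    proof (rule tendsto_l2_norm_dominated)
      show "(\<lambda>n. ?ind (\<Union>i<n. F i) y x) \<longlonglongrightarrow> ?ind (\<Union>i. F i) y x" for x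
        by (intro tendsto_intros LIMSEQ_indicator_UN)
      show "norm (?ind (\<Union>i<n. F i) y x - ?ind (\<Union>i. F i) y x) \<le> norm (?ind (\<Union>i. F i) y x)" for n x
        by (auto simp: indicator_def)
      show "square_integrable M (?ind (\<Union>i. F i) y)"
        by (rule square_integrable_indicator[OF U F(3)])
      show "?ind (\<Union>i<n. F i) y \<in> borel_measurable M" for n
      proof (rule square_integrable_measurable[OF square_integrable_indicator])
        show "(\<Union>i<n. F i) \<in> sets M" using F(1) by auto
        show "emeasure M (\<Union>i<n. F i) < \<infinity>" by (rule finsub[OF _ U F(3)]) auto
      qed
      show "?ind (\<Union>i. F i) y \<in> borel_measurable M"
        by (rule square_integrable_measurable[OF square_integrable_indicator[OF U F(3)]])
    qed
  qed (rule G)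
  \<comment> \<open>Working inside one box keeps all measures finite, so that complements relative
    to the box still have square integrable indicators.\<close>
  have in_box: "\<forall>y\<in>range P. l2_approx M G (?ind (E \<inter> box a b) y)"
    if E: "E \<in> sets borel" and ab: "box a b \<subseteq> \<Omega>" for E and a b :: 'a
  proof -
    have "Int_stable (range (\<lambda>(a, b). box a b :: 'a set))"
      by (auto simp: Int_stable_def box_Int_box)
    moreover have "range (\<lambda>(a, b). box a b) \<subseteq> Pow (UNIV :: 'a set)" by auto
    moreover have "E \<in> sigma_sets UNIV (range (\<lambda>(a, b). box a b))"
      using E unfolding borel_eq_box by simp
    ultimately show ?thesis
    proof (induction rule: sigma_sets_induct_disjoint)
      case (basic E)
      then obtain c d where E: "E = box c d" by auto
      obtain p q where pq: "box c d \<inter> box a b = box p q"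
        unfolding box_Int_box by blast
      then have "box p q \<subseteq> \<Omega>" using ab by auto
      then show ?case unfolding E pq using boxes by blast
    next
      case empty
      then show ?case using zero by simp
    next
      case (compl E)
      show ?case
      proof
        fix y assume y: "y \<in> range P"
        have eq: "?ind ((UNIV - E) \<inter> box a b) y = (\<lambda>x. ?ind (box a b) y x + ?ind (E \<inter> box a b) (- y) x)"
          by (rule ext) (simp add: indicator_def)
        show "l2_approx M G (?ind ((UNIV - E) \<inter> box a b) y)"
          unfolding eq
          by (rule appr_add[OF boxes[OF ab y] compl.IH[rule_format, OF range_uminus[OF y]]])
      qed
    next
      case (union F)
      show ?case
      proof
        fix y assume y: "y \<in> range P"
        have F: "F i \<in> sets M" for i
          using union.hyps(2) unfolding sets_M borel_eq_box by auto
        have "(\<Union>i. F i \<inter> box a b) = (\<Union>i. F i) \<inter> box a b" by auto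
        moreover have "l2_approx M G (?ind (\<Union>i. F i \<inter> box a b) y)"
        proof (rule disj_union)
          show "F i \<inter> box a b \<in> sets M" for i using F box_sets by blast
          show "disjoint_family (\<lambda>i. F i \<inter> box a b)"
            using union.hyps(1) by (auto simp: disjoint_family_on_def)
          show "emeasure M (\<Union>i. F i \<inter> box a b) < \<infinity>"
            by (rule finsub[OF _ box_sets fin]) auto
          show "l2_approx M G (?ind (F i \<inter> box a b) y)" for i
            using union.IH y by blast
        qed
        ultimately show "l2_approx M G (?ind ((\<Union>i. F i) \<inter> box a b) y)" by simp
      qed
    qed
  qed
  obtain \<D> where \<D>: "countable \<D>" "\<D> \<subseteq> Pow \<Omega>" "\<And>X. X \<in> \<D> \<Longrightarrow> \<exists>a b. X = box a b" "\<Union>\<D> = \<Omega>"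
    using open_countable_Union_open_box[OF \<open>open \<Omega>\<close>] by metis
  have box00: "box 0 0 = ({} :: 'a set)" by (simp add: box_eq_empty)
  \<comment> \<open>Adjoining the empty box makes the family nonempty even for empty \<Omega>, so
    that it is the range of a sequence.\<close>
  define K where "K = from_nat_into (insert (box 0 0) \<D>)"
  have range_K: "range K = insert (box 0 0) \<D>"
    unfolding K_def by (rule range_from_nat_into) (use \<D>(1) in auto)
  have K_box: "\<exists>a b. K n = box a b \<and> box a b \<subseteq> \<Omega>" for n
  proof -
    have "K n \<in> insert (box 0 0) \<D>" unfolding range_K[symmetric] by (rule rangeI)
    then consider "K n = box 0 0" | "K n \<in> \<D>" by blast
    then show ?thesis
    proof cases
      case 1
      then show ?thesis using box00 by (metis empty_subsetI)
    next
      case 2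
      moreover from this have "K n \<subseteq> \<Omega>" using \<D>(2) by (metis PowD subsetD)
      ultimately show ?thesis using \<D>(3) by metis
    qed
  qed
  have K_UN: "(\<Union>n. K n) = \<Omega>" using range_K \<D>(4) box00 by simp
  have ind: "l2_approx M G (?ind E y)"
    if E: "E \<in> sets M" "E \<subseteq> \<Omega>" "emeasure M E < \<infinity>" and y: "y \<in> range P" for E y
  proof -
    \<comment> \<open>Each disjointed piece lies in a single box of the cover, where
      \<open>in_box\<close> applies; the pieces are reassembled by
      \<open>disj_union\<close>.\<close>
    let ?F = "\<lambda>n. E \<inter> disjointed K n"
    have K_sets: "range K \<subseteq> sets M" using K_box box_sets by (metis image_subsetI)
    have UN: "(\<Union>n. ?F n) = E"
      using UN_disjointed_eq[of K] K_UN E(2) by (simp add: Int_UN_distrib[symmetric] Int_absorb2)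
    have F_sets: "?F n \<in> sets M" for n
      using sets.range_disjointed_sets[OF K_sets] E(1) by blast
    have "l2_approx M G (?ind (\<Union>n. ?F n) y)"
    proof (rule disj_union)
      show "disjoint_family ?F"
        using disjoint_family_disjointed[of K] by (auto simp: disjoint_family_on_def)
      show "emeasure M (\<Union>n. ?F n) < \<infinity>" unfolding UN by (rule E(3))
      show "l2_approx M G (?ind (?F n) y)" for n
      proof -
        obtain a b where ab: "K n = box a b" "box a b \<subseteq> \<Omega>" using K_box by blast
        have eq: "?F n \<inter> box a b = ?F n" using disjointed_subset[of K n] ab(1) by blast
        have "?F n \<in> sets borel" using F_sets by (simp only: sets_M)
        from in_box[OF this ab(2)] y show ?thesis unfolding eq by (rule bspec)
      qed
    qed (rule F_sets)
    then show ?thesis unfolding UN .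
  qed
  have [measurable]: "f \<in> borel_measurable M" using f(1) by (rule square_integrable_measurable)
  obtain s where s: "\<And>i. simple_function M (s i)" "\<And>x. (\<lambda>i. s i x) \<longlonglongrightarrow> f x"
    "\<And>i x. norm (s i x) \<le> 2 * norm (f x)"
    using borel_measurable_implies_sequence_metric[of f M 0] by simp metis
  have s_si: "square_integrable M (s i)" for i
    using s(3) by (intro square_integrable_bound[OF f(1) borel_measurable_simple_function[OF s(1)]])
  obtain B where B: "B \<ge> 0" "\<And>x. norm (P x) \<le> norm x * B"
    using bounded_linear.nonneg_bounded[OF P] by blast
  \<comment> \<open>The simple functions \<open>s i\<close> may take values outside the range of P.
    Applying P corrects this and does not change the limit, because P fixes the values of f.\<close>
  show ?thesis
  proof (rule l2_approx_lim[where s = "\<lambda>i x. P (s i x)"])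
    fix i
    have lev: "s i -` {y} \<in> sets M" for y using simple_functionD(2)[OF s(1)] by simp
    have fin_lev: "emeasure M (s i -` {y}) < \<infinity>" if "y \<noteq> 0" for y
    proof -
      have "integrable M (\<lambda>x. (norm (s i x))\<^sup>2)" using s_si by (rule square_integrableD)
      then have "integrable M (\<lambda>x. indicator (s i -` {y}) x * (norm y)\<^sup>2)"
      proof (rule Bochner_Integration.integrable_bound)
        have "(indicator (s i -` {y}) :: 'a \<Rightarrow> real) \<in> borel_measurable M"
          by (rule borel_measurable_indicator[OF lev])
        then show "(\<lambda>x. indicator (s i -` {y}) x * (norm y)\<^sup>2) \<in> borel_measurable M"
          by (intro borel_measurable_times) auto
      qed (auto simp: indicator_def)
      then show ?thesis
        using that lev by (simp add: integrable_indicator_iff)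
    qed
    have "P (s i x) = (\<Sum>y\<in>range (s i). ?ind (s i -` {y}) (P y) x)" for x
    proof -
      have "P (s i x) = P (\<Sum>y\<in>range (s i). ?ind (s i -` {y}) y x)"
        by (rule arg_cong[of _ _ P], subst simple_function_indicator_representation_banach[OF s(1)])
          (simp_all only: space_M UNIV_I Int_UNIV_right)
      also have "\<dots> = (\<Sum>y\<in>range (s i). ?ind (s i -` {y}) (P y) x)"
        unfolding linear_sum[OF bounded_linear.linear[OF P]]
        by (simp only: linear_cmul[OF bounded_linear.linear[OF P]])
      finally show ?thesis .
    qed
    moreover have "l2_approx M G (\<lambda>x. \<Sum>y\<in>I. ?ind (s i -` {y}) (P y) x)" if "finite I" for I
      using that
    proof induction
      case (insert y I)
      have "l2_approx M G (?ind (s i -` {y}) (P y))"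
      proof (cases "y = 0")
        case True
        then show ?thesis using zero linear_0[OF bounded_linear.linear[OF P]] by simp
      next
        case False
        have "s i -` {y} \<subseteq> \<Omega>"
        proof
          fix x assume "x \<in> s i -` {y}"
          then have "f x \<noteq> 0" using s(3)[of i x] False by auto
          then show "x \<in> \<Omega>" using f(3)[of x] by auto
        qed
        then show ?thesis by (rule ind[OF lev _ fin_lev[OF False] rangeI])
      qed
      from appr_add[OF this insert.IH] show ?case
        unfolding sum.insert[OF insert.hyps] .
    qed (use zero in simp)
    ultimately show "l2_approx M G (\<lambda>x. P (s i x))"
      using simple_functionD(1)[OF s(1), of i] by simp
  next
    show "(\<lambda>i. l2_norm M (\<lambda>x. P (s i x) - f x)) \<longlonglongrightarrow> 0"
    proof (rule tendsto_l2_norm_dominated)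
      show "(\<lambda>i. P (s i x)) \<longlonglongrightarrow> f x" for x
        using bounded_linear.tendsto[OF P s(2)[of x]] f(2)[of x] by simp
      show "square_integrable M (\<lambda>x. (2 * B + 1) *\<^sub>R f x)"
        using f(1) by (rule square_integrable_scaleR)
      show "norm (P (s i x) - f x) \<le> norm ((2 * B + 1) *\<^sub>R f x)" for i x
      proof -
        have "norm (P (s i x) - f x) \<le> norm (P (s i x)) + norm (f x)" by (rule norm_triangle_ineq4)
        also have "norm (P (s i x)) \<le> (2 * norm (f x)) * B"
          using B(2)[of "s i x"] mult_right_mono[OF s(3)[of i x] B(1)] by linarith
        also have "2 * norm (f x) * B + norm (f x) = \<bar>2 * B + 1\<bar> * norm (f x)"
          using B(1) by (simp add: distrib_right)
        finally show ?thesis by (simp only: norm_scaleR)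
      qed
      show "(\<lambda>x. P (s i x)) \<in> borel_measurable M" for i
        by (rule measurable_bounded_linear[OF P borel_measurable_simple_function[OF s(1)]])
    qed measurable
  qed (use f G in auto)
qed

section \<open>Smooth functions with compact support\<close>

text \<open>The classical function exp(-1/y), extended by 0 to the nonpositive half-line, together
  with its multiples by powers of 1/y: the family is closed under differentiation up to linear
  combinations.\<close>

definition flat :: "nat \<Rightarrow> real \<Rightarrow> real" where
  "flat j y = (if y > 0 then inverse y ^ j * exp (- inverse y) else 0)"

lemma flat_tendsto_0: "flat j \<midarrow>0\<rightarrow> 0"
proof (rule filterlim_split_at)
  show "(flat j \<longlongrightarrow> 0) (at_left 0)"
    by (rule tendsto_eventually) (auto simp: flat_def eventually_at_left_field intro: exI[of _ "-1"])
  have "((\<lambda>y. inverse y ^ j / exp (inverse y)) \<longlongrightarrow> 0) (at_right (0::real))"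
    by (rule filterlim_compose[OF tendsto_power_div_exp_0 filterlim_inverse_at_top_right])
  then show "(flat j \<longlongrightarrow> 0) (at_right 0)"
    by (rule Lim_transform_eventually)
      (auto simp: flat_def exp_minus field_simps eventually_at_right_field intro: exI[of _ 1])
qed

text \<open>Away from 0 this is the product rule. At 0 the difference quotient of
  \<open>flat j\<close> is exactly \<open>flat (j + 1)\<close>, which tends to 0 since powers of 1/y
  lose against exp(-1/y).\<close>

lemma DERIV_flat: "(flat j has_real_derivative flat (j + 2) y - real j * flat (j + 1) y) (at y)"
proof -
  consider "y < 0" | "y = 0" | "y > 0" by linarith
  then show ?thesis
  proof cases
    case 1
    have "((\<lambda>_. 0) has_real_derivative flat (j + 2) y - real j * flat (j + 1) y) (at y)"
      using 1 by (simp add: flat_def)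
    then show ?thesis
      by (rule has_field_derivative_transform_within_open[where S = "{..<0}"])
        (use 1 in \<open>auto simp: flat_def\<close>)
  next
    case 2
    have "(\<lambda>h. (flat j (0 + h) - flat j 0) / h) \<midarrow>0\<rightarrow> 0"
    proof (rule Lim_transform_eventually[OF flat_tendsto_0[of "j + 1"]])
      show "\<forall>\<^sub>F h in at 0. flat (j + 1) h = (flat j (0 + h) - flat j 0) / h"
        by (auto simp: flat_def field_simps eventually_at_filter)
    qed
    then show ?thesis using 2 by (simp add: DERIV_def flat_def)
  next
    case 3
    have "((\<lambda>y. inverse y ^ j * exp (- inverse y)) has_real_derivative
        flat (j + 2) y - real j * flat (j + 1) y) (at y)"
      using 3 by (auto intro!: derivative_eq_intros simp: flat_def field_simps power2_eq_square
          simp flip: power_Suc) (cases j; simp add: field_simps)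
    then show ?thesis
      by (rule has_field_derivative_transform_within_open[where S = "{0<..}"])
        (use 3 in \<open>auto simp: flat_def\<close>)
  qed
qed

lemma flat_0_bounds: "0 \<le> flat 0 y" "flat 0 y \<le> 1"
  by (auto simp: flat_def)

lemma flat_0_tendsto_1: "(flat 0 \<longlongrightarrow> 1) at_top"
proof -
  have "((\<lambda>y. exp (- inverse y)) \<longlongrightarrow> exp (- 0)) (at_top :: real filter)"
    by (intro tendsto_intros tendsto_inverse_0_at_top filterlim_ident)
  then have "((\<lambda>y. exp (- inverse y)) \<longlongrightarrow> 1) (at_top :: real filter)" by simp
  then show ?thesis
    by (rule Lim_transform_eventually)
      (auto simp: flat_def intro: eventually_mono[OF eventually_gt_at_top[of 0]])
qed

text \<open>Smoothness constrains all iterated derivatives at once and is awkward to check for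
  products of many factors. This class contains the functions \<open>bump\<close> and is closed
  under directional derivatives, which yields smoothness without computing any of them.\<close>

inductive smooth_scalar :: "('a::euclidean_space \<Rightarrow> real) \<Rightarrow> bool" where
  flat: "smooth_scalar (\<lambda>x. flat j (x \<bullet> v + c))"
| const: "smooth_scalar (\<lambda>_. r)"
| add: "smooth_scalar f \<Longrightarrow> smooth_scalar g \<Longrightarrow> smooth_scalar (\<lambda>x. f x + g x)"
| mult: "smooth_scalar f \<Longrightarrow> smooth_scalar g \<Longrightarrow> smooth_scalar (\<lambda>x. f x * g x)"

lemma smooth_scalar_derivative:
  assumes "smooth_scalar f"
  shows "\<exists>D. (\<forall>x. (f has_derivative D x) (at x)) \<and> (\<forall>v. smooth_scalar (\<lambda>x. D x v))"
  using assms
proof induction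
  case (flat j v c)
  let ?D = "\<lambda>x h. (flat (j + 2) (x \<bullet> v + c) + (- real j) * flat (j + 1) (x \<bullet> v + c)) * (h \<bullet> v)"
  have "((\<lambda>x. flat j (x \<bullet> v + c)) has_derivative ?D x) (at x)" for x
  proof -
    have "(flat j has_derivative (\<lambda>h. (flat (j + 2) (x \<bullet> v + c) - real j * flat (j + 1) (x \<bullet> v + c)) * h))
        (at (x \<bullet> v + c))"
      using DERIV_flat by (rule has_field_derivative_imp_has_derivative)
    moreover have "((\<lambda>x. x \<bullet> v + c) has_derivative (\<lambda>h. h \<bullet> v)) (at x)"
      by (auto intro!: derivative_eq_intros)
    ultimately show ?thesis
      using has_derivative_compose by fastforce
  qed
  moreover have "smooth_scalar (\<lambda>x. ?D x h)" for h
    by (intro smooth_scalar.intros)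
  ultimately show ?case by (intro exI[of _ ?D]) simp
next
  case (const r)
  show ?case by (rule exI[of _ "\<lambda>_ _. 0"]) (auto intro: smooth_scalar.const)
next
  case (add f g)
  then obtain D E where "\<And>x. (f has_derivative D x) (at x)" "\<And>v. smooth_scalar (\<lambda>x. D x v)"
    "\<And>x. (g has_derivative E x) (at x)" "\<And>v. smooth_scalar (\<lambda>x. E x v)" by blast
  then show ?case
    by (intro exI[of _ "\<lambda>x h. D x h + E x h"])
      (auto intro: smooth_scalar.intros has_derivative_add)
next
  case (mult f g)
  then obtain D E where *: "\<And>x. (f has_derivative D x) (at x)" "\<And>v. smooth_scalar (\<lambda>x. D x v)"
    "\<And>x. (g has_derivative E x) (at x)" "\<And>v. smooth_scalar (\<lambda>x. E x v)" by blast
  show ?case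
    by (intro exI[of _ "\<lambda>x h. f x * E x h + D x h * g x"] conjI allI has_derivative_mult
        smooth_scalar.intros mult.hyps *)
qed

lemma smooth_scalar_prod:
  "(\<And>i. i \<in> I \<Longrightarrow> smooth_scalar (f i)) \<Longrightarrow> smooth_scalar (\<lambda>x. \<Prod>i\<in>I. f i x)"
  by (induction I rule: infinite_finite_induct) (auto intro: smooth_scalar.intros)

section \<open>Closure properties of smooth functions and test functions\<close>

lemma iter_deriv_snoc: "iter_deriv (vs @ [v]) f = iter_deriv vs (dir_deriv v f)"
  by (simp add: iter_deriv_def)

lemma dir_derivI: "(f has_derivative D) (at x) \<Longrightarrow> dir_deriv v f x = D v"
  unfolding dir_deriv_def by (simp add: frechet_derivative_at[symmetric])

text \<open>Smooth functions form the largest class of differentiable functions that is stable under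
  basis derivatives. Each closure property below is proved by exhibiting such a class F.\<close>

lemma smooth_on_UNIV_coinduct:
  assumes "F f" and diff: "\<And>f x. F f \<Longrightarrow> f differentiable (at x)"
    and deriv: "\<And>f v. F f \<Longrightarrow> v \<in> Basis \<Longrightarrow> F (dir_deriv v f)"
  shows "smooth_on UNIV f"
  unfolding smooth_on_def
proof (intro allI impI)
  fix vs :: "'a list" assume "set vs \<subseteq> Basis"
  then have "F (iter_deriv vs f)"
    by (induction vs) (use assms(1) deriv in \<open>auto simp: iter_deriv_def\<close>)
  then show "iter_deriv vs f differentiable_on UNIV"
    by (auto simp: differentiable_on_def intro: diff)
qed

lemma smooth_on_UNIV_differentiable: "smooth_on UNIV f \<Longrightarrow> f differentiable (at x)"
  unfolding smooth_on_def differentiable_on_def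
  by (drule spec[of _ "[]"]) (simp add: iter_deriv_def)

lemma smooth_on_UNIV_has_derivative:
  "smooth_on UNIV f \<Longrightarrow> (f has_derivative frechet_derivative f (at x)) (at x)"
  by (simp add: smooth_on_UNIV_differentiable frechet_derivative_works[symmetric])

lemma smooth_on_UNIV_continuous: "smooth_on UNIV f \<Longrightarrow> continuous_on S f"
  by (intro continuous_at_imp_continuous_on ballI differentiable_imp_continuous_within
      smooth_on_UNIV_differentiable)

lemma smooth_on_UNIV_dir_deriv:
  assumes "smooth_on UNIV f" "v \<in> Basis" shows "smooth_on UNIV (dir_deriv v f)"
  unfolding smooth_on_def
proof (intro allI impI)
  fix vs :: "'a list" assume "set vs \<subseteq> Basis"
  then have "set (vs @ [v]) \<subseteq> Basis" using assms(2) by simp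
  then show "iter_deriv vs (dir_deriv v f) differentiable_on UNIV"
    using assms(1) unfolding smooth_on_def iter_deriv_snoc[symmetric] by blast
qed

lemma smooth_scalar_smooth: "smooth_scalar f \<Longrightarrow> smooth_on UNIV f"
proof (erule smooth_on_UNIV_coinduct[where F = smooth_scalar])
  fix f :: "'a \<Rightarrow> real" and x v assume "smooth_scalar f"
  then obtain D where D: "\<And>x. (f has_derivative D x) (at x)" "\<And>v. smooth_scalar (\<lambda>x. D x v)"
    using smooth_scalar_derivative by blast
  show "f differentiable (at x)" using D(1) by (auto simp: differentiable_def)
  have "dir_deriv v f = (\<lambda>x. D x v)" using D(1) by (auto intro: dir_derivI)
  then show "smooth_scalar (dir_deriv v f)" using D(2) by simp
qed

lemma smooth_on_UNIV_add:
  fixes f g :: "'a::euclidean_space \<Rightarrow> 'b::real_normed_vector"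
  assumes "smooth_on UNIV f" "smooth_on UNIV g"
  shows "smooth_on UNIV (\<lambda>x. f x + g x)"
proof (rule smooth_on_UNIV_coinduct
    [where F = "\<lambda>h. \<exists>f g. smooth_on UNIV f \<and> smooth_on UNIV g \<and> h = (\<lambda>x. f x + g x)"])
  show "\<exists>f' g'. smooth_on UNIV f' \<and> smooth_on UNIV g' \<and> (\<lambda>x. f x + g x) = (\<lambda>x. f' x + g' x)"
    using assms by blast
next
  fix h :: "'a \<Rightarrow> 'b" and x v :: 'a
  assume "\<exists>f g. smooth_on UNIV f \<and> smooth_on UNIV g \<and> h = (\<lambda>x. f x + g x)"
  then obtain f g where *: "smooth_on UNIV f" "smooth_on UNIV g" and h: "h = (\<lambda>x. f x + g x)"
    by blast
  note d = has_derivative_add[OF *[THEN smooth_on_UNIV_has_derivative]]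
  show "h differentiable (at x)" unfolding h differentiable_def using d by blast
  assume v: "v \<in> Basis"
  have "dir_deriv v h = (\<lambda>x. dir_deriv v f x + dir_deriv v g x)"
    unfolding h using dir_derivI[OF d] by (auto simp: dir_deriv_def)
  then show "\<exists>f g. smooth_on UNIV f \<and> smooth_on UNIV g \<and> dir_deriv v h = (\<lambda>x. f x + g x)"
    using *[THEN smooth_on_UNIV_dir_deriv[OF _ v]] by blast
qed

lemma dir_deriv_bounded_linear:
  assumes "bounded_linear L" "smooth_on UNIV f"
  shows "dir_deriv v (\<lambda>x. L (f x)) = (\<lambda>x. L (dir_deriv v f x))"
  using dir_derivI[OF bounded_linear.has_derivative[OF assms(1) smooth_on_UNIV_has_derivative[OF assms(2)]]]
  by (auto simp: dir_deriv_def)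

lemma dir_deriv_add:
  assumes "smooth_on UNIV f" "smooth_on UNIV g"
  shows "dir_deriv v (\<lambda>x. f x + g x) = (\<lambda>x. dir_deriv v f x + dir_deriv v g x)"
  using dir_derivI[OF has_derivative_add[OF assms[THEN smooth_on_UNIV_has_derivative]]]
  by (auto simp: dir_deriv_def)

lemma smooth_on_UNIV_bounded_linear:
  fixes f :: "'a::euclidean_space \<Rightarrow> 'b::real_normed_vector"
  assumes L: "bounded_linear L" and "smooth_on UNIV f"
  shows "smooth_on UNIV (\<lambda>x. L (f x) :: 'c::real_normed_vector)"
proof (rule smooth_on_UNIV_coinduct[where F = "\<lambda>h. \<exists>f. smooth_on UNIV f \<and> h = (\<lambda>x. L (f x))"])
  show "\<exists>g. smooth_on UNIV g \<and> (\<lambda>x. L (f x)) = (\<lambda>x. L (g x))"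
    using assms by blast
next
  fix h :: "'a \<Rightarrow> 'c" and v x :: 'a assume "\<exists>f :: 'a \<Rightarrow> 'b. smooth_on UNIV f \<and> h = (\<lambda>x. L (f x))"
  then obtain f :: "'a \<Rightarrow> 'b" where f: "smooth_on UNIV f" and h: "h = (\<lambda>x. L (f x))" by blast
  show "h differentiable (at x)"
    using bounded_linear.has_derivative[OF L smooth_on_UNIV_has_derivative[OF f]]
    unfolding h differentiable_def by blast
  assume "v \<in> Basis"
  then show "\<exists>f. smooth_on UNIV f \<and> dir_deriv v h = (\<lambda>x. L (f x))"
    unfolding h dir_deriv_bounded_linear[OF L f] using smooth_on_UNIV_dir_deriv[OF f] by blast
qed

text \<open>Any compact K outside which f vanishes may stand in for the closed support, which is
  then a closed subset of K. Supports never have to be computed.\<close>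

lemma test_functionI:
  assumes "smooth_on UNIV f" "compact K" "K \<subseteq> S" "\<And>x. x \<notin> K \<Longrightarrow> f x = 0"
  shows "test_function S f"
proof -
  have sub: "closure {x. f x \<noteq> 0} \<subseteq> K"
    by (rule closure_minimal[OF _ compact_imp_closed[OF assms(2)]]) (use assms(4) in blast)
  have "compact (K \<inter> closure {x. f x \<noteq> 0})"
    by (rule compact_Int_closed[OF assms(2) closed_closure])
  then have "compact (closure {x. f x \<noteq> 0})"
    by (simp only: Int_absorb1[OF sub])
  then show ?thesis using sub assms(1,3) unfolding test_function_def by (meson subset_trans)
qed

lemma test_functionE:
  assumes "test_function S f"
  obtains K where "smooth_on UNIV f" "compact K" "K \<subseteq> S" "\<And>x. x \<notin> K \<Longrightarrow> f x = 0"
proof (rule that)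
  show "f x = 0" if "x \<notin> closure {x. f x \<noteq> 0}" for x
    using that closure_subset[of "{x. f x \<noteq> 0}"] by (metis (mono_tags) mem_Collect_eq subsetD)
qed (use assms in \<open>simp_all only: test_function_def\<close>)

lemma test_function_smooth: "test_function S f \<Longrightarrow> smooth_on UNIV f"
  by (simp add: test_function_def)

lemma test_function_outside: "test_function S f \<Longrightarrow> x \<notin> S \<Longrightarrow> f x = 0"
  by (erule test_functionE) blast

lemma test_function_add:
  assumes "test_function S f" "test_function S g"
  shows "test_function S (\<lambda>x. f x + g x)"
proof -
  obtain K where K: "compact K" "K \<subseteq> S" "\<And>x. x \<notin> K \<Longrightarrow> f x = 0"
    by (rule test_functionE[OF assms(1)]) blast
  obtain L where L: "compact L" "L \<subseteq> S" "\<And>x. x \<notin> L \<Longrightarrow> g x = 0"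
    by (rule test_functionE[OF assms(2)]) blast
  show ?thesis
    by (rule test_functionI[of _ "K \<union> L"])
      (use K L assms in \<open>auto intro: smooth_on_UNIV_add test_function_smooth\<close>)
qed

lemma test_function_bounded_linear:
  assumes "bounded_linear L" "test_function S f"
  shows "test_function S (\<lambda>x. L (f x))"
proof -
  obtain K where K: "compact K" "K \<subseteq> S" "\<And>x. x \<notin> K \<Longrightarrow> f x = 0"
    by (rule test_functionE[OF assms(2)]) blast
  have "L 0 = 0" using linear_0[OF bounded_linear.linear[OF assms(1)]] .
  show ?thesis
  proof (rule test_functionI[OF _ K(1,2)])
    show "smooth_on UNIV (\<lambda>x. L (f x))"
      by (rule smooth_on_UNIV_bounded_linear[OF assms(1) test_function_smooth[OF assms(2)]])
    show "L (f x) = 0" if "x \<notin> K" for x using K(3)[OF that] \<open>L 0 = 0\<close> by (simp only:)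
  qed
qed

lemma smooth_on_UNIV_zero: "smooth_on UNIV (\<lambda>_. 0 :: 'b::real_normed_vector)"
  using smooth_on_UNIV_bounded_linear[OF bounded_linear_scaleR_left[of "0::'b"] smooth_scalar_smooth
      [OF smooth_scalar.const]] by simp

lemma test_function_zero: "test_function S (\<lambda>_. 0)"
  by (rule test_functionI[of _ "{}"]) (auto intro: smooth_on_UNIV_zero)

lemma test_function_sum:
  "(\<And>i. i \<in> I \<Longrightarrow> test_function S (f i)) \<Longrightarrow> test_function S (\<lambda>x. \<Sum>i\<in>I. f i x)"
  by (induction I rule: infinite_finite_induct) (auto intro: test_function_add test_function_zero)

lemma has_derivative_outside_support:
  assumes "(f has_derivative D) (at x)" "closed K" "x \<notin> K" "\<And>x. x \<notin> K \<Longrightarrow> f x = 0"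
  shows "D = (\<lambda>_. 0)"
proof -
  have "((\<lambda>_. 0) has_derivative D) (at x)"
    by (rule has_derivative_transform_within_open[OF assms(1), of "- K"]) (use assms in auto)
  then show ?thesis by (rule has_derivative_unique) simp
qed

lemma test_function_dir_deriv:
  assumes f: "test_function S f" and v: "v \<in> Basis"
  shows "test_function S (dir_deriv v f)"
proof -
  obtain K where K: "smooth_on UNIV f" "compact K" "K \<subseteq> S" "\<And>x. x \<notin> K \<Longrightarrow> f x = 0"
    by (rule test_functionE[OF f]) blast
  have "dir_deriv v f x = 0" if "x \<notin> K" for x
    using has_derivative_outside_support[OF smooth_on_UNIV_has_derivative[OF K(1)]
        compact_imp_closed[OF K(2)] that] K(4) by (simp add: dir_deriv_def)
  then show ?thesis by (rule test_functionI[OF smooth_on_UNIV_dir_deriv[OF K(1) v] K(2,3)])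
qed

lemma integrable_continuous_compact_support:
  fixes f :: "'a::euclidean_space \<Rightarrow> real"
  assumes "continuous_on UNIV f" "compact K" "\<And>x. x \<notin> K \<Longrightarrow> f x = 0"
  shows "integrable lborel f"
proof -
  have "integrable lborel (\<lambda>x. indicator K x *\<^sub>R f x)"
    using assms by (intro borel_integrable_compact) (auto intro: continuous_on_subset)
  moreover have "(\<lambda>x. indicator K x *\<^sub>R f x) = f"
    using assms(3) by (auto simp: indicator_def fun_eq_iff)
  ultimately show ?thesis by simp
qed

text \<open>Each factor vanishes within distance 1/n of its face of the box and tends to 1 at
  interior points, because \<open>flat 0\<close> is 0 on the nonpositive half-line and tends to 1 at
  infinity. So the functions are supported in compact subsets of the open box and converge to its
  indicator; for n = 0 all factors are 0.\<close>

definition bump :: "'a::euclidean_space \<Rightarrow> 'a \<Rightarrow> nat \<Rightarrow> 'a \<Rightarrow> real" where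
  "bump a b n x = (\<Prod>i\<in>Basis. flat 0 (real n * (x \<bullet> i - a \<bullet> i) - 1) * flat 0 (real n * (b \<bullet> i - x \<bullet> i) - 1))"

lemma smooth_scalar_bump: "smooth_scalar (bump a b n)"
proof -
  have "smooth_scalar (\<lambda>x. flat 0 (real n * (x \<bullet> i - a \<bullet> i) - 1))"
    "smooth_scalar (\<lambda>x. flat 0 (real n * (b \<bullet> i - x \<bullet> i) - 1))" for i
    using smooth_scalar.flat[of 0 "real n *\<^sub>R i" "- real n * (a \<bullet> i) - 1"]
      smooth_scalar.flat[of 0 "- real n *\<^sub>R i" "real n * (b \<bullet> i) - 1"]
    by (simp_all add: algebra_simps)
  then show ?thesis
    unfolding bump_def by (intro smooth_scalar_prod smooth_scalar.mult)
qed

lemma bump_bounds: "0 \<le> bump a b n x" "bump a b n x \<le> 1"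
  unfolding bump_def
  by (auto intro!: prod_nonneg prod_le_1 mult_nonneg_nonneg flat_0_bounds mult_le_one)

lemma bump_support:
  assumes "x \<notin> cbox (a + inverse (real n) *\<^sub>R One) (b - inverse (real n) *\<^sub>R One)" "n > 0"
  shows "bump a b n x = 0"
proof -
  obtain i :: 'a where i: "i \<in> Basis" and "\<not> (a \<bullet> i + inverse (real n) \<le> x \<bullet> i \<and> x \<bullet> i \<le> b \<bullet> i - inverse (real n))"
    using assms(1) unfolding mem_box by (auto simp: inner_add_left inner_diff_left)
  then have "real n * (x \<bullet> i - a \<bullet> i) \<le> 1 \<or> real n * (b \<bullet> i - x \<bullet> i) \<le> 1"
    using assms(2) by (auto simp: field_simps)
  then have "flat 0 (real n * (x \<bullet> i - a \<bullet> i) - 1) * flat 0 (real n * (b \<bullet> i - x \<bullet> i) - 1) = 0"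
    by (auto simp: flat_def)
  then show ?thesis unfolding bump_def using i by (intro prod_zero) auto
qed

lemma test_function_bump:
  assumes "box a b \<subseteq> S" "n > 0" shows "test_function S (bump a b n)"
proof (rule test_functionI)
  have "cbox (a + inverse (real n) *\<^sub>R One) (b - inverse (real n) *\<^sub>R One) \<subseteq> box a b"
  proof
    fix x assume x: "x \<in> cbox (a + inverse (real n) *\<^sub>R One) (b - inverse (real n) *\<^sub>R One)"
    have n: "inverse (real n) > 0" using assms(2) by simp
    have "a \<bullet> i < x \<bullet> i \<and> x \<bullet> i < b \<bullet> i" if i: "i \<in> Basis" for i
    proof -
      have "a \<bullet> i + inverse (real n) \<le> x \<bullet> i" "x \<bullet> i \<le> b \<bullet> i - inverse (real n)"
        using x i unfolding mem_box by (auto simp: inner_add_left inner_diff_left)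
      then show ?thesis using n by linarith
    qed
    then show "x \<in> box a b" by (simp add: mem_box)
  qed
  then show "cbox (a + inverse (real n) *\<^sub>R One) (b - inverse (real n) *\<^sub>R One) \<subseteq> S"
    using assms(1) by blast
qed (rule smooth_scalar_smooth[OF smooth_scalar_bump] compact_cbox bump_support[OF _ assms(2)]; assumption)+

lemma bump_tendsto_indicator: "(\<lambda>n. bump a b n x) \<longlonglongrightarrow> indicator (box a b) x"
proof (cases "x \<in> box a b")
  case True
  have lim: "(\<lambda>n. flat 0 (real n * c - 1)) \<longlonglongrightarrow> 1" if "c > 0" for c
  proof (rule filterlim_compose[OF flat_0_tendsto_1])
    have "LIM n sequentially. - 1 + c * real n :> at_top"
      using that by (intro filterlim_tendsto_add_at_top[OF tendsto_const]
          filterlim_tendsto_pos_mult_at_top[OF tendsto_const] filterlim_real_sequentially)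
    then show "LIM n sequentially. real n * c - 1 :> at_top" by (simp add: algebra_simps)
  qed
  have "(\<lambda>n. bump a b n x) \<longlonglongrightarrow> (\<Prod>i\<in>(Basis::'a set). 1 * 1)"
    unfolding bump_def using True by (intro tendsto_prod tendsto_mult lim) (auto simp: mem_box)
  then show ?thesis using True by simp
next
  case False
  have "bump a b n x = 0" for n
  proof (cases "n = 0")
    case True
    obtain i :: 'a where "i \<in> Basis" using nonempty_Basis by blast
    then show ?thesis unfolding bump_def using True by (intro prod_zero) (auto simp: flat_def)
  next
    case n: False
    have "test_function (box a b) (bump a b n)" using n by (intro test_function_bump) auto
    then show ?thesis using False by (rule test_function_outside)
  qed
  then show ?thesis using False by simp
qed

section \<open>Integration by parts\<close>

lemma lborel_integral_translate:
  fixes f :: "'a::euclidean_space \<Rightarrow> real"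
  assumes "f \<in> borel_measurable borel"
  shows "(LINT x|lborel. f (c + x)) = (LINT x|lborel. f x)"
proof -
  have "(LINT x|lborel. f x) = (LINT x|distr lborel borel ((+) c). f x)"
    by (simp add: lborel_distr_plus)
  also have "\<dots> = (LINT x|lborel. f (c + x))"
    using assms by (intro integral_distr) auto
  finally show ?thesis by simp
qed

text \<open>The difference quotients have integral \<open>0\<close> by translation invariance.\<close>

lemma integral_derivative_compact_support:
  fixes F :: "'a::euclidean_space \<Rightarrow> real"
  assumes F: "\<And>x. (F has_derivative F' x) (at x)" and cont: "continuous_on UNIV (\<lambda>x. F' x v)"
    and K: "compact K" "\<And>x. x \<notin> K \<Longrightarrow> F x = 0"
  shows "(LINT x|lborel. F' x v) = 0"
proof -
  define d where "d x = F' x v" for x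
  have d_supp: "d x = 0" if "x \<notin> K" for x
    using has_derivative_outside_support[OF F compact_imp_closed[OF K(1)] that K(2)] by (simp add: d_def)
  have contF: "continuous_on UNIV F"
    using F by (auto intro!: continuous_at_imp_continuous_on has_derivative_continuous)
  have [measurable]: "F \<in> borel_measurable borel" "d \<in> borel_measurable borel"
    using contF cont by (auto intro: borel_measurable_continuous_onI simp: d_def[abs_def])
  have intF: "integrable lborel F"
    by (rule integrable_continuous_compact_support[OF contF K])
  obtain B where B: "\<And>x. \<bar>d x\<bar> \<le> B" "B \<ge> 0"
  proof -
    have "bounded (d ` K)"
      using K(1) cont unfolding d_def[abs_def]
      by (intro compact_imp_bounded compact_continuous_image) (auto intro: continuous_on_subset)
    then obtain B where "B > 0" "\<And>x. x \<in> K \<Longrightarrow> \<bar>d x\<bar> \<le> B"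
      by (auto simp: bounded_pos)
    then show ?thesis using that[of B] d_supp by (metis abs_zero less_imp_le)
  qed
  obtain R where R: "\<And>x. x \<in> K \<Longrightarrow> norm x \<le> R"
    using compact_imp_bounded[OF K(1)] by (auto simp: bounded_iff)
  define t where "t n = inverse (real (Suc n))" for n
  have t: "0 < t n" "t n \<le> 1" for n by (auto simp: t_def field_simps)
  have line: "((\<lambda>s. F (x + s *\<^sub>R v)) has_real_derivative d (x + s *\<^sub>R v)) (at s)" for x s
  proof -
    have "((\<lambda>s. x + s *\<^sub>R v) has_derivative (\<lambda>h. h *\<^sub>R v)) (at s)"
      by (auto intro!: derivative_eq_intros)
    from has_derivative_compose[OF this F]
    have "((\<lambda>s. F (x + s *\<^sub>R v)) has_derivative (\<lambda>h. F' (x + s *\<^sub>R v) (h *\<^sub>R v))) (at s)" .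
    moreover have "(\<lambda>h. F' (x + s *\<^sub>R v) (h *\<^sub>R v)) = (*) (d (x + s *\<^sub>R v))"
      by (auto simp: d_def linear_cmul[OF has_derivative_linear[OF F]])
    ultimately show ?thesis by (simp add: has_field_derivative_def)
  qed
  define q where "q n x = (F (x + t n *\<^sub>R v) - F x) / t n" for n x
  have q_int: "(LINT x|lborel. q n x) = 0" for n
  proof -
    have "(LINT x|lborel. F (x + t n *\<^sub>R v)) = (LINT x|lborel. F x)"
      using lborel_integral_translate[of F "t n *\<^sub>R v"] by (simp add: add.commute)
    moreover have "integrable lborel (\<lambda>x. F (x + t n *\<^sub>R v))"
    proof (rule integrable_continuous_compact_support[where K = "(\<lambda>x. x - t n *\<^sub>R v) ` K"])
      show "continuous_on UNIV (\<lambda>x. F (x + t n *\<^sub>R v))"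
        by (intro continuous_on_compose2[OF contF] continuous_intros) auto
      show "compact ((\<lambda>x. x - t n *\<^sub>R v) ` K)"
        by (intro compact_continuous_image K continuous_intros)
      show "F (x + t n *\<^sub>R v) = 0" if "x \<notin> (\<lambda>x. x - t n *\<^sub>R v) ` K" for x
        using that by (intro K(2)) (metis add_diff_cancel_right' image_eqI)
    qed
    ultimately show ?thesis using intF by (simp add: q_def)
  qed
  have "(\<lambda>n. LINT x|lborel. q n x) \<longlonglongrightarrow> (LINT x|lborel. d x)"
  proof (rule integral_dominated_convergence)
    \<comment> \<open>By the mean value theorem \<open>q n x\<close> is a value of the derivative at
      distance at most \<open>norm v\<close> from x, as \<open>t n\<close> is at most 1. Hence it is
      bounded by B and vanishes for x outside the ball of radius \<open>R + norm v\<close>.\<close>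
    show "integrable lborel (\<lambda>x::'a. B * indicator (cball 0 (R + norm v)) x)"
      using emeasure_bounded_finite[OF bounded_cball[of "0::'a" "R + norm v"]]
      by (intro integrable_mult_right integrable_real_indicator) auto
    show "AE x in lborel. (\<lambda>n. q n x) \<longlonglongrightarrow> d x"
    proof (rule AE_I2)
      fix x
      have "(\<lambda>h. (F (x + h *\<^sub>R v) - F x) / h) \<midarrow>0\<rightarrow> d x"
        using line[of x 0] by (simp add: DERIV_def)
      moreover have "filterlim t (at 0) sequentially"
        unfolding t_def[abs_def] using LIMSEQ_inverse_real_of_nat by (rule filterlim_atI) auto
      ultimately show "(\<lambda>n. q n x) \<longlonglongrightarrow> d x"
        unfolding q_def by (rule filterlim_compose)
    qed
    show "AE x in lborel. norm (q n x) \<le> B * indicator (cball 0 (R + norm v)) x" for n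
    proof (rule AE_I2)
      fix x
      have "\<exists>z. 0 < z \<and> z < t n \<and> F (x + t n *\<^sub>R v) - F (x + 0 *\<^sub>R v) = (t n - 0) * d (x + z *\<^sub>R v)"
        using t(1) line by (intro MVT2) auto
      then obtain z where z: "0 < z" "z < t n" "q n x = d (x + z *\<^sub>R v)"
        using t(1)[of n] by (auto simp: q_def)
      show "norm (q n x) \<le> B * indicator (cball 0 (R + norm v)) x"
      proof (cases "x + z *\<^sub>R v \<in> K")
        case True
        have "norm x \<le> norm (x + z *\<^sub>R v) + norm (z *\<^sub>R v)"
          using norm_triangle_ineq4[of "x + z *\<^sub>R v" "z *\<^sub>R v"] by simp
        also have "\<dots> \<le> R + norm v"
        proof (rule add_mono[OF R[OF True]])
          have "\<bar>z\<bar> \<le> 1" using z t(2)[of n] by linarith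
          then show "norm (z *\<^sub>R v) \<le> norm v" by (simp add: mult_left_le_one_le)
        qed
        finally show ?thesis using B z(3) by (simp add: indicator_def dist_norm)
      next
        case False
        then show ?thesis using d_supp z(3) B(2) by simp
      qed
    qed
    show "q n \<in> borel_measurable lborel" for n unfolding q_def[abs_def] by measurable
  qed measurable
  then have "(LINT x|lborel. d x) = 0" unfolding q_int by (simp add: LIMSEQ_const_iff)
  then show ?thesis by (simp add: d_def)
qed

text \<open>The scalar function x \<mapsto> f x \<bullet> g x inherits compact support from f alone,
  so its derivative integrates to 0. Leaving g unrestricted at infinity allows it to absorb the
  exponential weight later.\<close>

lemma integral_by_parts_inner:
  fixes f g :: "'a::euclidean_space \<Rightarrow> 'b::real_inner"
  assumes f: "\<And>x. (f has_derivative f' x) (at x)" "continuous_on UNIV (\<lambda>x. f' x v)"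
    and g: "\<And>x. (g has_derivative g' x) (at x)" "continuous_on UNIV (\<lambda>x. g' x v)"
    and K: "compact K" "\<And>x. x \<notin> K \<Longrightarrow> f x = 0"
  shows "(LINT x|lborel. f' x v \<bullet> g x) = - (LINT x|lborel. f x \<bullet> g' x v)"
proof -
  have cf: "continuous_on UNIV f" and cg: "continuous_on UNIV g"
    using f g by (auto intro!: continuous_at_imp_continuous_on has_derivative_continuous)
  have supp: "f' x v = 0" if "x \<notin> K" for x
    using has_derivative_outside_support[OF f(1) compact_imp_closed[OF K(1)] that K(2)] by simp
  have i1: "integrable lborel (\<lambda>x. f' x v \<bullet> g x)"
    by (rule integrable_continuous_compact_support[OF _ K(1)])
      (auto intro!: continuous_intros f g cg simp: supp)
  have i2: "integrable lborel (\<lambda>x. f x \<bullet> g' x v)"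
    by (rule integrable_continuous_compact_support[OF _ K(1)])
      (auto intro!: continuous_intros f g cf simp: K)
  have "(LINT x|lborel. f x \<bullet> g' x v + f' x v \<bullet> g x) = 0"
  proof (rule integral_derivative_compact_support[where F = "\<lambda>x. f x \<bullet> g x" and K = K and v = v
        and F' = "\<lambda>x h. f x \<bullet> g' x h + f' x h \<bullet> g x"])
    show "((\<lambda>x. f x \<bullet> g x) has_derivative (\<lambda>h. f x \<bullet> g' x h + f' x h \<bullet> g x)) (at x)" for x
      by (rule has_derivative_inner[OF f(1) g(1)])
    show "continuous_on UNIV (\<lambda>x. f x \<bullet> g' x v + f' x v \<bullet> g x)"
      by (intro continuous_intros cf cg f g)
  qed (use K in auto)
  then show ?thesis using i1 i2 by simp
qed

section \<open>Completeness and separability of \<open>L\<^sup>2\<close>\<close>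

lemma sq_integrable_iff: "sq_integrable f \<longleftrightarrow> square_integrable lborel f"
  by (simp add: sq_integrable_def square_integrable_def)

lemma L2_class_eq_abs: "sq_integrable f \<Longrightarrow> L2_class f = abs_L2 f"
  by (simp add: L2_class_def)

lemma sq_integrable_rep_L2: "sq_integrable (rep_L2 F)"
  using Quotient3_rep_reflp[OF Quotient3_L2] by simp

lemma L2_class_rep_L2 [simp]: "L2_class (rep_L2 F) = F"
  by (simp add: L2_class_eq_abs sq_integrable_rep_L2 Quotient3_abs_rep[OF Quotient3_L2])

lemma AE_rep_L2_class: "sq_integrable f \<Longrightarrow> AE x in lborel. rep_L2 (L2_class f) x = f x"
  using Quotient3_rep_abs[OF Quotient3_L2, of f] by (simp add: L2_class_eq_abs)

lemma L2_class_cong: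
  assumes "sq_integrable f" "sq_integrable g" "AE x in lborel. f x = g x"
  shows "L2_class f = L2_class g"
  using assms Quotient3_rel_abs[OF Quotient3_L2, of f g] by (simp add: L2_class_eq_abs)

lemma inner_L2_class:
  assumes "sq_integrable f" "sq_integrable g"
  shows "L2_class f \<bullet> L2_class g = (LINT x|lborel. f x \<bullet> g x)"
  using assms by (transfer fixing: f g) simp

lemma L2_class_add:
  assumes "sq_integrable f" "sq_integrable g"
  shows "L2_class (\<lambda>x. f x + g x) = L2_class f + L2_class g"
  using assms sq_integrable_add[OF assms] by (transfer fixing: f g) auto

lemma L2_class_diff:
  assumes "sq_integrable f" "sq_integrable g"
  shows "L2_class (\<lambda>x. f x - g x) = L2_class f - L2_class g"
  using assms sq_integrable_diff[OF assms] by (transfer fixing: f g) auto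

lemma L2_class_scaleR:
  assumes "sq_integrable f"
  shows "L2_class (\<lambda>x. r *\<^sub>R f x) = r *\<^sub>R L2_class f"
  using assms sq_integrable_scaleR[OF assms] by (transfer fixing: f r) auto

lemma L2_class_scaleC:
  assumes "sq_integrable f"
  shows "L2_class (\<lambda>x. a *\<^sub>C f x) = a *\<^sub>C L2_class f"
  using assms sq_integrable_scaleC[OF assms] by (transfer fixing: f a) auto

lemma norm_L2_class:
  assumes "sq_integrable f"
  shows "norm (L2_class f) = l2_norm lborel f"
proof -
  have "(norm (L2_class f))\<^sup>2 = (l2_norm lborel f)\<^sup>2"
    unfolding power2_norm_eq_inner inner_L2_class[OF assms assms] l2_norm_eq_inner ..
  then show ?thesis by simp
qed

lemma norm_L2_eq: "norm F = l2_norm lborel (rep_L2 F)"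
  using norm_L2_class[OF sq_integrable_rep_L2, of F] by simp

lemma norm_L2_class_diff:
  assumes "sq_integrable f" "sq_integrable g"
  shows "norm (L2_class f - L2_class g) = l2_norm lborel (\<lambda>x. f x - g x)"
  using norm_L2_class[OF sq_integrable_diff[OF assms]] by (simp add: L2_class_diff[OF assms])

instance L2 :: ("{euclidean_space, complex_inner}") banach
proof
  fix X :: "nat \<Rightarrow> 'a L2"
  assume X: "Cauchy X"
  have eq: "l2_norm lborel (\<lambda>x. rep_L2 (X m) x - rep_L2 (X n) x) = norm (X m - X n)" for m n
    using norm_L2_class_diff[OF sq_integrable_rep_L2[of "X m"] sq_integrable_rep_L2[of "X n"]] by simp
  obtain f where f: "square_integrable lborel f"
      "(\<lambda>n. l2_norm lborel (\<lambda>x. rep_L2 (X n) x - f x)) \<longlonglongrightarrow> 0"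
  proof (rule l2_complete[where s = "\<lambda>n. rep_L2 (X n)" and M = lborel and S = UNIV])
    show "square_integrable lborel (rep_L2 (X n))" for n
      using sq_integrable_rep_L2 by (simp add: sq_integrable_iff)
    show "\<exists>N. \<forall>m\<ge>N. \<forall>n\<ge>N. l2_norm lborel (\<lambda>x. rep_L2 (X m) x - rep_L2 (X n) x) < e" if "e > 0" for e
      using CauchyD[OF X that] unfolding eq by blast
  qed auto
  have "norm (X n - L2_class f) = l2_norm lborel (\<lambda>x. rep_L2 (X n) x - f x)" for n
    using norm_L2_class_diff[OF sq_integrable_rep_L2[of "X n"], of f] f(1) by (simp add: sq_integrable_iff)
  then have "(\<lambda>n. norm (X n - L2_class f)) \<longlonglongrightarrow> 0" using f(2) by simp
  then have "X \<longlonglongrightarrow> L2_class f" by (rule LIM_zero_cancel[OF tendsto_norm_zero_cancel])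
  then show "convergent X" by (auto simp: convergent_def)
qed

lemma second_countable_if_countable_dense:
  fixes D :: "'a::metric_space set"
  assumes "countable D" and dense: "\<And>x e. e > 0 \<Longrightarrow> \<exists>d\<in>D. dist x d < e"
  shows "\<exists>B :: 'a::metric_space set set. countable B \<and> open = generate_topology B"
proof (intro exI conjI)
  let ?B = "(\<lambda>(d, n). ball d (inverse (real (Suc n)))) ` (D \<times> UNIV)"
  show "countable ?B" using assms(1) by auto
  have "topological_basis ?B"
  proof (rule topological_basisI)
    fix U and x :: 'a assume "open U" "x \<in> U"
    then obtain e where e: "e > 0" "ball x e \<subseteq> U" by (auto simp: open_contains_ball)
    obtain n where n: "inverse (real (Suc n)) < e / 2" using reals_Archimedean[of "e / 2"] e by auto
    obtain d where d: "d \<in> D" "dist x d < inverse (real (Suc n))"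
      using dense[of "inverse (real (Suc n))" x] by auto
    have "ball d (inverse (real (Suc n))) \<subseteq> ball x e"
    proof
      fix z assume "z \<in> ball d (inverse (real (Suc n)))"
      then show "z \<in> ball x e" using d n dist_triangle[of x z d] by auto
    qed
    then have "x \<in> ball d (inverse (real (Suc n))) \<and> ball d (inverse (real (Suc n))) \<subseteq> U"
      using d e(2) by (auto simp: dist_commute)
    then show "\<exists>B'\<in>?B. x \<in> B' \<and> B' \<subseteq> U" using d(1) by (intro bexI[of _ "ball d (inverse (real (Suc n)))"]) auto
  qed auto
  then show "open = generate_topology ?B" by (rule topological_basis_imp_subbasis)
qed

text \<open>Lets corners from a countable dense set replace arbitrary ones: \<open>p n\<close> lies
  just inside the corner a and \<open>q n\<close> just inside the corner b, so every box stays
  within \<open>box a b\<close> and eventually contains each given point of it.\<close>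

lemma box_approx_indicator:
  fixes a b x :: "'a::euclidean_space"
  assumes p: "\<And>n. p n \<in> box a (a + inverse (real (Suc n)) *\<^sub>R One)"
    and q: "\<And>n. q n \<in> box (b - inverse (real (Suc n)) *\<^sub>R One) b"
  shows "box (p n) (q n) \<subseteq> box a b"
    and "(\<lambda>n. indicator (box (p n) (q n)) x :: real) \<longlonglongrightarrow> indicator (box a b) x"
proof -
  show sub: "box (p n) (q n) \<subseteq> box a b" for n
  proof
    fix z assume z: "z \<in> box (p n) (q n)"
    have "a \<bullet> i < z \<bullet> i \<and> z \<bullet> i < b \<bullet> i" if i: "i \<in> Basis" for i
      using bspec[OF p[of n, unfolded mem_box] i] bspec[OF q[of n, unfolded mem_box] i]
        bspec[OF z[unfolded mem_box] i] by linarith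
    then show "z \<in> box a b" by (simp add: mem_box)
  qed
  show "(\<lambda>n. indicator (box (p n) (q n)) x :: real) \<longlonglongrightarrow> indicator (box a b) x"
  proof (cases "x \<in> box a b")
    case True
    have "\<forall>\<^sub>F n in sequentially. \<forall>i\<in>Basis. p n \<bullet> i < x \<bullet> i \<and> x \<bullet> i < q n \<bullet> i"
    proof (rule eventually_ball_finite[OF finite_Basis], rule ballI)
      fix i :: 'a assume i: "i \<in> Basis"
      have pos: "x \<bullet> i - a \<bullet> i > 0" "b \<bullet> i - x \<bullet> i > 0" using True i by (auto simp: mem_box)
      have "\<forall>\<^sub>F n in sequentially. inverse (real (Suc n)) < min (x \<bullet> i - a \<bullet> i) (b \<bullet> i - x \<bullet> i)"
        by (rule order_tendstoD(2)[OF LIMSEQ_inverse_real_of_nat]) (use pos in simp)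
      then show "\<forall>\<^sub>F n in sequentially. p n \<bullet> i < x \<bullet> i \<and> x \<bullet> i < q n \<bullet> i"
      proof eventually_elim
        case (elim n)
        have "p n \<bullet> i < a \<bullet> i + inverse (real (Suc n))" "b \<bullet> i - inverse (real (Suc n)) < q n \<bullet> i"
          using p[of n] q[of n] i by (auto simp: mem_box inner_add_left inner_diff_left)
        then show ?case using elim by auto
      qed
    qed
    then have "\<forall>\<^sub>F n in sequentially. indicator (box (p n) (q n)) x = (indicator (box a b) x :: real)"
      by eventually_elim (use True in \<open>simp add: mem_box\<close>)
    then show ?thesis by (rule tendsto_eventually)
  next
    case False
    then have "indicator (box (p n) (q n)) x = (0 :: real)" for n using sub[of n] by (auto simp: indicator_def)
    then show ?thesis using False by simp
  qed
qed

text \<open>Step functions on boxes with corners in A and values in Y suffice. Indexing them by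
  lists gives countability directly and turns addition into concatenation.\<close>

lemma countable_dense_L2:
  "\<exists>D :: 'b::{euclidean_space, complex_inner} L2 set. countable D \<and> (\<forall>F. \<forall>e>0. \<exists>d\<in>D. dist F d < e)"
proof -
  obtain A :: "(real^3) set" where A: "countable A" "\<And>X. open X \<Longrightarrow> X \<noteq> {} \<Longrightarrow> \<exists>d\<in>A. d \<in> X"
    by (rule countable_dense_setE) blast
  obtain Y :: "'b set" where Y: "countable Y" "\<And>X. open X \<Longrightarrow> X \<noteq> {} \<Longrightarrow> \<exists>d\<in>Y. d \<in> X"
    by (rule countable_dense_setE) blast
  let ?step = "\<lambda>l x. \<Sum>(p, q, y)\<leftarrow>l. indicator (box p q) (x :: real^3) *\<^sub>R (y :: 'b)"
  let ?G = "?step ` lists (A \<times> A \<times> Y)"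
  have fin: "emeasure lborel (box a b) < \<infinity>" for a b :: "real^3"
    by (rule emeasure_bounded_finite) simp
  have cube: "\<exists>p\<in>A. p \<in> box a (a + inverse (real (Suc n)) *\<^sub>R One)"
    "\<exists>q\<in>A. q \<in> box (a - inverse (real (Suc n)) *\<^sub>R One) a" for a n
    by (intro A(2) open_box; simp add: box_ne_empty inner_add_left inner_diff_left)+
  have G_si: "square_integrable lborel (?step l)" for l
  proof (induction l)
    case (Cons z l)
    obtain p q y where z: "z = (p, q, y)" by (metis prod_cases3)
    have "square_integrable lborel (\<lambda>x. indicator (box p q) x *\<^sub>R y)"
      by (rule square_integrable_indicator[OF _ fin]) simp
    from square_integrable_add[OF this Cons.IH]
    have "square_integrable lborel (\<lambda>x. indicator (box p q) x *\<^sub>R y + ?step l x)" .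
    then show ?case by (simp add: z)
  qed simp
  have approx: "l2_approx lborel ?G f" if f: "square_integrable lborel f" for f
  proof (rule l2_approx_boxes[where \<Omega> = UNIV and P = "\<lambda>x. x" and D = Y])
    show "\<And>g. g \<in> ?G \<Longrightarrow> square_integrable lborel g" using G_si by blast
    show "(\<lambda>x. g x + h x) \<in> ?G" if "g \<in> ?G" "h \<in> ?G" for g h
    proof -
      obtain l l' where l: "l \<in> lists (A \<times> A \<times> Y)" "g = ?step l" and l': "l' \<in> lists (A \<times> A \<times> Y)" "h = ?step l'"
        using \<open>g \<in> ?G\<close> \<open>h \<in> ?G\<close> by blast
      have "(\<lambda>x. g x + h x) = ?step (l @ l')" unfolding l(2) l'(2) by (rule ext) simp
      moreover have "l @ l' \<in> lists (A \<times> A \<times> Y)" using l l' by simp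
      ultimately show ?thesis by (rule image_eqI)
    qed
    show "\<exists>g\<in>?G. l2_norm lborel (\<lambda>x. indicator (box a b) x *\<^sub>R y - g x) < e"
      if y: "y \<in> Y" and e: "e > 0" for a b y and e :: real
    proof -
      obtain p where p: "\<And>n. p n \<in> A" "\<And>n. p n \<in> box a (a + inverse (real (Suc n)) *\<^sub>R One)"
        using cube(1)[of a] by metis
      obtain q where q: "\<And>n. q n \<in> A" "\<And>n. q n \<in> box (b - inverse (real (Suc n)) *\<^sub>R One) b"
        using cube(2)[of b] by metis
      note sub = box_approx_indicator(1)[OF p(2) q(2)] and lim = box_approx_indicator(2)[OF p(2) q(2)]
      have si: "square_integrable lborel (\<lambda>x. indicator (box c d) x *\<^sub>R y)" for c d :: "real^3"
        by (intro square_integrable_indicator fin) simp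
      have "(\<lambda>n. l2_norm lborel (\<lambda>x. indicator (box (p n) (q n)) x *\<^sub>R y - indicator (box a b) x *\<^sub>R y)) \<longlonglongrightarrow> 0"
      proof (rule tendsto_l2_norm_dominated)
        show "square_integrable lborel (\<lambda>x. indicator (box a b) x *\<^sub>R y)" by (rule si)
        show "(\<lambda>n. indicator (box (p n) (q n)) x *\<^sub>R y) \<longlonglongrightarrow> indicator (box a b) x *\<^sub>R y" for x
          by (intro tendsto_scaleR lim tendsto_const)
        show "norm (indicator (box (p n) (q n)) x *\<^sub>R y - indicator (box a b) x *\<^sub>R y)
            \<le> norm (indicator (box a b) x *\<^sub>R y)" for n x
          using sub[of n] by (auto simp: indicator_def)
      qed (rule square_integrable_measurable[OF si])+
      then have "\<forall>\<^sub>F n in sequentially. l2_norm lborel (\<lambda>x. indicator (box (p n) (q n)) x *\<^sub>R y - indicator (box a b) x *\<^sub>R y) < e"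
        using e by (rule order_tendstoD(2))
      then obtain n where n: "l2_norm lborel (\<lambda>x. indicator (box (p n) (q n)) x *\<^sub>R y - indicator (box a b) x *\<^sub>R y) < e"
        by (auto dest: eventually_happens)
      show ?thesis
      proof (rule bexI[of _ "?step [(p n, q n, y)]"])
        show "l2_norm lborel (\<lambda>x. indicator (box a b) x *\<^sub>R y - ?step [(p n, q n, y)] x) < e"
          using n by (simp add: l2_norm_minus_commute)
        show "?step [(p n, q n, y)] \<in> ?G" using p(1) q(1) y by (intro imageI) simp
      qed
    qed
    show "\<exists>z\<in>Y. norm (y - z) < e" if "e > 0" for y :: 'b and e :: real
      using Y(2)[of "ball y e"] that by (auto simp: dist_norm)
  qed (use f fin in auto)
  show ?thesis
  proof (intro exI conjI allI impI)
    show "countable (L2_class ` ?G)" using A(1) Y(1) by auto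
    fix F :: "'b L2" and e :: real assume "e > 0"
    then obtain g where g: "g \<in> ?G" "l2_norm lborel (\<lambda>x. rep_L2 F x - g x) < e"
      using approx[of "rep_L2 F"] sq_integrable_rep_L2[of F] unfolding l2_approx_def sq_integrable_iff by blast
    have "sq_integrable g" using g(1) G_si unfolding sq_integrable_iff by blast
    then have "dist F (L2_class g) < e"
      using norm_L2_class_diff[OF sq_integrable_rep_L2[of F]] g(2) by (simp add: dist_norm)
    then show "\<exists>d\<in>L2_class ` ?G. dist F d < e" using g(1) by blast
  qed
qed

text \<open>Separability makes sums and inner products of Borel measurable L2-valued functions of
  time measurable, on which all calculations in \<open>Hnu\<close> rest.\<close>

instance L2 :: ("{euclidean_space, complex_inner}") second_countable_topology
proof
  obtain D :: "'a L2 set" where "countable D" "\<And>F e. e > 0 \<Longrightarrow> \<exists>d\<in>D. dist F d < e"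
    using countable_dense_L2 by blast
  then show "\<exists>B :: 'a L2 set set. countable B \<and> open = generate_topology B"
    by (rule second_countable_if_countable_dense)
qed

section \<open>Exponentially weighted time\<close>

text \<open>Putting the exponential factor into the measure turns \<open>Hnu\<close> and
  \<open>Hnu_norm\<close> into the general notions \<open>square_integrable\<close> and
  \<open>l2_norm\<close>, without changing the null sets.\<close>

definition weighted :: "real \<Rightarrow> real measure" where
  "weighted \<nu> = density lborel (\<lambda>t. ennreal (exp (- 2 * \<nu> * t)))"

lemma sets_weighted [simp, measurable_cong]: "sets (weighted \<nu>) = sets borel"
  by (simp add: weighted_def)

lemma space_weighted [simp]: "space (weighted \<nu>) = UNIV"
  by (simp add: weighted_def)

lemma AE_weighted: "(AE t in weighted \<nu>. Q t) \<longleftrightarrow> (AE t in lborel. Q t)"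
  unfolding weighted_def by (subst AE_density) auto

lemma integral_weighted:
  fixes f :: "real \<Rightarrow> real"
  assumes "f \<in> borel_measurable borel"
  shows "(LINT t|weighted \<nu>. f t) = (LINT t|lborel. exp (- 2 * \<nu> * t) * f t)"
  unfolding weighted_def using assms by (subst integral_density) auto

lemma integrable_weighted:
  fixes f :: "real \<Rightarrow> real"
  assumes "f \<in> borel_measurable borel"
  shows "integrable (weighted \<nu>) f \<longleftrightarrow> integrable lborel (\<lambda>t. exp (- 2 * \<nu> * t) * f t)"
  unfolding weighted_def using assms by (subst integrable_density) auto

lemma emeasure_weighted_box: "emeasure (weighted \<nu>) (box a b) < \<infinity>"
proof -
  have "integrable lborel (\<lambda>t. indicator (cbox a b) t *\<^sub>R exp (- 2 * \<nu> * t))"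
    by (intro borel_integrable_compact continuous_intros compact_cbox)
  then have "integrable (weighted \<nu>) (indicator (cbox a b) :: real \<Rightarrow> real)"
    by (subst integrable_weighted) (auto simp: mult.commute)
  then have fin: "emeasure (weighted \<nu>) (cbox a b) < \<infinity>"
    by (simp add: integrable_indicator_iff)
  have "emeasure (weighted \<nu>) (box a b) \<le> emeasure (weighted \<nu>) (cbox a b)"
    by (rule emeasure_mono) (auto simp: box_subset_cbox)
  then show ?thesis using fin by (rule le_less_trans)
qed

lemma Hnu_iff:
  "f \<in> Hnu \<nu> H \<longleftrightarrow> square_integrable (weighted \<nu>) f \<and> (\<forall>t. f t \<in> H)"
proof (cases "f \<in> borel_measurable borel")
  case True
  then have "(\<lambda>t. (norm (f t))\<^sup>2) \<in> borel_measurable borel" by measurable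
  then show ?thesis using True
    by (auto simp: Hnu_def square_integrable_def integrable_weighted mult.commute)
qed (auto simp: Hnu_def square_integrable_def)

lemma Hnu_norm_eq:
  assumes "f \<in> borel_measurable borel"
  shows "Hnu_norm \<nu> f = l2_norm (weighted \<nu>) f"
proof -
  have "(\<lambda>t. (norm (f t))\<^sup>2) \<in> borel_measurable borel" using assms by measurable
  then show ?thesis by (simp add: Hnu_norm_def l2_norm_def integral_weighted mult.commute)
qed

text \<open>Substitution turns a delay by c into the factor exp(-\<nu> c). This is the source of
  decay in the Euler sum, whose k-th term is delayed by k h.\<close>

lemma l2_norm_weighted_shift:
  fixes f :: "real \<Rightarrow> 'b::{real_inner, second_countable_topology}"
  assumes [measurable]: "f \<in> borel_measurable borel"
  shows "l2_norm (weighted \<nu>) (\<lambda>t. f (t - c)) = exp (- \<nu> * c) * l2_norm (weighted \<nu>) f"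
proof -
  let ?g = "\<lambda>t. exp (- 2 * \<nu> * t) * (norm (f (t - c)))\<^sup>2"
  have "(LINT t|lborel. ?g t) = (LINT t|lborel. ?g (c + t))"
    by (rule lborel_integral_translate[symmetric]) measurable
  also have "\<dots> = (LINT t|lborel. (exp (- \<nu> * c))\<^sup>2 * (exp (- 2 * \<nu> * t) * (norm (f t))\<^sup>2))"
    by (intro Bochner_Integration.integral_cong)
      (auto simp: algebra_simps exp_add power2_eq_square simp flip: exp_add)
  finally have "(LINT t|lborel. ?g t) = (exp (- \<nu> * c))\<^sup>2 * (LINT t|lborel. exp (- 2 * \<nu> * t) * (norm (f t))\<^sup>2)"
    by simp
  moreover have "(LINT t|weighted \<nu>. (norm (f (t - c)))\<^sup>2) = (LINT t|lborel. ?g t)"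
    "(LINT t|weighted \<nu>. (norm (f t))\<^sup>2) = (LINT t|lborel. exp (- 2 * \<nu> * t) * (norm (f t))\<^sup>2)"
    by (rule integral_weighted, measurable)+
  ultimately show ?thesis by (simp add: l2_norm_def real_sqrt_mult)
qed

lemma square_integrable_compact_support:
  fixes f :: "'a::euclidean_space \<Rightarrow> 'b::real_inner"
  assumes sets_M: "sets M = sets borel" and fin: "\<And>a b. emeasure M (box a b) < \<infinity>"
    and f: "continuous_on UNIV f" "compact K" "\<And>x. x \<notin> K \<Longrightarrow> f x = 0"
  shows "square_integrable M f"
proof -
  obtain a where a: "K \<subseteq> box (- a) a"
    using bounded_subset_box_symmetric[OF compact_imp_bounded[OF f(2)]] by blast
  have "bounded (f ` K)"
    by (rule compact_imp_bounded[OF compact_continuous_image[OF continuous_on_subset[OF f(1)] f(2)]]) simp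
  then obtain B where B: "B > 0" "\<And>x. x \<in> K \<Longrightarrow> norm (f x) \<le> B"
    by (auto simp: bounded_pos)
  show ?thesis
  proof (rule square_integrable_bound[where K = B])
    show "square_integrable M (\<lambda>x. indicator (box (- a) a) x *\<^sub>R (1::real))"
      by (rule square_integrable_indicator[OF _ fin]) (simp add: sets_M)
    show "f \<in> borel_measurable M"
      using borel_measurable_continuous_onI[OF f(1)] measurable_cong_sets[OF sets_M refl] by blast
    show "norm (f x) \<le> B * norm (indicator (box (- a) a) x *\<^sub>R (1::real))" for x
      using B f(3)[of x] a by (cases "x \<in> K") (auto simp: indicator_def)
  qed
qed

lemma test_function_square_integrable:
  fixes f :: "'a::euclidean_space \<Rightarrow> 'b::real_inner"
  assumes "sets M = sets borel" "\<And>a b. emeasure M (box a b) < \<infinity>" "test_function U f"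
  shows "square_integrable M f"
proof -
  obtain K where K: "smooth_on UNIV f" "compact K" "K \<subseteq> U" "\<And>x. x \<notin> K \<Longrightarrow> f x = 0"
    by (rule test_functionE[OF assms(3)]) blast
  show ?thesis
    by (rule square_integrable_compact_support[OF assms(1,2) smooth_on_UNIV_continuous[OF K(1)] K(2,4)])
qed

lemma test_function_weighted:
  fixes f :: "real \<Rightarrow> 'b::real_inner"
  shows "test_function U f \<Longrightarrow> square_integrable (weighted \<nu>) f"
  by (rule test_function_square_integrable[OF sets_weighted emeasure_weighted_box])

lemma bump_tendsto_l2:
  fixes y :: "'b::{real_inner, second_countable_topology}"
  assumes sets_M: "sets M = sets borel" and fin: "\<And>a b. emeasure M (box a b) < \<infinity>"
  shows "(\<lambda>n. l2_norm M (\<lambda>x. bump a b n x *\<^sub>R y - indicator (box a b) x *\<^sub>R y)) \<longlonglongrightarrow> 0"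
proof (rule tendsto_l2_norm_dominated)
  show si: "square_integrable M (\<lambda>x. indicator (box a b) x *\<^sub>R y)"
    by (rule square_integrable_indicator[OF _ fin]) (simp add: sets_M)
  show "(\<lambda>x. indicator (box a b) x *\<^sub>R y) \<in> borel_measurable M"
    by (rule square_integrable_measurable[OF si])
  show "(\<lambda>n. bump a b n x *\<^sub>R y) \<longlonglongrightarrow> indicator (box a b) x *\<^sub>R y" for x
    by (intro tendsto_scaleR bump_tendsto_indicator tendsto_const)
  show "(\<lambda>x. bump a b n x *\<^sub>R y) \<in> borel_measurable M" for n
  proof -
    have "continuous_on UNIV (\<lambda>x. bump a b n x *\<^sub>R y)"
      by (intro continuous_intros smooth_on_UNIV_continuous smooth_scalar_smooth smooth_scalar_bump)
    then show ?thesis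
      using borel_measurable_continuous_onI measurable_cong_sets[OF sets_M refl] by blast
  qed
  show "norm (bump a b n x *\<^sub>R y - indicator (box a b) x *\<^sub>R y) \<le> norm (indicator (box a b) x *\<^sub>R y)" for n x
  proof (cases "x \<in> box a b")
    case True
    have "\<bar>bump a b n x - 1\<bar> \<le> 1" using bump_bounds[of a b n x] by linarith
    then have "\<bar>bump a b n x - 1\<bar> * norm y \<le> 1 * norm y" by (rule mult_right_mono) simp
    then show ?thesis using True by (simp flip: norm_scaleR add: scaleR_diff_left)
  next
    case False
    have "bump a b n x = 0"
    proof (cases "n = 0")
      case True
      obtain i :: 'a where "i \<in> Basis" using nonempty_Basis by blast
      then show ?thesis unfolding bump_def using True by (intro prod_zero) (auto simp: flat_def)
    next
      case n: False
      then show ?thesis using test_function_outside[OF test_function_bump[of a b "box a b" n]] False by simp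
    qed
    then show ?thesis by simp
  qed
qed

lemma bump_l2_approx:
  fixes y :: "'b::{real_inner, second_countable_topology}"
  assumes "sets M = sets borel" "\<And>a b. emeasure M (box a b) < \<infinity>" and e: "e > 0"
  obtains n where "n > 0" "l2_norm M (\<lambda>x. bump a b n x *\<^sub>R y - indicator (box a b) x *\<^sub>R y) < e"
proof -
  have "\<forall>\<^sub>F n in sequentially. l2_norm M (\<lambda>x. bump a b n x *\<^sub>R y - indicator (box a b) x *\<^sub>R y) < e"
    using bump_tendsto_l2[OF assms(1,2)] by (rule order_tendstoD(2)) (rule e)
  then obtain m where "\<forall>n\<ge>m. l2_norm M (\<lambda>x. bump a b n x *\<^sub>R y - indicator (box a b) x *\<^sub>R y) < e"
    unfolding eventually_sequentially by (rule exE)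
  then have "l2_norm M (\<lambda>x. bump a b (Suc m) x *\<^sub>R y - indicator (box a b) x *\<^sub>R y) < e"
    by (rule allE[of _ "Suc m"]) (rule mp, simp_all)
  then show ?thesis by (rule that[OF zero_less_Suc])
qed

section \<open>Calculus for test functions of time\<close>

lemma smooth_on_real_has_vector_derivative:
  fixes f :: "real \<Rightarrow> 'b::real_normed_vector"
  assumes "smooth_on UNIV f"
  shows "(f has_vector_derivative dir_deriv 1 f t) (at t)"
proof -
  let ?D = "frechet_derivative f (at t)"
  have D: "(f has_derivative ?D) (at t)" by (rule smooth_on_UNIV_has_derivative[OF assms])
  have "?D = (\<lambda>h. h *\<^sub>R dir_deriv 1 f t)"
  proof
    fix h :: real
    show "?D h = h *\<^sub>R dir_deriv 1 f t"
      using linear_cmul[OF has_derivative_linear[OF D], of h 1] by (simp add: dir_deriv_def)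
  qed
  then show ?thesis using D by (simp add: has_vector_derivative_def)
qed

lemma smooth_on_real_vector_derivative:
  fixes f :: "real \<Rightarrow> 'b::real_normed_vector"
  assumes "smooth_on UNIV f"
  shows "(\<lambda>t. vector_derivative f (at t)) = dir_deriv 1 f"
  using vector_derivative_at[OF smooth_on_real_has_vector_derivative[OF assms]] by (rule ext)

lemma test_function_shift:
  fixes f :: "real \<Rightarrow> 'b::real_normed_vector"
  assumes "test_function UNIV f"
  shows "test_function UNIV (\<lambda>t. f (t - c))"
proof -
  obtain K where K: "smooth_on UNIV f" "compact K" "K \<subseteq> UNIV" "\<And>x. x \<notin> K \<Longrightarrow> f x = 0"
    by (rule test_functionE[OF assms]) blast
  have deriv: "((\<lambda>t. f (t - c)) has_derivative frechet_derivative f (at (t - c))) (at t)"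
    if "smooth_on UNIV f" for f :: "real \<Rightarrow> 'b" and t
  proof -
    have "((\<lambda>t. t - c) has_derivative (\<lambda>h. h)) (at t)" by (auto intro!: derivative_eq_intros)
    from has_derivative_compose[OF this smooth_on_UNIV_has_derivative[OF that]] show ?thesis .
  qed
  show ?thesis
  proof (rule test_functionI)
    show "smooth_on UNIV (\<lambda>t. f (t - c))"
    proof (rule smooth_on_UNIV_coinduct[where F = "\<lambda>g. \<exists>f. smooth_on UNIV f \<and> g = (\<lambda>t. f (t - c))"])
      show "\<exists>g. smooth_on UNIV g \<and> (\<lambda>t. f (t - c)) = (\<lambda>t. g (t - c))" using K(1) by blast
    next
      fix g :: "real \<Rightarrow> 'b" and t v :: real
      assume "\<exists>f. smooth_on UNIV f \<and> g = (\<lambda>t. f (t - c))"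
      then obtain f where f: "smooth_on UNIV f" "g = (\<lambda>t. f (t - c))" by blast
      show "g differentiable (at t)" unfolding f(2) differentiable_def using deriv[OF f(1)] by blast
      assume v: "v \<in> Basis"
      have "dir_deriv v g = (\<lambda>t. dir_deriv v f (t - c))"
        unfolding f(2) using dir_derivI[OF deriv[OF f(1)]] by (auto simp: dir_deriv_def)
      then show "\<exists>f. smooth_on UNIV f \<and> dir_deriv v g = (\<lambda>t. f (t - c))"
        using smooth_on_UNIV_dir_deriv[OF f(1) v] by blast
    qed
    show "compact ((\<lambda>t. t + c) ` K)" by (intro compact_continuous_image K continuous_intros)
    show "f (t - c) = 0" if "t \<notin> (\<lambda>t. t + c) ` K" for t
      using that by (intro K(4)) (metis diff_add_cancel image_eqI)
  qed simp
qed

lemma test_function_scaleR: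
  assumes "test_function U \<xi>"
  shows "test_function U (\<lambda>t. \<xi> t *\<^sub>R y)"
  using bounded_linear_scaleR_left assms by (rule test_function_bounded_linear)

lemma dir_deriv_scaleR:
  assumes "smooth_on UNIV \<xi>"
  shows "dir_deriv v (\<lambda>t. \<xi> t *\<^sub>R y) = (\<lambda>t. dir_deriv v \<xi> t *\<^sub>R y)"
  by (rule dir_deriv_bounded_linear[OF bounded_linear_scaleR_left assms])

text \<open>Differentiating the weight contributes 2 \<nu> g: in the weighted space the formal
  adjoint of the time derivative is its negative plus 2 \<nu>. This extra term is what makes the
  time derivative accretive.\<close>

lemma weighted_integral_by_parts:
  fixes f g :: "real \<Rightarrow> 'b::{real_inner, second_countable_topology}"
  assumes f: "test_function U f" and g: "test_function V g"
  shows "(LINT t|weighted \<nu>. dir_deriv 1 f t \<bullet> g t) =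
    - (LINT t|weighted \<nu>. f t \<bullet> (dir_deriv 1 g t - (2 * \<nu>) *\<^sub>R g t))"
proof -
  note sf = test_function_smooth[OF f] and sg = test_function_smooth[OF g]
  note cf = smooth_on_UNIV_continuous[OF sf] and cg = smooth_on_UNIV_continuous[OF sg]
  have one: "(1::real) \<in> Basis" by simp
  note cdf = smooth_on_UNIV_continuous[OF smooth_on_UNIV_dir_deriv[OF sf one]]
    and cdg = smooth_on_UNIV_continuous[OF smooth_on_UNIV_dir_deriv[OF sg one]]
  obtain K where K: "smooth_on UNIV f" "compact K" "K \<subseteq> U" "\<And>x. x \<notin> K \<Longrightarrow> f x = 0"
    by (rule test_functionE[OF f]) blast
  let ?e = "\<lambda>t. exp (- 2 * \<nu> * t)"
  have "(LINT t|lborel. dir_deriv 1 f t \<bullet> (?e t *\<^sub>R g t)) =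
      - (LINT t|lborel. f t \<bullet> (?e t *\<^sub>R (dir_deriv 1 g t - (2 * \<nu>) *\<^sub>R g t)))"
  proof -
    let ?f' = "\<lambda>t h. h *\<^sub>R dir_deriv 1 f t" and ?g' = "\<lambda>t h. h *\<^sub>R (?e t *\<^sub>R (dir_deriv 1 g t - (2 * \<nu>) *\<^sub>R g t))"
    have "(LINT t|lborel. ?f' t 1 \<bullet> (?e t *\<^sub>R g t)) = - (LINT t|lborel. f t \<bullet> ?g' t 1)"
    proof (rule integral_by_parts_inner[where f' = ?f' and g' = ?g' and v = 1, OF _ _ _ _ K(2,4)])
      show "(f has_derivative ?f' t) (at t)" for t
        using smooth_on_real_has_vector_derivative[OF sf] by (simp add: has_vector_derivative_def)
      show "((\<lambda>t. ?e t *\<^sub>R g t) has_derivative ?g' t) (at t)" for t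
      proof -
        have "(?e has_real_derivative - 2 * \<nu> * ?e t) (at t)"
          by (auto intro!: derivative_eq_intros)
        from has_vector_derivative_scaleR[OF this smooth_on_real_has_vector_derivative[OF sg]]
        have "((\<lambda>t. ?e t *\<^sub>R g t) has_vector_derivative
            ?e t *\<^sub>R dir_deriv 1 g t + (- 2 * \<nu> * ?e t) *\<^sub>R g t) (at t)" .
        moreover have "?e t *\<^sub>R dir_deriv 1 g t + (- 2 * \<nu> * ?e t) *\<^sub>R g t
            = ?e t *\<^sub>R (dir_deriv 1 g t - (2 * \<nu>) *\<^sub>R g t)"
          by (simp add: scaleR_diff_right mult.commute)
        ultimately show ?thesis by (simp only: has_vector_derivative_def)
      qed
      show "continuous_on UNIV (\<lambda>t. ?f' t 1)" by (intro continuous_intros cdf)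
      show "continuous_on UNIV (\<lambda>t. ?g' t 1)" by (intro continuous_intros cdg cg)
    qed
    then show ?thesis by simp
  qed
  moreover have "(LINT t|weighted \<nu>. dir_deriv 1 f t \<bullet> g t) = (LINT t|lborel. dir_deriv 1 f t \<bullet> (?e t *\<^sub>R g t))"
    by (subst integral_weighted) (auto intro!: borel_measurable_continuous_onI continuous_intros cdf cg)
  moreover have "(LINT t|weighted \<nu>. f t \<bullet> (dir_deriv 1 g t - (2 * \<nu>) *\<^sub>R g t)) =
      (LINT t|lborel. f t \<bullet> (?e t *\<^sub>R (dir_deriv 1 g t - (2 * \<nu>) *\<^sub>R g t)))"
    by (subst integral_weighted)
      (auto intro!: borel_measurable_continuous_onI continuous_intros cdg cg cf simp: mult.commute)
  ultimately show ?thesis by simp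
qed

lemma l2_norm_bounded_linear:
  assumes "bounded_linear L"
  obtains K where "K \<ge> 0" "\<And>M f. square_integrable M f \<Longrightarrow> l2_norm M (\<lambda>x. L (f x)) \<le> K * l2_norm M f"
proof -
  obtain K where K: "K \<ge> 0" "\<And>x. norm (L x) \<le> norm x * K"
    using bounded_linear.nonneg_bounded[OF assms] by blast
  have "l2_norm M (\<lambda>x. L (f x)) \<le> K * l2_norm M f" if "square_integrable M f" for M f
    by (rule l2_norm_bound[OF that measurable_bounded_linear[OF assms square_integrable_measurable[OF that]] K(1)])
      (use K(2) in \<open>simp add: mult.commute\<close>)
  with K(1) show ?thesis by (rule that)
qed

lemma tendsto_l2_bounded_linear:
  fixes s :: "nat \<Rightarrow> 'a \<Rightarrow> 'b::{real_inner, second_countable_topology}"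
  assumes L: "bounded_linear L" and s: "\<And>n. square_integrable M (s n)" "square_integrable M u"
    and lim: "(\<lambda>n. l2_norm M (\<lambda>x. s n x - u x)) \<longlonglongrightarrow> 0"
  shows "(\<lambda>n. l2_norm M (\<lambda>x. L (s n x) - L (u x))) \<longlonglongrightarrow> 0"
proof -
  obtain K where K: "K \<ge> 0" "\<And>f. square_integrable M f \<Longrightarrow> l2_norm M (\<lambda>x. L (f x)) \<le> K * l2_norm M f"
    using l2_norm_bounded_linear[OF L] by metis
  show ?thesis
  proof (rule Lim_null_comparison)
    show "(\<lambda>n. K * l2_norm M (\<lambda>x. s n x - u x)) \<longlonglongrightarrow> 0"
      using tendsto_mult_left[OF lim, of K] by simp
    show "\<forall>\<^sub>F n in sequentially. norm (l2_norm M (\<lambda>x. L (s n x) - L (u x))) \<le> K * l2_norm M (\<lambda>x. s n x - u x)"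
      using K(2)[OF square_integrable_diff[OF s]] 
      by (simp add: linear_diff[OF bounded_linear.linear[OF L]])
  qed
qed

lemma dir_deriv_shift:
  fixes f :: "real \<Rightarrow> 'b::real_normed_vector"
  assumes "smooth_on UNIV f"
  shows "dir_deriv v (\<lambda>t. f (t - c)) = (\<lambda>t. dir_deriv v f (t - c))"
proof
  fix t
  have "((\<lambda>t. t - c) has_derivative (\<lambda>h. h)) (at t)" by (auto intro!: derivative_eq_intros)
  from dir_derivI[OF has_derivative_compose[OF this smooth_on_UNIV_has_derivative[OF assms]]]
  show "dir_deriv v (\<lambda>t. f (t - c)) t = dir_deriv v f (t - c)" by (simp add: dir_deriv_def)
qed

lemma dir_deriv_real_deriv:
  assumes "smooth_on UNIV f"
  shows "(f has_real_derivative dir_deriv 1 f t) (at t)"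
  using smooth_on_real_has_vector_derivative[OF assms]
  by (simp add: has_real_derivative_iff_has_vector_derivative)

text \<open>Two applications of the mean value theorem bound the pointwise error by h times the
  supremum of the second derivative. The explicit rate is essential, because it has to beat a loss
  of order \<open>h^(-1/2)\<close> in the Euler sum.\<close>

lemma difference_quotient_bound:
  fixes \<xi> :: "real \<Rightarrow> real"
  assumes \<xi>: "test_function UNIV \<xi>"
  obtains L where "L \<ge> 0" "\<And>h. 0 < h \<Longrightarrow> h \<le> 1 \<Longrightarrow>
    l2_norm (weighted \<nu>) (\<lambda>t. dir_deriv 1 \<xi> t - inverse h * (\<xi> t - \<xi> (t - h))) \<le> h * L"
proof -
  obtain K where K: "smooth_on UNIV \<xi>" "compact K" "K \<subseteq> UNIV" "\<And>x. x \<notin> K \<Longrightarrow> \<xi> x = 0"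
    by (rule test_functionE[OF \<xi>]) blast
  let ?d = "dir_deriv 1 \<xi>"
  let ?dd = "dir_deriv 1 ?d"
  have one: "(1::real) \<in> Basis" by simp
  have sd: "smooth_on UNIV ?d" by (rule smooth_on_UNIV_dir_deriv[OF K(1) one])
  have td: "test_function UNIV ?dd"
    by (rule test_function_dir_deriv[OF test_function_dir_deriv[OF \<xi> one] one])
  obtain K2 where K2: "smooth_on UNIV ?dd" "compact K2" "K2 \<subseteq> UNIV" "\<And>x. x \<notin> K2 \<Longrightarrow> ?dd x = 0"
    by (rule test_functionE[OF td]) blast
  have "bounded (?dd ` K2)"
    by (rule compact_imp_bounded[OF compact_continuous_image[OF smooth_on_UNIV_continuous[OF K2(1)] K2(2)]])
  then obtain B where B: "B > 0" "\<And>x. x \<in> K2 \<Longrightarrow> norm (?dd x) \<le> B" by (auto simp: bounded_pos)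
  have B': "\<bar>?dd x\<bar> \<le> B" for x
    using B(2)[of x] K2(4)[of x] B(1) by (cases "x \<in> K2") auto
  obtain R where R: "R > 0" "\<And>x. x \<in> K \<Longrightarrow> norm x \<le> R"
    using compact_imp_bounded[OF K(2)] by (auto simp: bounded_pos)
  \<comment> \<open>R bounds the support of \<xi>, and h is at most 1; so at distance R + 2 from 0
    both \<xi> and its delayed copy vanish.\<close>
  let ?I = "\<lambda>t. indicator (box (- (R + 2)) (R + 2)) t *\<^sub>R (1::real)"
  have I: "square_integrable (weighted \<nu>) ?I"
    by (rule square_integrable_indicator[OF _ emeasure_weighted_box]) simp
  show ?thesis
  proof (rule that)
    show "0 \<le> B * l2_norm (weighted \<nu>) ?I" using B(1) by simp
    fix h :: real assume h: "0 < h" "h \<le> 1"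
    let ?w = "\<lambda>t. ?d t - inverse h * (\<xi> t - \<xi> (t - h))"
    have outside: "\<xi> t = 0" if "\<bar>t\<bar> > R" for t
      using R(2)[of t] that K(4)[of t] by force
    have "norm (?w t) \<le> (h * B) * norm (?I t)" for t
    proof (cases "t \<in> box (- (R + 2)) (R + 2)")
      case True
      have "\<exists>z. t - h < z \<and> z < t \<and> \<xi> t - \<xi> (t - h) = (t - (t - h)) * ?d z"
        by (rule MVT2) (use h dir_deriv_real_deriv[OF K(1)] in auto)
      then obtain z where z: "t - h < z" "z < t" "\<xi> t - \<xi> (t - h) = h * ?d z" by auto
      have "\<exists>y. z < y \<and> y < t \<and> ?d t - ?d z = (t - z) * ?dd y"
        by (rule MVT2) (use z dir_deriv_real_deriv[OF sd] in auto)
      then obtain y where y: "?d t - ?d z = (t - z) * ?dd y" by auto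
      have "inverse h * (h * ?d z) = ?d z" using h by (simp add: field_simps)
      then have "?w t = (t - z) * ?dd y" using y by (simp only: z(3))
      then have "\<bar>?w t\<bar> = \<bar>t - z\<bar> * \<bar>?dd y\<bar>" by (simp add: abs_mult)
      also have "\<dots> \<le> h * B" using z h B' by (intro mult_mono) auto
      finally show ?thesis using True by simp
    next
      case False
      then have t: "\<bar>t\<bar> \<ge> R + 2" by (auto simp: box_real)
      have "?d t = 0"
      proof -
        have "(\<xi> has_derivative frechet_derivative \<xi> (at t)) (at t)"
          by (rule smooth_on_UNIV_has_derivative[OF K(1)])
        moreover have "t \<notin> cball 0 R" using t by (simp add: dist_real_def)
        moreover have "\<And>x. x \<notin> cball 0 R \<Longrightarrow> \<xi> x = 0" using outside by (simp add: dist_real_def)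
        ultimately have "frechet_derivative \<xi> (at t) = (\<lambda>_. 0)"
          using has_derivative_outside_support[OF _ closed_cball] by blast
        then show ?thesis by (simp add: dir_deriv_def)
      qed
      moreover have "\<xi> t = 0" "\<xi> (t - h) = 0" using t h by (auto intro!: outside)
      ultimately show ?thesis using B(1) h by simp
    qed
    moreover have "?w \<in> borel_measurable (weighted \<nu>)"
    proof -
      have "continuous_on UNIV ?w"
        by (intro continuous_intros smooth_on_UNIV_continuous[OF sd] smooth_on_UNIV_continuous[OF K(1)]
            continuous_on_compose2[OF smooth_on_UNIV_continuous[OF K(1), of UNIV]]) auto
      then show ?thesis
        using borel_measurable_continuous_onI measurable_cong_sets[OF sets_weighted refl] by blast
    qed
    ultimately have "l2_norm (weighted \<nu>) ?w \<le> (h * B) * l2_norm (weighted \<nu>) ?I"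
      using B(1) h by (intro l2_norm_bound[OF I]) auto
    then show "l2_norm (weighted \<nu>) ?w \<le> h * (B * l2_norm (weighted \<nu>) ?I)" by (simp only: mult.assoc)
  qed
qed

section \<open>Well-posedness of abstract evolutionary equations\<close>

text \<open>All spaces are regarded as real Hilbert spaces. \<open>N\<close> is a pseudo-inverse of \<open>M0\<close>; it makes the
  energy identity available although \<open>M0\<close> has a kernel. Skew-selfadjointness of \<open>A\<close> enters only
  through skew-symmetry and the solvability of the implicit Euler step.\<close>

locale evolutionary =
  fixes P M0 M1 N :: "'h::{real_inner, banach, second_countable_topology} \<Rightarrow> 'h"
    and S :: "'h set" and A :: "('h \<times> 'h) set" and \<nu>0 \<delta> :: real
  assumes P: "bounded_linear P" "\<And>x. P x \<in> S" "\<And>x. x \<in> S \<Longrightarrow> P x = x"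
    and M0: "bounded_linear M0" "\<And>x. x \<in> S \<Longrightarrow> M0 x \<in> S"
    and M0_sym: "\<And>x y. x \<in> S \<Longrightarrow> y \<in> S \<Longrightarrow> M0 x \<bullet> y = x \<bullet> M0 y"
    and M0_nonneg: "\<And>x. x \<in> S \<Longrightarrow> 0 \<le> x \<bullet> M0 x"
    and M1: "bounded_linear M1" "\<And>x. x \<in> S \<Longrightarrow> M1 x \<in> S"
    and N: "bounded_linear N" "\<And>x. x \<in> S \<Longrightarrow> N x \<in> S"
    and N_sym: "\<And>x y. x \<in> S \<Longrightarrow> y \<in> S \<Longrightarrow> N x \<bullet> y = x \<bullet> N y"
    and M0_N: "\<And>x. x \<in> S \<Longrightarrow> M0 (N (M0 x)) = M0 x"
    and A_sub: "A \<subseteq> S \<times> S"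
    and A_subspace: "subspace A"
    and A_skew: "\<And>x a y b. (x, a) \<in> A \<Longrightarrow> (y, b) \<in> A \<Longrightarrow> a \<bullet> y = - (x \<bullet> b)"
    and A_dense: "\<And>x e. x \<in> S \<Longrightarrow> e > 0 \<Longrightarrow> \<exists>y\<in>Domain A. norm (x - y) < e"
    and A_range: "\<And>h f. h > 0 \<Longrightarrow> f \<in> S \<Longrightarrow> \<exists>x a. (x, a) \<in> A \<and> inverse h *\<^sub>R M0 x + M1 x + a = f"
    and \<nu>0: "\<nu>0 > 0" and \<delta>: "\<delta> > 0"
    and coercive: "\<And>x. x \<in> S \<Longrightarrow> \<delta> * (norm x)\<^sup>2 \<le> \<nu>0 * (x \<bullet> M0 x) + x \<bullet> M1 x"
begin

text \<open>As the fixed point set of the bounded operator P, S is both a subspace and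
  closed.\<close>

lemma S_eq: "S = {x. P x = x}"
  using P(2,3) by (metis (mono_tags) mem_Collect_eq set_eqI)

lemma subspace_S: "subspace S"
proof -
  interpret P: bounded_linear P by (rule P)
  show ?thesis unfolding S_eq by (auto simp: subspace_def P.add P.scaleR P.zero)
qed

lemma closed_S: "closed S"
  unfolding S_eq
  by (intro closed_Collect_eq linear_continuous_on P(1) continuous_on_id)

lemma S_add: "x \<in> S \<Longrightarrow> y \<in> S \<Longrightarrow> x + y \<in> S"
  and S_scaleR: "x \<in> S \<Longrightarrow> r *\<^sub>R x \<in> S" and S_diff: "x \<in> S \<Longrightarrow> y \<in> S \<Longrightarrow> x - y \<in> S"
  and S_0: "0 \<in> S"
  using subspace_S by (auto intro: subspace_add subspace_scale subspace_diff subspace_0)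

lemma A_orthogonal: "(x, a) \<in> A \<Longrightarrow> x \<bullet> a = 0"
  using A_skew[of x a x a] by (simp add: inner_commute)

definition evo_graph :: "real \<Rightarrow> ((real \<Rightarrow> 'h) \<times> (real \<Rightarrow> 'h)) set" where
  "evo_graph \<nu> = {(u, f) \<in> Hnu \<nu> S \<times> Hnu \<nu> S. \<exists>v a.
     (\<lambda>t. M0 (u t), v) \<in> time_deriv_graph \<nu> S \<and> (u, a) \<in> pointwise_graph \<nu> S A \<and>
     (AE t in lborel. f t = v t + M1 (u t) + a t)}"

section \<open>Weighted spaces with values in S and closed graphs in them\<close>

lemma HnuD: "u \<in> Hnu \<nu> S \<Longrightarrow> square_integrable (weighted \<nu>) u" "u \<in> Hnu \<nu> S \<Longrightarrow> u t \<in> S"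
  by (auto simp: Hnu_iff)

lemma Hnu_add_scale:
  assumes "u \<in> Hnu \<nu> S" "v \<in> Hnu \<nu> S"
  shows "(\<lambda>t. u t + r *\<^sub>R v t) \<in> Hnu \<nu> S"
  unfolding Hnu_iff
  using square_integrable_add[OF HnuD(1)[OF assms(1)] square_integrable_scaleR[OF HnuD(1)[OF assms(2)]]]
    S_add[OF HnuD(2)[OF assms(1)] S_scaleR[OF HnuD(2)[OF assms(2)]]] by blast

lemma Hnu_bounded_linear:
  assumes "bounded_linear L" "\<And>x. x \<in> S \<Longrightarrow> L x \<in> S" "u \<in> Hnu \<nu> S"
  shows "(\<lambda>t. L (u t)) \<in> Hnu \<nu> S"
  unfolding Hnu_iff
  using square_integrable_bounded_linear[OF assms(1) HnuD(1)[OF assms(3)]] assms(2) HnuD(2)[OF assms(3)]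
  by blast

lemma Hnu_norm_l2: "u \<in> Hnu \<nu> S \<Longrightarrow> Hnu_norm \<nu> u = l2_norm (weighted \<nu>) u"
  by (rule Hnu_norm_eq) (use HnuD(1)[THEN square_integrable_measurable] in simp)

lemma Hnu_limit_iff:
  assumes "\<And>n. s n \<in> Hnu \<nu> S" "u \<in> Hnu \<nu> S"
  shows "Hnu_limit \<nu> s u \<longleftrightarrow> (\<lambda>n. l2_norm (weighted \<nu>) (\<lambda>t. s n t - u t)) \<longlonglongrightarrow> 0"
proof -
  have "(\<lambda>t. s n t - u t) \<in> Hnu \<nu> S" for n
    using Hnu_add_scale[OF assms, of n "- 1"] by simp
  then show ?thesis by (simp add: Hnu_limit_def Hnu_norm_l2)
qed

lemma Hnu_closureE:
  assumes "(u, f) \<in> Hnu_closure \<nu> S G"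
  obtains s r where "\<And>n. (s n, r n) \<in> G" "\<And>n. s n \<in> Hnu \<nu> S" "\<And>n. r n \<in> Hnu \<nu> S"
    "u \<in> Hnu \<nu> S" "f \<in> Hnu \<nu> S"
    "(\<lambda>n. l2_norm (weighted \<nu>) (\<lambda>t. s n t - u t)) \<longlonglongrightarrow> 0"
    "(\<lambda>n. l2_norm (weighted \<nu>) (\<lambda>t. r n t - f t)) \<longlonglongrightarrow> 0"
proof -
  obtain s r where *: "\<forall>n. (s n, r n) \<in> G \<inter> Hnu \<nu> S \<times> Hnu \<nu> S" "Hnu_limit \<nu> s u" "Hnu_limit \<nu> r f"
    and uf: "u \<in> Hnu \<nu> S" "f \<in> Hnu \<nu> S"
    using assms by (auto simp: Hnu_closure_def)
  have sr: "(s n, r n) \<in> G" "s n \<in> Hnu \<nu> S" "r n \<in> Hnu \<nu> S" for n using *(1) by auto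
  show ?thesis
    by (rule that[OF sr uf]) (use *(2,3) Hnu_limit_iff[OF sr(2) uf(1)] Hnu_limit_iff[OF sr(3) uf(2)] in simp_all)
qed

lemma Hnu_closureI:
  assumes "\<And>n. (s n, r n) \<in> G" "\<And>n. s n \<in> Hnu \<nu> S" "\<And>n. r n \<in> Hnu \<nu> S"
    "u \<in> Hnu \<nu> S" "f \<in> Hnu \<nu> S"
    "(\<lambda>n. l2_norm (weighted \<nu>) (\<lambda>t. s n t - u t)) \<longlonglongrightarrow> 0"
    "(\<lambda>n. l2_norm (weighted \<nu>) (\<lambda>t. r n t - f t)) \<longlonglongrightarrow> 0"
  shows "(u, f) \<in> Hnu_closure \<nu> S G"
proof -
  have "Hnu_limit \<nu> s u" "Hnu_limit \<nu> r f"
    using assms(6,7) Hnu_limit_iff[OF assms(2,4)] Hnu_limit_iff[OF assms(3,5)] by simp_all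
  moreover have "\<forall>n. (s n, r n) \<in> G \<inter> Hnu \<nu> S \<times> Hnu \<nu> S" using assms(1-3) by simp
  ultimately have "\<exists>s r. (\<forall>n. (s n, r n) \<in> G \<inter> Hnu \<nu> S \<times> Hnu \<nu> S) \<and> Hnu_limit \<nu> s u \<and> Hnu_limit \<nu> r f"
    by (intro exI conjI)
  then show ?thesis unfolding Hnu_closure_def using assms(4,5) by simp
qed

lemma Hnu_closure_add_scale:
  assumes G: "\<And>u f v g. (u, f) \<in> G \<Longrightarrow> (v, g) \<in> G \<Longrightarrow> (\<lambda>t. u t + c *\<^sub>R v t, \<lambda>t. f t + c *\<^sub>R g t) \<in> G"
    and uf: "(u, f) \<in> Hnu_closure \<nu> S G" and vg: "(v, g) \<in> Hnu_closure \<nu> S G"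
  shows "(\<lambda>t. u t + c *\<^sub>R v t, \<lambda>t. f t + c *\<^sub>R g t) \<in> Hnu_closure \<nu> S G"
proof -
  obtain s r where s: "\<And>n. (s n, r n) \<in> G" "\<And>n. s n \<in> Hnu \<nu> S" "\<And>n. r n \<in> Hnu \<nu> S"
    "u \<in> Hnu \<nu> S" "f \<in> Hnu \<nu> S"
    "(\<lambda>n. l2_norm (weighted \<nu>) (\<lambda>t. s n t - u t)) \<longlonglongrightarrow> 0"
    "(\<lambda>n. l2_norm (weighted \<nu>) (\<lambda>t. r n t - f t)) \<longlonglongrightarrow> 0"
    using uf by (rule Hnu_closureE) blast
  obtain s' r' where s': "\<And>n. (s' n, r' n) \<in> G" "\<And>n. s' n \<in> Hnu \<nu> S" "\<And>n. r' n \<in> Hnu \<nu> S"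
    "v \<in> Hnu \<nu> S" "g \<in> Hnu \<nu> S"
    "(\<lambda>n. l2_norm (weighted \<nu>) (\<lambda>t. s' n t - v t)) \<longlonglongrightarrow> 0"
    "(\<lambda>n. l2_norm (weighted \<nu>) (\<lambda>t. r' n t - g t)) \<longlonglongrightarrow> 0"
    using vg by (rule Hnu_closureE) blast
  have lim: "(\<lambda>n. l2_norm (weighted \<nu>) (\<lambda>t. (s n t + c *\<^sub>R s' n t) - (u t + c *\<^sub>R v t))) \<longlonglongrightarrow> 0"
    if "\<And>n. s n \<in> Hnu \<nu> S" "u \<in> Hnu \<nu> S" "\<And>n. s' n \<in> Hnu \<nu> S" "v \<in> Hnu \<nu> S"
      and l: "(\<lambda>n. l2_norm (weighted \<nu>) (\<lambda>t. s n t - u t)) \<longlonglongrightarrow> 0"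
        "(\<lambda>n. l2_norm (weighted \<nu>) (\<lambda>t. s' n t - v t)) \<longlonglongrightarrow> 0" for s s' u v
  proof (rule Lim_null_comparison)
    show "(\<lambda>n. l2_norm (weighted \<nu>) (\<lambda>t. s n t - u t) + \<bar>c\<bar> * l2_norm (weighted \<nu>) (\<lambda>t. s' n t - v t)) \<longlonglongrightarrow> 0"
      using tendsto_add[OF l(1) tendsto_mult_left[OF l(2), of "\<bar>c\<bar>"]] by simp
    show "\<forall>\<^sub>F n in sequentially. norm (l2_norm (weighted \<nu>) (\<lambda>t. (s n t + c *\<^sub>R s' n t) - (u t + c *\<^sub>R v t)))
        \<le> l2_norm (weighted \<nu>) (\<lambda>t. s n t - u t) + \<bar>c\<bar> * l2_norm (weighted \<nu>) (\<lambda>t. s' n t - v t)"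
    proof (rule always_eventually, rule allI)
      fix n
      have "l2_norm (weighted \<nu>) (\<lambda>t. (s n t - u t) + c *\<^sub>R (s' n t - v t)) \<le>
          l2_norm (weighted \<nu>) (\<lambda>t. s n t - u t) + l2_norm (weighted \<nu>) (\<lambda>t. c *\<^sub>R (s' n t - v t))"
        by (rule l2_norm_triangle[OF square_integrable_diff[OF HnuD(1) HnuD(1)]
              square_integrable_scaleR[OF square_integrable_diff[OF HnuD(1) HnuD(1)]]]) (rule that)+
      also have "(\<lambda>t. (s n t - u t) + c *\<^sub>R (s' n t - v t)) = (\<lambda>t. (s n t + c *\<^sub>R s' n t) - (u t + c *\<^sub>R v t))"
        by (simp add: algebra_simps fun_eq_iff)
      finally show "norm (l2_norm (weighted \<nu>) (\<lambda>t. (s n t + c *\<^sub>R s' n t) - (u t + c *\<^sub>R v t)))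
        \<le> l2_norm (weighted \<nu>) (\<lambda>t. s n t - u t) + \<bar>c\<bar> * l2_norm (weighted \<nu>) (\<lambda>t. s' n t - v t)"
        by (simp only: l2_norm_scaleR real_norm_def abs_of_nonneg[OF l2_norm_nonneg])
    qed
  qed
  show ?thesis
    by (rule Hnu_closureI[OF G[OF s(1) s'(1)] Hnu_add_scale[OF s(2) s'(2)] Hnu_add_scale[OF s(3) s'(3)]
          Hnu_add_scale[OF s(4) s'(4)] Hnu_add_scale[OF s(5) s'(5)]
          lim[OF s(2,4) s'(2,4) s(6) s'(6)] lim[OF s(3,5) s'(3,5) s(7) s'(7)]])
qed

section \<open>The weighted time derivative and testing in time\<close>

abbreviation "test_graph \<equiv>
  {(\<phi>, \<lambda>t. vector_derivative \<phi> (at t)) | \<phi> :: real \<Rightarrow> 'h. test_function UNIV \<phi> \<and> range \<phi> \<subseteq> S}"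

lemma test_graphE:
  assumes "(s, r) \<in> test_graph"
  shows "test_function UNIV s" "r = dir_deriv 1 s" "s t \<in> S"
  using assms smooth_on_real_vector_derivative[OF test_function_smooth] by auto

lemma time_derivI:
  assumes \<phi>: "test_function UNIV \<phi>" "\<And>t. \<phi> t \<in> S" "\<And>t. dir_deriv 1 \<phi> t \<in> S"
  shows "(\<phi>, dir_deriv 1 \<phi>) \<in> time_deriv_graph \<nu> S"
  unfolding time_deriv_graph_def
proof (rule Hnu_closureI[where s = "\<lambda>_. \<phi>" and r = "\<lambda>_. dir_deriv 1 \<phi>"])
  show "(\<phi>, dir_deriv 1 \<phi>) \<in> test_graph"
    unfolding smooth_on_real_vector_derivative[OF test_function_smooth[OF \<phi>(1)], symmetric]
    using \<phi> by auto
  show "\<phi> \<in> Hnu \<nu> S" "\<phi> \<in> Hnu \<nu> S" using \<phi> test_function_weighted by (auto simp: Hnu_iff)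
  show "dir_deriv 1 \<phi> \<in> Hnu \<nu> S" "dir_deriv 1 \<phi> \<in> Hnu \<nu> S"
    using \<phi> test_function_weighted[OF test_function_dir_deriv[OF \<phi>(1)]] by (auto simp: Hnu_iff)
qed auto

lemma time_deriv_Hnu:
  assumes "(w, v) \<in> time_deriv_graph \<nu> S" shows "w \<in> Hnu \<nu> S" "v \<in> Hnu \<nu> S"
  using assms by (auto simp: time_deriv_graph_def Hnu_closure_def)

lemma time_deriv_add_scale:
  assumes "(w, v) \<in> time_deriv_graph \<nu> S" "(w', v') \<in> time_deriv_graph \<nu> S"
  shows "(\<lambda>t. w t + c *\<^sub>R w' t, \<lambda>t. v t + c *\<^sub>R v' t) \<in> time_deriv_graph \<nu> S"
  using _ assms unfolding time_deriv_graph_def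
proof (rule Hnu_closure_add_scale)
  fix u f v g assume uf: "(u, f) \<in> test_graph" and vg: "(v, g) \<in> test_graph"
  note u = test_graphE[OF uf] and v = test_graphE[OF vg]
  have cv: "test_function UNIV (\<lambda>t. c *\<^sub>R v t)"
    by (rule test_function_bounded_linear[OF bounded_linear_scaleR_right v(1)])
  have uv: "test_function UNIV (\<lambda>t. u t + c *\<^sub>R v t)" by (rule test_function_add[OF u(1) cv])
  have "(\<lambda>t. vector_derivative (\<lambda>t. u t + c *\<^sub>R v t) (at t)) = (\<lambda>t. f t + c *\<^sub>R g t)"
    unfolding smooth_on_real_vector_derivative[OF test_function_smooth[OF uv]]
      dir_deriv_add[OF test_function_smooth[OF u(1)] test_function_smooth[OF cv]]
      dir_deriv_bounded_linear[OF bounded_linear_scaleR_right test_function_smooth[OF v(1)]] u(2) v(2) ..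
  moreover have "range (\<lambda>t. u t + c *\<^sub>R v t) \<subseteq> S" using S_add[OF u(3) S_scaleR[OF v(3)]] by blast
  ultimately show "(\<lambda>t. u t + c *\<^sub>R v t, \<lambda>t. f t + c *\<^sub>R g t) \<in> test_graph"
    using uv by (auto intro!: exI[of _ "\<lambda>t. u t + c *\<^sub>R v t"])
qed

text \<open>The identity holds on the core of test functions, and both sides depend continuously on
  w and v. The derivative sits on \<eta>, so only w itself remains on the right.\<close>

lemma time_deriv_weak:
  assumes wv: "(w, v) \<in> time_deriv_graph \<nu> S" and \<eta>: "test_function UNIV \<eta>"
  shows "(LINT t|weighted \<nu>. v t \<bullet> \<eta> t) = - (LINT t|weighted \<nu>. w t \<bullet> (dir_deriv 1 \<eta> t - (2 * \<nu>) *\<^sub>R \<eta> t))"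
proof -
  obtain s r where s: "\<And>n. (s n, r n) \<in> test_graph" "\<And>n. s n \<in> Hnu \<nu> S" "\<And>n. r n \<in> Hnu \<nu> S"
    "w \<in> Hnu \<nu> S" "v \<in> Hnu \<nu> S"
    "(\<lambda>n. l2_norm (weighted \<nu>) (\<lambda>t. s n t - w t)) \<longlonglongrightarrow> 0"
    "(\<lambda>n. l2_norm (weighted \<nu>) (\<lambda>t. r n t - v t)) \<longlonglongrightarrow> 0"
    using wv unfolding time_deriv_graph_def by (rule Hnu_closureE) blast
  let ?\<theta> = "\<lambda>t. dir_deriv 1 \<eta> t - (2 * \<nu>) *\<^sub>R \<eta> t"
  have \<eta>_si: "square_integrable (weighted \<nu>) \<eta>" by (rule test_function_weighted[OF \<eta>])
  have \<theta>_si: "square_integrable (weighted \<nu>) ?\<theta>"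
    by (rule square_integrable_diff[OF test_function_weighted[OF test_function_dir_deriv[OF \<eta>]]
          square_integrable_scaleR[OF \<eta>_si]]) simp
  have lim1: "(\<lambda>n. LINT t|weighted \<nu>. r n t \<bullet> \<eta> t) \<longlonglongrightarrow> (LINT t|weighted \<nu>. v t \<bullet> \<eta> t)"
    by (rule tendsto_l2_inner[OF HnuD(1)[OF s(3)] HnuD(1)[OF s(5)] \<eta>_si \<eta>_si s(7)]) simp
  have lim2: "(\<lambda>n. LINT t|weighted \<nu>. s n t \<bullet> ?\<theta> t) \<longlonglongrightarrow> (LINT t|weighted \<nu>. w t \<bullet> ?\<theta> t)"
    by (rule tendsto_l2_inner[OF HnuD(1)[OF s(2)] HnuD(1)[OF s(4)] \<theta>_si \<theta>_si s(6)]) simp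
  have eq: "(LINT t|weighted \<nu>. r n t \<bullet> \<eta> t) = - (LINT t|weighted \<nu>. s n t \<bullet> ?\<theta> t)" for n
    unfolding test_graphE(2)[OF s(1)] by (rule weighted_integral_by_parts[OF test_graphE(1)[OF s(1)] \<eta>])
  show ?thesis by (rule LIMSEQ_unique[OF lim1[unfolded eq] tendsto_minus[OF lim2]])
qed

text \<open>On test functions, integration by parts against \<open>N s\<close> and symmetry of N
  give I = -I + 2 \<nu> J, where I and J are the two integrals; hence I = \<nu> J. Boundedness of N
  passes this to the closure.\<close>

lemma time_deriv_energy:
  assumes wv: "(w, v) \<in> time_deriv_graph \<nu> S"
  shows "(LINT t|weighted \<nu>. v t \<bullet> N (w t)) = \<nu> * (LINT t|weighted \<nu>. w t \<bullet> N (w t))"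
proof -
  obtain s r where s: "\<And>n. (s n, r n) \<in> test_graph" "\<And>n. s n \<in> Hnu \<nu> S" "\<And>n. r n \<in> Hnu \<nu> S"
    "w \<in> Hnu \<nu> S" "v \<in> Hnu \<nu> S"
    "(\<lambda>n. l2_norm (weighted \<nu>) (\<lambda>t. s n t - w t)) \<longlonglongrightarrow> 0"
    "(\<lambda>n. l2_norm (weighted \<nu>) (\<lambda>t. r n t - v t)) \<longlonglongrightarrow> 0"
    using wv unfolding time_deriv_graph_def by (rule Hnu_closureE) blast
  note Ns = square_integrable_bounded_linear[OF N(1) HnuD(1)]
  note limN = tendsto_l2_bounded_linear[OF N(1) HnuD(1)[OF s(2)] HnuD(1)[OF s(4)] s(6)]
  have lim1: "(\<lambda>n. LINT t|weighted \<nu>. r n t \<bullet> N (s n t)) \<longlonglongrightarrow> (LINT t|weighted \<nu>. v t \<bullet> N (w t))"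
    by (rule tendsto_l2_inner[OF HnuD(1)[OF s(3)] HnuD(1)[OF s(5)] Ns[OF s(2)] Ns[OF s(4)] s(7) limN])
  have lim2: "(\<lambda>n. LINT t|weighted \<nu>. s n t \<bullet> N (s n t)) \<longlonglongrightarrow> (LINT t|weighted \<nu>. w t \<bullet> N (w t))"
    by (rule tendsto_l2_inner[OF HnuD(1)[OF s(2)] HnuD(1)[OF s(4)] Ns[OF s(2)] Ns[OF s(4)] s(6) limN])
  have eq: "(LINT t|weighted \<nu>. r n t \<bullet> N (s n t)) = \<nu> * (LINT t|weighted \<nu>. s n t \<bullet> N (s n t))" for n
  proof -
    note sn = test_graphE[OF s(1)[of n]]
    have "(LINT t|weighted \<nu>. r n t \<bullet> N (s n t)) =
        - (LINT t|weighted \<nu>. s n t \<bullet> (N (r n t) - (2 * \<nu>) *\<^sub>R N (s n t)))"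
      using weighted_integral_by_parts[OF sn(1) test_function_bounded_linear[OF N(1) sn(1)], of \<nu>]
      unfolding dir_deriv_bounded_linear[OF N(1) test_function_smooth[OF sn(1)]] sn(2) .
    also have "(LINT t|weighted \<nu>. s n t \<bullet> (N (r n t) - (2 * \<nu>) *\<^sub>R N (s n t))) =
        (LINT t|weighted \<nu>. r n t \<bullet> N (s n t) - (2 * \<nu>) * (s n t \<bullet> N (s n t)))"
      using N_sym[OF HnuD(2)[OF s(2)] HnuD(2)[OF s(3)]]
      by (intro Bochner_Integration.integral_cong refl) (simp add: inner_diff_right inner_commute)
    also have "\<dots> = (LINT t|weighted \<nu>. r n t \<bullet> N (s n t)) - 2 * \<nu> * (LINT t|weighted \<nu>. s n t \<bullet> N (s n t))"
      using integrable_inner[OF HnuD(1)[OF s(3)] Ns[OF s(2)]] integrable_inner[OF HnuD(1)[OF s(2)] Ns[OF s(2)]]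
      by simp
    finally show ?thesis by simp
  qed
  show ?thesis by (rule LIMSEQ_unique[OF lim1[unfolded eq] tendsto_mult_left[OF lim2]])
qed

text \<open>Reduces density statements in \<open>Hnu\<close> to products of a scalar test function
  of time and a vector from a dense set: indicators of intervals are replaced by bumps, at the cost
  of half the tolerance.\<close>

lemma l2_approx_test:
  fixes G :: "(real \<Rightarrow> 'h) set"
  assumes G: "\<And>g. g \<in> G \<Longrightarrow> square_integrable (weighted \<nu>) g"
    and add: "\<And>g h. g \<in> G \<Longrightarrow> h \<in> G \<Longrightarrow> (\<lambda>x. g x + h x) \<in> G"
    and test: "\<And>\<xi> y e. test_function UNIV \<xi> \<Longrightarrow> y \<in> D \<Longrightarrow> e > 0 \<Longrightarrow>
      \<exists>g\<in>G. l2_norm (weighted \<nu>) (\<lambda>t. \<xi> t *\<^sub>R y - g t) < e"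
    and dense: "\<And>x e. x \<in> S \<Longrightarrow> e > 0 \<Longrightarrow> \<exists>y\<in>D. norm (x - y) < e"
    and f: "f \<in> Hnu \<nu> S"
  shows "l2_approx (weighted \<nu>) G f"
proof (rule l2_approx_boxes[where \<Omega> = UNIV and P = P and D = D])
  show "\<exists>g\<in>G. l2_norm (weighted \<nu>) (\<lambda>x. indicator (box a b) x *\<^sub>R y - g x) < e"
    if y: "y \<in> D" and e: "e > 0" for a b y e
  proof -
    let ?I = "\<lambda>x. indicator (box a b) x *\<^sub>R y"
    obtain n where n: "n > 0" "l2_norm (weighted \<nu>) (\<lambda>x. bump a b n x *\<^sub>R y - ?I x) < e / 2"
      by (rule bump_l2_approx[OF sets_weighted emeasure_weighted_box half_gt_zero[OF e]])
    have bt: "test_function UNIV (bump a b n)" by (rule test_function_bump[OF subset_UNIV n(1)])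
    obtain g where g: "g \<in> G" "l2_norm (weighted \<nu>) (\<lambda>t. bump a b n t *\<^sub>R y - g t) < e / 2"
      using test[OF bt y, of "e / 2"] e by auto
    have si_I: "square_integrable (weighted \<nu>) ?I"
      by (rule square_integrable_indicator[OF _ emeasure_weighted_box]) simp
    have "l2_norm (weighted \<nu>) (\<lambda>x. ?I x - g x) \<le> l2_norm (weighted \<nu>) (\<lambda>x. ?I x - bump a b n x *\<^sub>R y)
        + l2_norm (weighted \<nu>) (\<lambda>x. bump a b n x *\<^sub>R y - g x)"
      by (rule l2_norm_triangle_diff[OF si_I test_function_weighted[OF test_function_scaleR[OF bt]] G[OF g(1)]])
    also have "l2_norm (weighted \<nu>) (\<lambda>x. ?I x - bump a b n x *\<^sub>R y) < e / 2"
      using n(2) by (subst l2_norm_minus_commute)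
    finally have "l2_norm (weighted \<nu>) (\<lambda>x. ?I x - g x) < e" using g(2) by linarith
    then show ?thesis using g(1) by (rule bexI)
  qed
  show "\<exists>z\<in>D. norm (y - z) < e" if "y \<in> range P" "e > 0" for y e
    using dense[OF _ that(2)] that(1) P(2) by blast
  show "P (f t) = f t" for t by (rule P(3)[OF HnuD(2)[OF f]])
qed (use emeasure_weighted_box P(1) G add HnuD(1)[OF f] in auto)

text \<open>Let G be the orthogonal complement of g. By hypothesis it contains all products \<xi> y,
  so g can be approximated by some h in G; then |g|^2 is the pairing of g with g - h, and g must
  vanish.\<close>

lemma weakly_zero_imp_AE_zero:
  assumes g: "g \<in> Hnu \<nu> S"
    and dense: "\<And>x e. x \<in> S \<Longrightarrow> e > 0 \<Longrightarrow> \<exists>y\<in>D. norm (x - y) < e"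
    and zero: "\<And>\<xi> y. test_function UNIV \<xi> \<Longrightarrow> y \<in> D \<Longrightarrow> (LINT t|weighted \<nu>. g t \<bullet> (\<xi> t *\<^sub>R y)) = 0"
  shows "AE t in lborel. g t = 0"
proof -
  let ?W = "weighted \<nu>"
  define G where "G = {h :: real \<Rightarrow> 'h. square_integrable ?W h \<and> (LINT t|?W. g t \<bullet> h t) = 0}"
  note gs = HnuD(1)[OF g]
  have "l2_approx ?W G g"
  proof (rule l2_approx_test[OF _ _ _ dense g])
    show "square_integrable ?W h" if "h \<in> G" for h using that by (simp add: G_def)
    show "(\<lambda>x. h x + k x) \<in> G" if "h \<in> G" "k \<in> G" for h k
    proof -
      have hk: "square_integrable ?W h" "square_integrable ?W k" "(LINT t|?W. g t \<bullet> h t) = 0" "(LINT t|?W. g t \<bullet> k t) = 0"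
        using that by (auto simp: G_def)
      have "(LINT t|?W. g t \<bullet> (h t + k t)) = 0"
        using hk integrable_inner[OF gs hk(1)] integrable_inner[OF gs hk(2)] by (simp add: inner_add_right)
      then show ?thesis using square_integrable_add[OF hk(1,2)] by (simp add: G_def)
    qed
    show "\<exists>h\<in>G. l2_norm ?W (\<lambda>t. \<xi> t *\<^sub>R y - h t) < e"
      if "test_function UNIV \<xi>" "y \<in> D" "e > 0" for \<xi> y and e :: real
    proof (rule bexI)
      show "l2_norm ?W (\<lambda>t. \<xi> t *\<^sub>R y - \<xi> t *\<^sub>R y) < e" using that by simp
      show "(\<lambda>t. \<xi> t *\<^sub>R y) \<in> G"
        using zero[OF that(1,2)] test_function_weighted[OF test_function_scaleR[OF that(1)]] by (simp add: G_def)
    qed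
  qed
  have "l2_norm ?W g \<le> 0 + e" if e: "e > 0" for e
  proof -
    obtain h where h: "square_integrable ?W h" "(LINT t|?W. g t \<bullet> h t) = 0" "l2_norm ?W (\<lambda>t. g t - h t) < e"
      using \<open>l2_approx ?W G g\<close> e unfolding l2_approx_def G_def by blast
    have "(l2_norm ?W g)\<^sup>2 = (LINT t|?W. g t \<bullet> (g t - h t))"
      using h(2) integrable_inner[OF gs gs] integrable_inner[OF gs h(1)]
      by (simp add: inner_diff_right l2_norm_eq_inner)
    also have "\<dots> \<le> l2_norm ?W g * l2_norm ?W (\<lambda>t. g t - h t)"
      using l2_Cauchy_Schwarz[OF gs square_integrable_diff[OF gs h(1)]] by linarith
    also have "\<dots> \<le> l2_norm ?W g * e" using h(3) by (intro mult_left_mono) auto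
    finally show ?thesis
      by (cases "l2_norm ?W g = 0") (use e in \<open>auto simp: power2_eq_square order_less_le\<close>)
  qed
  then have "l2_norm ?W g \<le> 0" by (rule field_le_epsilon)
  then have "l2_norm ?W g = 0" using l2_norm_nonneg[of ?W g] by linarith
  then show ?thesis unfolding l2_norm_eq_0_iff[OF gs] AE_weighted .
qed

end

section \<open>Energy estimate and closability\<close>

context evolutionary
begin

text \<open>A derivative of a function with values in the range of \<open>M0\<close> should stay in
  that range. Weakly: with z = \<open>N (M0 y)\<close>, the vectors z and y have the same pairing
  with every \<open>M0 (u t)\<close>, so v has the same integral against \<xi> z and \<xi> y;
  symmetry of \<open>M0\<close> and N moves the operators from z back onto v.\<close>

lemma M0_N_time_deriv:
  assumes u: "u \<in> Hnu \<nu> S" and wv: "(\<lambda>t. M0 (u t), v) \<in> time_deriv_graph \<nu> S"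
  shows "AE t in lborel. M0 (N (v t)) = v t"
proof -
  let ?W = "weighted \<nu>"
  have v: "v \<in> Hnu \<nu> S" by (rule time_deriv_Hnu(2)[OF wv])
  define g where "g t = M0 (N (v t)) + (- 1) *\<^sub>R v t" for t
  have g: "g \<in> Hnu \<nu> S"
    unfolding g_def[abs_def]
    by (rule Hnu_add_scale[OF Hnu_bounded_linear[OF M0 Hnu_bounded_linear[OF N v]] v])
  have "AE t in lborel. g t = 0"
  proof (rule weakly_zero_imp_AE_zero[where D = S, OF g])
    show "\<exists>y\<in>S. norm (x - y) < e" if "x \<in> S" "e > 0" for x and e :: real
      using that by (intro bexI[of _ x]) auto
    fix \<xi> :: "real \<Rightarrow> real" and y :: 'h assume \<xi>: "test_function UNIV \<xi>" and y: "y \<in> S"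
    have sm: "smooth_on UNIV \<xi>" by (rule test_function_smooth[OF \<xi>])
    define z where "z = N (M0 y)"
    have z: "z \<in> S" unfolding z_def by (rule N(2)[OF M0(2)[OF y]])
    have vz: "(LINT t|?W. v t \<bullet> (\<xi> t *\<^sub>R z)) =
        - (LINT t|?W. M0 (u t) \<bullet> (dir_deriv 1 \<xi> t *\<^sub>R z - (2 * \<nu>) *\<^sub>R (\<xi> t *\<^sub>R z)))"
      if "z \<in> S" for z
      using time_deriv_weak[OF wv test_function_scaleR[OF \<xi>, of z]] unfolding dir_deriv_scaleR[OF sm] .
    have "M0 (u t) \<bullet> z = M0 (u t) \<bullet> y" for t
    proof -
      have ut: "u t \<in> S" by (rule HnuD(2)[OF u])
      have "M0 (u t) \<bullet> z = N (M0 (u t)) \<bullet> M0 y"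
        unfolding z_def by (rule N_sym[OF M0(2)[OF ut] M0(2)[OF y], symmetric])
      also have "\<dots> = M0 (N (M0 (u t))) \<bullet> y"
        by (rule M0_sym[OF N(2)[OF M0(2)[OF ut]] y, symmetric])
      finally show ?thesis unfolding M0_N[OF ut] .
    qed
    then have "(LINT t|?W. v t \<bullet> (\<xi> t *\<^sub>R z)) = (LINT t|?W. v t \<bullet> (\<xi> t *\<^sub>R y))"
      unfolding vz[OF y] vz[OF z] by (simp add: inner_diff_right)
    moreover have "M0 (N (v t)) \<bullet> (\<xi> t *\<^sub>R y) = v t \<bullet> (\<xi> t *\<^sub>R z)" for t
    proof -
      have vt: "v t \<in> S" by (rule HnuD(2)[OF v])
      show ?thesis
        using M0_sym[OF N(2)[OF vt] y] N_sym[OF vt M0(2)[OF y]] by (simp add: z_def)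
    qed
    then have "g t \<bullet> (\<xi> t *\<^sub>R y) = v t \<bullet> (\<xi> t *\<^sub>R z) - v t \<bullet> (\<xi> t *\<^sub>R y)" for t
      unfolding g_def inner_add_left inner_scaleR_left by (simp only:)
    moreover have "integrable ?W (\<lambda>t. v t \<bullet> (\<xi> t *\<^sub>R x))" for x
      by (rule integrable_inner[OF HnuD(1)[OF v] test_function_weighted[OF test_function_scaleR[OF \<xi>]]])
    ultimately show "(LINT t|?W. g t \<bullet> (\<xi> t *\<^sub>R y)) = 0" by simp
  qed
  then show ?thesis by eventually_elim (simp add: g_def)
qed

lemma evo_graphE:
  assumes "(u, f) \<in> evo_graph \<nu>"
  obtains v a where "u \<in> Hnu \<nu> S" "f \<in> Hnu \<nu> S" "v \<in> Hnu \<nu> S" "a \<in> Hnu \<nu> S"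
    "(\<lambda>t. M0 (u t), v) \<in> time_deriv_graph \<nu> S" "AE t in lborel. (u t, a t) \<in> A"
    "AE t in lborel. f t = v t + M1 (u t) + a t"
  using assms time_deriv_Hnu(2) unfolding evo_graph_def pointwise_graph_def by auto

lemma evo_graph_subset: "evo_graph \<nu> \<subseteq> Hnu \<nu> S \<times> Hnu \<nu> S"
  by (auto simp: evo_graph_def)

lemma integral_weighted_cong_AE:
  fixes f g :: "real \<Rightarrow> real"
  assumes "integrable (weighted \<nu>) f" "integrable (weighted \<nu>) g" "AE t in lborel. f t = g t"
  shows "(LINT t|weighted \<nu>. f t) = (LINT t|weighted \<nu>. g t)"
  by (rule integral_cong_AE[OF borel_measurable_integrable[OF assms(1)]
        borel_measurable_integrable[OF assms(2)]]) (use assms(3) in \<open>simp only: AE_weighted\<close>)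

text \<open>Since v = \<open>M0 (N v)\<close> almost everywhere, symmetry rewrites u \<bullet> v as
  v \<bullet> \<open>N (M0 u)\<close>. Now only w = \<open>M0 u\<close> and its derivative occur,
  and \<open>time_deriv_energy\<close> applies; the contribution of A drops out by
  skew-symmetry.\<close>

lemma evo_graph_energy:
  assumes uf: "(u, f) \<in> evo_graph \<nu>"
  shows "(LINT t|weighted \<nu>. u t \<bullet> f t) = (LINT t|weighted \<nu>. \<nu> * (u t \<bullet> M0 (u t)) + u t \<bullet> M1 (u t))"
proof -
  let ?W = "weighted \<nu>"
  obtain v a where u: "u \<in> Hnu \<nu> S" and f: "f \<in> Hnu \<nu> S" and v: "v \<in> Hnu \<nu> S" and a: "a \<in> Hnu \<nu> S"
    and wv: "(\<lambda>t. M0 (u t), v) \<in> time_deriv_graph \<nu> S" and ua: "AE t in lborel. (u t, a t) \<in> A"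
    and eq: "AE t in lborel. f t = v t + M1 (u t) + a t"
    using uf by (rule evo_graphE) blast
  have M0u: "(\<lambda>t. M0 (u t)) \<in> Hnu \<nu> S" and M1u: "(\<lambda>t. M1 (u t)) \<in> Hnu \<nu> S"
    and NM0u: "(\<lambda>t. N (M0 (u t))) \<in> Hnu \<nu> S"
    by - (rule Hnu_bounded_linear[OF M0 u], assumption, rule Hnu_bounded_linear[OF M1 u], assumption,
        rule Hnu_bounded_linear[OF N Hnu_bounded_linear[OF M0 u]])
  note int = integrable_inner[OF HnuD(1) HnuD(1)]
  have "(LINT t|?W. u t \<bullet> f t) = (LINT t|?W. v t \<bullet> N (M0 (u t)) + u t \<bullet> M1 (u t))"
  proof (rule integral_weighted_cong_AE)
    show "AE t in lborel. u t \<bullet> f t = v t \<bullet> N (M0 (u t)) + u t \<bullet> M1 (u t)"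
      using eq ua M0_N_time_deriv[OF u wv]
    proof eventually_elim
      case (elim t)
      have ut: "u t \<in> S" and vt: "v t \<in> S" by (rule HnuD(2)[OF u] HnuD(2)[OF v])+
      have "u t \<bullet> v t = u t \<bullet> M0 (N (v t))" by (simp only: elim(3))
      also have "\<dots> = M0 (u t) \<bullet> N (v t)" by (rule M0_sym[OF ut N(2)[OF vt], symmetric])
      also have "\<dots> = N (M0 (u t)) \<bullet> v t" by (rule N_sym[OF M0(2)[OF ut] vt, symmetric])
      finally show ?case
        using A_orthogonal[OF elim(2)] by (simp add: elim(1) inner_add_right inner_commute)
    qed
  qed (intro Bochner_Integration.integrable_add int u f v M1u NM0u)+
  also have "\<dots> = (LINT t|?W. v t \<bullet> N (M0 (u t))) + (LINT t|?W. u t \<bullet> M1 (u t))"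
    by (rule Bochner_Integration.integral_add[OF int[OF v NM0u] int[OF u M1u]])
  also have "(LINT t|?W. v t \<bullet> N (M0 (u t))) = \<nu> * (LINT t|?W. M0 (u t) \<bullet> N (M0 (u t)))"
    by (rule time_deriv_energy[OF wv])
  also have "(LINT t|?W. M0 (u t) \<bullet> N (M0 (u t))) = (LINT t|?W. u t \<bullet> M0 (u t))"
  proof (rule Bochner_Integration.integral_cong[OF refl])
    fix t
    have ut: "u t \<in> S" by (rule HnuD(2)[OF u])
    show "M0 (u t) \<bullet> N (M0 (u t)) = u t \<bullet> M0 (u t)"
      using M0_sym[OF ut N(2)[OF M0(2)[OF ut]]] by (simp only: M0_N[OF ut])
  qed
  also have "\<nu> * (LINT t|?W. u t \<bullet> M0 (u t)) + (LINT t|?W. u t \<bullet> M1 (u t)) =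
      (LINT t|?W. \<nu> * (u t \<bullet> M0 (u t)) + u t \<bullet> M1 (u t))"
    using int[OF u M0u] int[OF u M1u] by simp
  finally show ?thesis .
qed

text \<open>Coercivity is assumed at \<nu>0 and persists for larger \<nu> because \<open>M0\<close>
  is nonnegative on S. Cauchy-Schwarz on the pairing of u with f then leaves one factor |u| to
  cancel.\<close>

lemma evo_graph_estimate:
  assumes uf: "(u, f) \<in> evo_graph \<nu>" and \<nu>: "\<nu>0 \<le> \<nu>"
  shows "\<delta> * l2_norm (weighted \<nu>) u \<le> l2_norm (weighted \<nu>) f"
proof -
  let ?W = "weighted \<nu>"
  have u: "u \<in> Hnu \<nu> S" and f: "f \<in> Hnu \<nu> S" using uf evo_graph_subset by blast+
  have M0u: "(\<lambda>t. M0 (u t)) \<in> Hnu \<nu> S" and M1u: "(\<lambda>t. M1 (u t)) \<in> Hnu \<nu> S"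
    by - (rule Hnu_bounded_linear[OF M0 u], assumption, rule Hnu_bounded_linear[OF M1 u])
  note int = integrable_inner[OF HnuD(1) HnuD(1)]
  have "\<delta> * (l2_norm ?W u)\<^sup>2 = (LINT t|?W. \<delta> * (norm (u t))\<^sup>2)"
    by (simp add: l2_norm_power2)
  also have "\<dots> \<le> (LINT t|?W. \<nu> * (u t \<bullet> M0 (u t)) + u t \<bullet> M1 (u t))"
  proof (rule integral_mono)
    show "integrable ?W (\<lambda>t. \<delta> * (norm (u t))\<^sup>2)" using square_integrableD[OF HnuD(1)[OF u]] by simp
    show "integrable ?W (\<lambda>t. \<nu> * (u t \<bullet> M0 (u t)) + u t \<bullet> M1 (u t))"
      using int[OF u M0u] int[OF u M1u] by simp
    fix t
    have ut: "u t \<in> S" by (rule HnuD(2)[OF u])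
    have "\<nu>0 * (u t \<bullet> M0 (u t)) \<le> \<nu> * (u t \<bullet> M0 (u t))"
      by (rule mult_right_mono[OF \<nu> M0_nonneg[OF ut]])
    then show "\<delta> * (norm (u t))\<^sup>2 \<le> \<nu> * (u t \<bullet> M0 (u t)) + u t \<bullet> M1 (u t)"
      using coercive[OF ut] by linarith
  qed
  also have "\<dots> = (LINT t|?W. u t \<bullet> f t)" by (rule evo_graph_energy[OF uf, symmetric])
  also have "\<dots> \<le> l2_norm ?W u * l2_norm ?W f"
    using l2_Cauchy_Schwarz[OF HnuD(1)[OF u] HnuD(1)[OF f]] by linarith
  finally have *: "l2_norm ?W u * (\<delta> * l2_norm ?W u) \<le> l2_norm ?W u * l2_norm ?W f"
    by (simp add: power2_eq_square mult.assoc mult.left_commute)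
  show ?thesis
  proof (cases "l2_norm ?W u = 0")
    case False
    then have "l2_norm ?W u > 0" using l2_norm_nonneg[of ?W u] by linarith
    then show ?thesis using * by simp
  qed simp
qed

lemma evo_closure_estimate:
  assumes uf: "(u, f) \<in> Hnu_closure \<nu> S (evo_graph \<nu>)" and \<nu>: "\<nu>0 \<le> \<nu>"
  shows "\<delta> * l2_norm (weighted \<nu>) u \<le> l2_norm (weighted \<nu>) f"
proof -
  obtain s r where s: "\<And>n. (s n, r n) \<in> evo_graph \<nu>" "\<And>n. s n \<in> Hnu \<nu> S" "\<And>n. r n \<in> Hnu \<nu> S"
    "u \<in> Hnu \<nu> S" "f \<in> Hnu \<nu> S"
    "(\<lambda>n. l2_norm (weighted \<nu>) (\<lambda>t. s n t - u t)) \<longlonglongrightarrow> 0"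
    "(\<lambda>n. l2_norm (weighted \<nu>) (\<lambda>t. r n t - f t)) \<longlonglongrightarrow> 0"
    using uf by (rule Hnu_closureE) blast
  show ?thesis
  proof (rule LIMSEQ_le)
    show "(\<lambda>n. \<delta> * l2_norm (weighted \<nu>) (s n)) \<longlonglongrightarrow> \<delta> * l2_norm (weighted \<nu>) u"
      by (rule tendsto_mult_left[OF tendsto_l2_norm[OF HnuD(1)[OF s(2)] HnuD(1)[OF s(4)] s(6)]])
    show "(\<lambda>n. l2_norm (weighted \<nu>) (r n)) \<longlonglongrightarrow> l2_norm (weighted \<nu>) f"
      by (rule tendsto_l2_norm[OF HnuD(1)[OF s(3)] HnuD(1)[OF s(5)] s(7)])
    show "\<exists>N. \<forall>n\<ge>N. \<delta> * l2_norm (weighted \<nu>) (s n) \<le> l2_norm (weighted \<nu>) (r n)"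
      using evo_graph_estimate[OF s(1) \<nu>] by blast
  qed
qed

lemma evo_graph_add_scale:
  assumes "(u, f) \<in> evo_graph \<nu>" "(u', f') \<in> evo_graph \<nu>"
  shows "(\<lambda>t. u t + c *\<^sub>R u' t, \<lambda>t. f t + c *\<^sub>R f' t) \<in> evo_graph \<nu>"
proof -
  obtain v a where u: "u \<in> Hnu \<nu> S" and f: "f \<in> Hnu \<nu> S" and v: "v \<in> Hnu \<nu> S" and a: "a \<in> Hnu \<nu> S"
    and wv: "(\<lambda>t. M0 (u t), v) \<in> time_deriv_graph \<nu> S" and ua: "AE t in lborel. (u t, a t) \<in> A"
    and eq: "AE t in lborel. f t = v t + M1 (u t) + a t"
    using assms(1) by (rule evo_graphE) blast
  obtain v' a' where u': "u' \<in> Hnu \<nu> S" and f': "f' \<in> Hnu \<nu> S" and v': "v' \<in> Hnu \<nu> S" and a': "a' \<in> Hnu \<nu> S"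
    and wv': "(\<lambda>t. M0 (u' t), v') \<in> time_deriv_graph \<nu> S" and ua': "AE t in lborel. (u' t, a' t) \<in> A"
    and eq': "AE t in lborel. f' t = v' t + M1 (u' t) + a' t"
    using assms(2) by (rule evo_graphE) blast
  interpret M0: bounded_linear M0 by (rule M0)
  interpret M1: bounded_linear M1 by (rule M1)
  have "(\<lambda>t. M0 (u t + c *\<^sub>R u' t), \<lambda>t. v t + c *\<^sub>R v' t) \<in> time_deriv_graph \<nu> S"
    using time_deriv_add_scale[OF wv wv'] by (simp only: M0.add M0.scaleR)
  moreover have "AE t in lborel. (u t + c *\<^sub>R u' t, a t + c *\<^sub>R a' t) \<in> A"
    using ua ua'
  proof eventually_elim
    case (elim t)
    then show ?case using subspace_add[OF A_subspace elim(1) subspace_scale[OF A_subspace elim(2), of c]] by simp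
  qed
  moreover have "AE t in lborel. f t + c *\<^sub>R f' t =
      (v t + c *\<^sub>R v' t) + M1 (u t + c *\<^sub>R u' t) + (a t + c *\<^sub>R a' t)"
    using eq eq' by eventually_elim (simp add: M1.add M1.scaleR scaleR_add_right)
  ultimately show ?thesis
    unfolding evo_graph_def pointwise_graph_def mem_Collect_eq prod.case mem_Times_iff fst_conv snd_conv
    by (intro conjI exI[of _ "\<lambda>t. v t + c *\<^sub>R v' t"] exI[of _ "\<lambda>t. a t + c *\<^sub>R a' t"]
        Hnu_add_scale[OF u u'] Hnu_add_scale[OF f f'] Hnu_add_scale[OF a a'])
qed

lemma evo_closure_diff:
  assumes "(u, f) \<in> Hnu_closure \<nu> S (evo_graph \<nu>)" "(v, g) \<in> Hnu_closure \<nu> S (evo_graph \<nu>)"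
  shows "(\<lambda>t. u t - v t, \<lambda>t. f t - g t) \<in> Hnu_closure \<nu> S (evo_graph \<nu>)"
proof -
  have "(\<lambda>t. u t + (- 1) *\<^sub>R v t, \<lambda>t. f t + (- 1) *\<^sub>R g t) \<in> Hnu_closure \<nu> S (evo_graph \<nu>)"
    by (rule Hnu_closure_add_scale[OF _ assms]) (rule evo_graph_add_scale)
  then show ?thesis by simp
qed

text \<open>Both the time derivative and A have been moved onto the test function \<xi> y with y in
  the domain of A, so u enters only through bounded operators. In this form the equation survives
  passage to the closure.\<close>

lemma evo_graph_weak:
  assumes uf: "(u, f) \<in> evo_graph \<nu>" and \<xi>: "test_function UNIV \<xi>" and yb: "(y, b) \<in> A"
  shows "(LINT t|weighted \<nu>. f t \<bullet> (\<xi> t *\<^sub>R y)) =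
      - (LINT t|weighted \<nu>. M0 (u t) \<bullet> (dir_deriv 1 \<xi> t *\<^sub>R y - (2 * \<nu>) *\<^sub>R \<xi> t *\<^sub>R y))
      + (LINT t|weighted \<nu>. M1 (u t) \<bullet> (\<xi> t *\<^sub>R y)) - (LINT t|weighted \<nu>. u t \<bullet> (\<xi> t *\<^sub>R b))"
proof -
  let ?W = "weighted \<nu>"
  obtain v a where u: "u \<in> Hnu \<nu> S" and f: "f \<in> Hnu \<nu> S" and v: "v \<in> Hnu \<nu> S" and a: "a \<in> Hnu \<nu> S"
    and wv: "(\<lambda>t. M0 (u t), v) \<in> time_deriv_graph \<nu> S" and ua: "AE t in lborel. (u t, a t) \<in> A"
    and eq: "AE t in lborel. f t = v t + M1 (u t) + a t"
    using uf by (rule evo_graphE) blast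
  have M1u: "(\<lambda>t. M1 (u t)) \<in> Hnu \<nu> S" by (rule Hnu_bounded_linear[OF M1 u])
  have int: "integrable ?W (\<lambda>t. h t \<bullet> (\<xi> t *\<^sub>R x))" if "h \<in> Hnu \<nu> S" for h x
    by (rule integrable_inner[OF HnuD(1)[OF that] test_function_weighted[OF test_function_scaleR[OF \<xi>]]])
  have "(LINT t|?W. f t \<bullet> (\<xi> t *\<^sub>R y)) =
      (LINT t|?W. v t \<bullet> (\<xi> t *\<^sub>R y) + M1 (u t) \<bullet> (\<xi> t *\<^sub>R y) - u t \<bullet> (\<xi> t *\<^sub>R b))"
  proof (rule integral_weighted_cong_AE)
    show "AE t in lborel. f t \<bullet> (\<xi> t *\<^sub>R y) = v t \<bullet> (\<xi> t *\<^sub>R y) + M1 (u t) \<bullet> (\<xi> t *\<^sub>R y) - u t \<bullet> (\<xi> t *\<^sub>R b)"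
      using eq ua
    proof eventually_elim
      case (elim t)
      then show ?case using A_skew[OF elim(2) yb] by (simp add: inner_add_left algebra_simps)
    qed
  qed (intro Bochner_Integration.integrable_add Bochner_Integration.integrable_diff int u f v M1u)+
  also have "\<dots> = (LINT t|?W. v t \<bullet> (\<xi> t *\<^sub>R y)) + (LINT t|?W. M1 (u t) \<bullet> (\<xi> t *\<^sub>R y))
      - (LINT t|?W. u t \<bullet> (\<xi> t *\<^sub>R b))"
    using int[OF v, of y] int[OF M1u, of y] int[OF u, of b] by simp
  also have "(LINT t|?W. v t \<bullet> (\<xi> t *\<^sub>R y)) =
      - (LINT t|?W. M0 (u t) \<bullet> (dir_deriv 1 \<xi> t *\<^sub>R y - (2 * \<nu>) *\<^sub>R \<xi> t *\<^sub>R y))"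
    using time_deriv_weak[OF wv test_function_scaleR[OF \<xi>, of y]]
    unfolding dir_deriv_scaleR[OF test_function_smooth[OF \<xi>]] .
  finally show ?thesis .
qed

lemma evo_closure_weak:
  assumes uf: "(u, f) \<in> Hnu_closure \<nu> S (evo_graph \<nu>)" and \<xi>: "test_function UNIV \<xi>" and yb: "(y, b) \<in> A"
  shows "(LINT t|weighted \<nu>. f t \<bullet> (\<xi> t *\<^sub>R y)) =
      - (LINT t|weighted \<nu>. M0 (u t) \<bullet> (dir_deriv 1 \<xi> t *\<^sub>R y - (2 * \<nu>) *\<^sub>R \<xi> t *\<^sub>R y))
      + (LINT t|weighted \<nu>. M1 (u t) \<bullet> (\<xi> t *\<^sub>R y)) - (LINT t|weighted \<nu>. u t \<bullet> (\<xi> t *\<^sub>R b))"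
proof -
  let ?W = "weighted \<nu>"
  let ?\<theta> = "\<lambda>t. dir_deriv 1 \<xi> t *\<^sub>R y - (2 * \<nu>) *\<^sub>R \<xi> t *\<^sub>R y"
  obtain s r where s: "\<And>n. (s n, r n) \<in> evo_graph \<nu>" "\<And>n. s n \<in> Hnu \<nu> S" "\<And>n. r n \<in> Hnu \<nu> S"
    "u \<in> Hnu \<nu> S" "f \<in> Hnu \<nu> S"
    "(\<lambda>n. l2_norm (weighted \<nu>) (\<lambda>t. s n t - u t)) \<longlonglongrightarrow> 0"
    "(\<lambda>n. l2_norm (weighted \<nu>) (\<lambda>t. r n t - f t)) \<longlonglongrightarrow> 0"
    using uf by (rule Hnu_closureE) blast
  have si: "square_integrable ?W (\<lambda>t. \<xi> t *\<^sub>R x)" for x :: 'h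
    by (rule test_function_weighted[OF test_function_scaleR[OF \<xi>]])
  have si': "square_integrable ?W ?\<theta>"
  proof (rule square_integrable_diff[OF _ square_integrable_scaleR[OF si]])
    show "square_integrable ?W (\<lambda>t. dir_deriv 1 \<xi> t *\<^sub>R y)"
      by (rule test_function_weighted[OF test_function_scaleR[OF test_function_dir_deriv[OF \<xi>]]]) simp
  qed
  have lim: "(\<lambda>n. LINT t|?W. L (z n t) \<bullet> \<eta> t) \<longlonglongrightarrow> (LINT t|?W. L (w t) \<bullet> \<eta> t)"
    if L: "bounded_linear L" and z: "\<And>n. z n \<in> Hnu \<nu> S" "w \<in> Hnu \<nu> S"
      "(\<lambda>n. l2_norm ?W (\<lambda>t. z n t - w t)) \<longlonglongrightarrow> 0" and \<eta>: "square_integrable ?W \<eta>" for L :: "'h \<Rightarrow> 'h" and z w \<eta>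
    by (rule tendsto_l2_inner[OF square_integrable_bounded_linear[OF L HnuD(1)[OF z(1)]]
          square_integrable_bounded_linear[OF L HnuD(1)[OF z(2)]] \<eta> \<eta>
          tendsto_l2_bounded_linear[OF L HnuD(1)[OF z(1)] HnuD(1)[OF z(2)] z(3)]]) simp
  have lim1: "(\<lambda>n. LINT t|?W. r n t \<bullet> (\<xi> t *\<^sub>R y)) \<longlonglongrightarrow> (LINT t|?W. f t \<bullet> (\<xi> t *\<^sub>R y))"
    by (rule lim[OF bounded_linear_ident s(3,5,7) si])
  have lim2: "(\<lambda>n. - (LINT t|?W. M0 (s n t) \<bullet> ?\<theta> t) + (LINT t|?W. M1 (s n t) \<bullet> (\<xi> t *\<^sub>R y))
      - (LINT t|?W. s n t \<bullet> (\<xi> t *\<^sub>R b))) \<longlonglongrightarrow>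
      - (LINT t|?W. M0 (u t) \<bullet> ?\<theta> t) + (LINT t|?W. M1 (u t) \<bullet> (\<xi> t *\<^sub>R y)) - (LINT t|?W. u t \<bullet> (\<xi> t *\<^sub>R b))"
    by (rule tendsto_diff[OF tendsto_add[OF tendsto_minus[OF lim[OF M0(1) s(2,4,6) si']]
            lim[OF M1(1) s(2,4,6) si]] lim[OF bounded_linear_ident s(2,4,6) si]])
  show ?thesis by (rule LIMSEQ_unique[OF lim1[unfolded evo_graph_weak[OF s(1) \<xi> yb]] lim2])
qed

text \<open>This is closability. For u = 0 the weak equation makes f orthogonal to all \<xi> y with
  y in the domain of A, and that domain is dense in S.\<close>

lemma evo_closure_zero:
  assumes uf: "(u, f) \<in> Hnu_closure \<nu> S (evo_graph \<nu>)" and u0: "AE t in lborel. u t = 0"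
  shows "AE t in lborel. f t = 0"
proof (rule weakly_zero_imp_AE_zero[where D = "Domain A"])
  let ?W = "weighted \<nu>"
  have u: "u \<in> Hnu \<nu> S" using uf by (auto simp: Hnu_closure_def)
  show "f \<in> Hnu \<nu> S" using uf by (auto simp: Hnu_closure_def)
  show "\<exists>y\<in>Domain A. norm (x - y) < e" if "x \<in> S" "e > 0" for x e by (rule A_dense[OF that])
  fix \<xi> :: "real \<Rightarrow> real" and y :: 'h assume \<xi>: "test_function UNIV \<xi>" and "y \<in> Domain A"
  then obtain b where yb: "(y, b) \<in> A" by blast
  have zero: "(LINT t|?W. L (u t) \<bullet> \<eta> t) = 0" if L: "bounded_linear L" for L :: "'h \<Rightarrow> 'h" and \<eta>
  proof -
    have "AE t in ?W. L (u t) \<bullet> \<eta> t = 0"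
      using u0 unfolding AE_weighted
      by eventually_elim (simp add: linear_0[OF bounded_linear.linear[OF L]])
    then show ?thesis by (rule integral_eq_zero_AE)
  qed
  show "(LINT t|?W. f t \<bullet> (\<xi> t *\<^sub>R y)) = 0"
    unfolding evo_closure_weak[OF uf \<xi> yb] zero[OF M0(1)] zero[OF M1(1)] zero[OF bounded_linear_ident]
    by simp
qed

section \<open>The implicit Euler scheme and density of the range\<close>

lemma evo_graph_single:
  assumes \<xi>: "test_function UNIV \<xi>" and xa: "(x, a) \<in> A"
  shows "(\<lambda>t. \<xi> t *\<^sub>R x, \<lambda>t. dir_deriv 1 \<xi> t *\<^sub>R M0 x + \<xi> t *\<^sub>R (M1 x + a)) \<in> evo_graph \<nu>"
proof -
  have x: "x \<in> S" and a: "a \<in> S" using xa A_sub by auto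
  interpret M0: bounded_linear M0 by (rule M0)
  interpret M1: bounded_linear M1 by (rule M1)
  have mem: "(\<lambda>t. \<xi> t *\<^sub>R y) \<in> Hnu \<nu> S" if "y \<in> S" "test_function UNIV \<xi>" for y and \<xi> :: "real \<Rightarrow> real"
    using test_function_weighted[OF test_function_scaleR[OF that(2)]] S_scaleR[OF that(1)] by (simp add: Hnu_iff)
  have d\<xi>: "test_function UNIV (dir_deriv 1 \<xi>)" by (rule test_function_dir_deriv[OF \<xi>]) simp
  have "(\<lambda>t. \<xi> t *\<^sub>R M0 x, \<lambda>t. dir_deriv 1 \<xi> t *\<^sub>R M0 x) \<in> time_deriv_graph \<nu> S"
    using time_derivI[OF test_function_scaleR[OF \<xi>, of "M0 x"] S_scaleR[OF M0(2)[OF x]]]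
    unfolding dir_deriv_scaleR[OF test_function_smooth[OF \<xi>]] using S_scaleR[OF M0(2)[OF x]] by simp
  moreover have "(\<lambda>t. \<xi> t *\<^sub>R x, \<lambda>t. \<xi> t *\<^sub>R a) \<in> pointwise_graph \<nu> S A"
    unfolding pointwise_graph_def using mem[OF x \<xi>] mem[OF a \<xi>] subspace_scale[OF A_subspace xa] by simp
  moreover have "(\<lambda>t. dir_deriv 1 \<xi> t *\<^sub>R M0 x + \<xi> t *\<^sub>R (M1 x + a)) \<in> Hnu \<nu> S"
    using Hnu_add_scale[OF mem[OF M0(2)[OF x] d\<xi>] mem[OF S_add[OF M1(2)[OF x] a] \<xi>], of 1] by simp
  ultimately show ?thesis
    unfolding evo_graph_def mem_Collect_eq prod.case mem_Times_iff fst_conv snd_conv M0.scaleR M1.scaleR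
    by (intro conjI mem[OF x \<xi>] exI[of _ "\<lambda>t. dir_deriv 1 \<xi> t *\<^sub>R M0 x"] exI[of _ "\<lambda>t. \<xi> t *\<^sub>R a"])
      (auto simp: scaleR_add_right)
qed

lemma evo_graph_zero: "(\<lambda>_. 0, \<lambda>_. 0) \<in> evo_graph \<nu>"
proof -
  have "(0, 0) \<in> A" using subspace_0[OF A_subspace] by (simp add: zero_prod_def)
  from evo_graph_single[OF test_function_zero this] show ?thesis
    using linear_0[OF bounded_linear.linear[OF M0(1)]] linear_0[OF bounded_linear.linear[OF M1(1)]] by simp
qed

lemma evo_graph_sum:
  assumes "\<And>k::nat. test_function UNIV (\<xi> k)" "\<And>k. (X k, a k) \<in> A"
  shows "(\<lambda>t. \<Sum>k<n. \<xi> k t *\<^sub>R X k, \<lambda>t. \<Sum>k<n. dir_deriv 1 (\<xi> k) t *\<^sub>R M0 (X k) + \<xi> k t *\<^sub>R (M1 (X k) + a k))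
    \<in> evo_graph \<nu>"
proof (induction n)
  case (Suc n)
  from evo_graph_add_scale[OF Suc evo_graph_single[OF assms(1)[of n] assms(2)[of n]], of 1]
  show ?case by simp
qed (use evo_graph_zero in simp)

lemma euler_sequence:
  assumes x: "x \<in> S" and h: "h > 0"
  obtains X a where "\<And>k. (X k, a k) \<in> A"
    "\<And>k. inverse h *\<^sub>R M0 (X k) + M1 (X k) + a k = (case k of 0 \<Rightarrow> x | Suc j \<Rightarrow> inverse h *\<^sub>R M0 (X j))"
proof -
  let ?eq = "\<lambda>z. inverse h *\<^sub>R M0 (fst z) + M1 (fst z) + snd z"
  \<comment> \<open>The equation of the first step is kept in the invariant as an implication
    guarded by n = 0; the recursion links each state to the next.\<close>
  have "\<exists>f. \<forall>n. (f n \<in> A \<and> (n = 0 \<longrightarrow> ?eq (f n) = x)) \<and> ?eq (f (Suc n)) = inverse h *\<^sub>R M0 (fst (f n))"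
  proof (rule dependent_nat_choice)
    obtain y b where "(y, b) \<in> A" "inverse h *\<^sub>R M0 y + M1 y + b = x" using A_range[OF h x] by blast
    then show "\<exists>z. z \<in> A \<and> ((0::nat) = 0 \<longrightarrow> ?eq z = x)" by (intro exI[of _ "(y, b)"]) simp
    fix z :: "'h \<times> 'h" and n :: nat assume "z \<in> A \<and> (n = 0 \<longrightarrow> ?eq z = x)"
    then have "fst z \<in> S" using A_sub by (auto simp: mem_Times_iff)
    then obtain y b where "(y, b) \<in> A" "inverse h *\<^sub>R M0 y + M1 y + b = inverse h *\<^sub>R M0 (fst z)"
      using A_range[OF h S_scaleR[OF M0(2)]] by blast
    then show "\<exists>z'. (z' \<in> A \<and> (Suc n = 0 \<longrightarrow> ?eq z' = x)) \<and> ?eq z' = inverse h *\<^sub>R M0 (fst z)"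
      by (intro exI[of _ "(y, b)"]) simp
  qed
  then obtain f where f: "\<And>n. f n \<in> A" "?eq (f 0) = x" "\<And>n. ?eq (f (Suc n)) = inverse h *\<^sub>R M0 (fst (f n))"
    by blast
  show ?thesis
    by (rule that[of "\<lambda>n. fst (f n)" "\<lambda>n. snd (f n)"]) (use f in \<open>auto split: nat.split\<close>)
qed

text \<open>Pair step k with h \<open>X k\<close> and let E be
  \<open>X k \<bullet> M0 (X k)\<close>. Coercivity costs the amount h \<nu>0 E, and nonnegativity
  of \<open>M0\<close> on \<open>X k - X j\<close> splits the mixed term into half the old and half
  the new energy. So an energy surviving one step is multiplied by at least 1 - 2 h \<nu>0, hence by
  at least q, and weighting step k by \<open>q ^ k\<close> makes the inequalities telescope.\<close>

lemma euler_energy: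
  assumes x: "x \<in> S" and h: "h > 0" and q: "0 < q" "q \<le> 1 - 2 * h * \<nu>0"
    and Xa: "\<And>k. (X k, a k) \<in> A"
    and eq: "\<And>k. inverse h *\<^sub>R M0 (X k) + M1 (X k) + a k = (case k of 0 \<Rightarrow> x | Suc j \<Rightarrow> inverse h *\<^sub>R M0 (X j))"
  shows "(\<Sum>k<n. q ^ k * (norm (X k))\<^sup>2) \<le> (norm x / \<delta>)\<^sup>2"
proof -
  \<comment> \<open>The energy available before step k. The first step has no predecessor; Young's
    inequality with parameter \<delta> converts its source x into the energy h |x|^2 /
    \<delta>.\<close>
  define e where "e k = (case k of 0 \<Rightarrow> h * (norm x)\<^sup>2 / \<delta> | Suc j \<Rightarrow> X j \<bullet> M0 (X j))" for k
  have XS: "X k \<in> S" for k using Xa[of k] A_sub by auto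
  have e_nonneg: "0 \<le> e k" for k
    using M0_nonneg[OF XS] h \<delta> by (auto simp: e_def split: nat.split)
  have step: "q * (X k \<bullet> M0 (X k)) + h * \<delta> * (norm (X k))\<^sup>2 \<le> e k" for k
  proof -
    let ?E = "X k \<bullet> M0 (X k)" and ?y = "case k of 0 \<Rightarrow> x | Suc j \<Rightarrow> inverse h *\<^sub>R M0 (X j)"
    have E: "0 \<le> ?E" by (rule M0_nonneg[OF XS])
    have "X k \<bullet> ?y = inverse h * ?E + X k \<bullet> M1 (X k)"
      unfolding eq[symmetric] using A_orthogonal[OF Xa[of k]] by (simp add: inner_add_right)
    then have "h * (X k \<bullet> ?y) = ?E + h * (X k \<bullet> M1 (X k))" using h by (simp add: distrib_left)
    moreover have "h * (\<delta> * (norm (X k))\<^sup>2) \<le> h * (\<nu>0 * ?E + X k \<bullet> M1 (X k))"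
      using coercive[OF XS] h by (intro mult_left_mono) auto
    ultimately have *: "(1 - h * \<nu>0) * ?E + h * \<delta> * (norm (X k))\<^sup>2 \<le> h * (X k \<bullet> ?y)"
      by (simp add: algebra_simps)
    have qE: "q * ?E \<le> (1 - 2 * h * \<nu>0) * ?E" by (rule mult_right_mono[OF q(2) E])
    show ?thesis
    proof (cases k)
      case 0
      have "X k \<bullet> x \<le> norm (X k) * norm x" by (rule norm_cauchy_schwarz)
      also have "\<dots> \<le> \<delta> / 2 * (norm (X k))\<^sup>2 + (norm x)\<^sup>2 / (2 * \<delta>)"
      proof -
        have "0 \<le> (\<delta> * norm (X k) - norm x)\<^sup>2 / (2 * \<delta>)" using \<delta> by simp
        also have "\<dots> = \<delta> / 2 * (norm (X k))\<^sup>2 + (norm x)\<^sup>2 / (2 * \<delta>) - norm (X k) * norm x"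
          using \<delta> by (simp add: power2_diff field_simps power2_eq_square)
        finally show ?thesis by simp
      qed
      finally have "h * (X k \<bullet> x) \<le> h * (\<delta> / 2 * (norm (X k))\<^sup>2 + (norm x)\<^sup>2 / (2 * \<delta>))"
        using h by (intro mult_left_mono) auto
      also have "\<dots> = (h * \<delta> * (norm (X k))\<^sup>2 + e k) / 2"
        using 0 \<delta> by (simp add: e_def field_simps)
      finally have "2 * ((1 - h * \<nu>0) * ?E) + h * \<delta> * (norm (X k))\<^sup>2 \<le> e k"
        using * 0 by simp
      moreover have "(1 - 2 * h * \<nu>0) * ?E \<le> 2 * ((1 - h * \<nu>0) * ?E)"
        using E by (simp add: algebra_simps)
      ultimately show ?thesis using qE by linarith
    next
      case (Suc j)
      have "0 \<le> (X k - X j) \<bullet> M0 (X k - X j)" by (rule M0_nonneg[OF S_diff[OF XS XS]])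
      also have "\<dots> = ?E - 2 * (X k \<bullet> M0 (X j)) + X j \<bullet> M0 (X j)"
        using M0_sym[OF XS[of k] XS[of j]]
        by (simp add: linear_diff[OF bounded_linear.linear[OF M0(1)]] inner_diff inner_commute)
      finally have "2 * (X k \<bullet> M0 (X j)) \<le> ?E + e k" using Suc by (simp add: e_def)
      moreover have "h * (X k \<bullet> ?y) = X k \<bullet> M0 (X j)" using Suc h by simp
      ultimately have "2 * ((1 - h * \<nu>0) * ?E) + 2 * (h * \<delta> * (norm (X k))\<^sup>2) \<le> ?E + e k" using * by linarith
      moreover have "2 * ((1 - h * \<nu>0) * ?E) = ?E + (1 - 2 * h * \<nu>0) * ?E" by (simp add: algebra_simps)
      moreover have "0 \<le> h * \<delta> * (norm (X k))\<^sup>2" using h \<delta> by simp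
      ultimately show ?thesis using qE by linarith
    qed
  qed
  have "h * \<delta> * (\<Sum>k<n. q ^ k * (norm (X k))\<^sup>2) + q ^ n * e n \<le> h * (norm x)\<^sup>2 / \<delta>"
  proof (induction n)
    case (Suc n)
    have "q ^ n * (q * (X n \<bullet> M0 (X n)) + h * \<delta> * (norm (X n))\<^sup>2) \<le> q ^ n * e n"
      using step[of n] q(1) by (intro mult_left_mono) auto
    then have "h * \<delta> * (q ^ n * (norm (X n))\<^sup>2) + q ^ Suc n * e (Suc n) \<le> q ^ n * e n"
      by (simp add: e_def algebra_simps)
    then show ?case using Suc by (simp add: distrib_left)
  qed (simp add: e_def)
  moreover have "0 \<le> q ^ n * e n" using q(1) e_nonneg by simp
  moreover have "(h * \<delta>) * (norm x / \<delta>)\<^sup>2 = h * (norm x)\<^sup>2 / \<delta>"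
    using \<delta> by (simp add: power2_eq_square)
  ultimately have "(h * \<delta>) * (\<Sum>k<n. q ^ k * (norm (X k))\<^sup>2) \<le> (h * \<delta>) * (norm x / \<delta>)\<^sup>2"
    by linarith
  then show ?thesis using h \<delta> by simp
qed

text \<open>Summation by parts: by the recursion \<open>M1 (X k) + a k\<close> is a difference of
  consecutive terms \<open>M0 (X j) / h\<close>, and reindexing moves the difference onto \<xi>.
  What is left is the error of the difference quotient against d, to be taken as the derivative of
  \<xi>, and one boundary term from stopping at n.\<close>

lemma euler_residual:
  assumes eq: "\<And>k. inverse h *\<^sub>R M0 (X k) + M1 (X k) + a k = (case k of 0 \<Rightarrow> x | Suc j \<Rightarrow> inverse h *\<^sub>R M0 (X j))"
  shows "(\<Sum>k<n. d (t - real k * h) *\<^sub>R M0 (X k) + \<xi> (t - real k * h) *\<^sub>R (M1 (X k) + a k)) - \<xi> t *\<^sub>R x =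
    (\<Sum>k<n. (d (t - real k * h) - inverse h * (\<xi> (t - real k * h) - \<xi> (t - real k * h - h))) *\<^sub>R M0 (X k))
      - \<xi> (t - real n * h) *\<^sub>R (case n of 0 \<Rightarrow> x | Suc j \<Rightarrow> inverse h *\<^sub>R M0 (X j))"
proof (induction n)
  case (Suc n)
  let ?y = "case n of 0 \<Rightarrow> x | Suc j \<Rightarrow> inverse h *\<^sub>R M0 (X j)"
  have 1: "M1 (X n) + a n = ?y - inverse h *\<^sub>R M0 (X n)" unfolding eq[symmetric] by simp
  have 2: "t - real (Suc n) * h = t - real n * h - h" by (simp add: algebra_simps)
  have "(\<Sum>k<Suc n. d (t - real k * h) *\<^sub>R M0 (X k) + \<xi> (t - real k * h) *\<^sub>R (M1 (X k) + a k)) - \<xi> t *\<^sub>R x =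
     ((\<Sum>k<n. d (t - real k * h) *\<^sub>R M0 (X k) + \<xi> (t - real k * h) *\<^sub>R (M1 (X k) + a k)) - \<xi> t *\<^sub>R x)
      + (d (t - real n * h) *\<^sub>R M0 (X n) + \<xi> (t - real n * h) *\<^sub>R (M1 (X n) + a n))"
    by simp
  also have "\<dots> = (\<Sum>k<n. (d (t - real k * h) - inverse h * (\<xi> (t - real k * h) - \<xi> (t - real k * h - h))) *\<^sub>R M0 (X k))
      - \<xi> (t - real n * h) *\<^sub>R ?y
      + (d (t - real n * h) *\<^sub>R M0 (X n) + \<xi> (t - real n * h) *\<^sub>R (?y - inverse h *\<^sub>R M0 (X n)))"
    unfolding Suc.IH 1 ..
  also have "\<dots> = (\<Sum>k<Suc n. (d (t - real k * h) - inverse h * (\<xi> (t - real k * h) - \<xi> (t - real k * h - h))) *\<^sub>R M0 (X k))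
      - \<xi> (t - real n * h - h) *\<^sub>R (inverse h *\<^sub>R M0 (X n))"
    by (simp add: algebra_simps)
  finally show ?case unfolding 2 by simp
qed simp

text \<open>The residual has a consistency part and a truncation part. The delay by k h contributes
  \<open>r ^ k * p ^ k\<close>, where the powers of p match the discrete energy estimate and those
  of r are summed as a geometric series. First h is chosen to make the consistency part small,
  uniformly in n; then n is chosen for the truncation part.\<close>

lemma evo_range_dense:
  fixes \<xi> :: "real \<Rightarrow> real"
  assumes x: "x \<in> S" and \<xi>: "test_function UNIV \<xi>" and e: "e > 0" and \<nu>: "\<nu>0 < \<nu>"
  shows "\<exists>f\<in>Range (evo_graph \<nu>). l2_norm (weighted \<nu>) (\<lambda>t. \<xi> t *\<^sub>R x - f t) < e"
proof -
  let ?W = "weighted \<nu>"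
  \<comment> \<open>The gap is halved: raising \<nu>0 to \<nu>' leaves room for the inequality p^2
    \<le> 1 - 2 h \<nu>0, and the remaining a gives the geometric factor r.\<close>
  define a where "a = (\<nu> - \<nu>0) / 2"
  define \<nu>' where "\<nu>' = \<nu>0 + a"
  have a: "a > 0" using \<nu> by (simp add: a_def)
  have \<nu>': "\<nu>' > 0" "\<nu>' + a = \<nu>"
    using a \<nu>0 by (simp add: \<nu>'_def, simp add: \<nu>'_def a_def field_simps)
  obtain L where L: "L \<ge> 0" "\<And>h. 0 < h \<Longrightarrow> h \<le> 1 \<Longrightarrow>
      l2_norm ?W (\<lambda>t. dir_deriv 1 \<xi> t - inverse h * (\<xi> t - \<xi> (t - h))) \<le> h * L"
    using difference_quotient_bound[OF \<xi>, of \<nu>] by blast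
  obtain B where B: "B \<ge> 0" "\<And>x. norm (M0 x) \<le> norm x * B"
    using bounded_linear.nonneg_bounded[OF M0(1)] by blast
  define Z where "Z = norm x / \<delta>"
  have Z: "Z \<ge> 0" using \<delta> by (simp add: Z_def)
  define C where "C = B * L * Z / sqrt a"
  have C: "C \<ge> 0" using B(1) L(1) Z a by (simp add: C_def)
  \<comment> \<open>The bounds serve, in this order, the difference quotient estimate, the
    inequality for p^2, the inequality for r^2, and the smallness of
    \<open>C * sqrt h\<close>.\<close>
  define h where "h = min (min 1 (a / (2 * \<nu>' * \<nu>0))) (min (1 / (2 * a)) ((e / (2 * (C + 1)))\<^sup>2))"
  have h: "h > 0" using a \<nu>'(1) \<nu>0 e C by (simp add: h_def)
  have h1: "h \<le> 1" and h2: "h \<le> a / (2 * \<nu>' * \<nu>0)" and h3: "h \<le> 1 / (2 * a)"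
    and h4: "h \<le> (e / (2 * (C + 1)))\<^sup>2" by (simp_all add: h_def)
  have h2': "2 * h * \<nu>' * \<nu>0 \<le> a" using h2 \<nu>'(1) \<nu>0 by (simp add: field_simps)
  have h3': "2 * a * h \<le> 1" using h3 a by (simp add: field_simps)
  have "sqrt h \<le> e / (2 * (C + 1))"
    using real_sqrt_le_mono[OF h4] e C by simp
  then have "C * sqrt h \<le> C * (e / (2 * (C + 1)))" using C by (rule mult_left_mono)
  also have "\<dots> < e / 2" using C e by (simp add: field_simps)
  finally have small1: "C * sqrt h < e / 2" .
  define p where "p = exp (- \<nu>' * h)"
  define r where "r = exp (- a * h)"
  have pr: "0 < p" "p \<le> 1" "0 < r" "r < 1" using \<nu>'(1) a h by (auto simp: p_def r_def)
  have exp_bound: "exp (- s) \<le> 1 - w" if "0 \<le> s" "1 \<le> (1 - w) * (1 + s)" for s w :: real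
  proof -
    have "exp (- s) = 1 / exp s" by (simp add: exp_minus field_simps)
    also have "\<dots> \<le> 1 / (1 + s)"
      using exp_ge_add_one_self[of s] that(1) by (intro divide_left_mono) auto
    also have "\<dots> \<le> 1 - w" using that by (simp add: divide_le_eq)
    finally show ?thesis .
  qed
  have q: "p\<^sup>2 \<le> 1 - 2 * h * \<nu>0"
  proof -
    have "p\<^sup>2 = exp (- (2 * \<nu>' * h))" by (simp add: p_def power2_eq_square flip: exp_add)
    also have "\<dots> \<le> 1 - 2 * h * \<nu>0"
    proof (rule exp_bound)
      show "0 \<le> 2 * \<nu>' * h" using \<nu>'(1) h by simp
      have "0 \<le> 2 * h * (a - 2 * h * \<nu>' * \<nu>0)" using h h2' by simp
      also have "\<dots> = (1 - 2 * h * \<nu>0) * (1 + 2 * \<nu>' * h) - 1" by (simp add: \<nu>'_def algebra_simps)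
      finally show "1 \<le> (1 - 2 * h * \<nu>0) * (1 + 2 * \<nu>' * h)" by simp
    qed
    finally show ?thesis .
  qed
  have r2: "r\<^sup>2 \<le> 1 - a * h"
  proof -
    have "r\<^sup>2 = exp (- (2 * a * h))" by (simp add: r_def power2_eq_square flip: exp_add)
    also have "\<dots> \<le> 1 - a * h"
    proof (rule exp_bound)
      show "0 \<le> 2 * a * h" using a h by simp
      have "0 \<le> a * h * (1 - 2 * a * h)" using a h h3' by simp
      then show "1 \<le> (1 - a * h) * (1 + 2 * a * h)" by (simp add: algebra_simps)
    qed
    finally show ?thesis .
  qed
  obtain X b where Xb: "\<And>k. (X k, b k) \<in> A"
    and eq: "\<And>k. inverse h *\<^sub>R M0 (X k) + M1 (X k) + b k = (case k of 0 \<Rightarrow> x | Suc j \<Rightarrow> inverse h *\<^sub>R M0 (X j))"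
    using euler_sequence[OF x h] by blast
  have energy: "(\<Sum>k<n. (p ^ k * norm (X k))\<^sup>2) \<le> Z\<^sup>2" for n
    using euler_energy[OF x h _ q Xb eq, of n] pr(1)
    by (simp add: Z_def power_mult_distrib power_mult[symmetric] mult.commute)
  have single: "p ^ k * norm (X k) \<le> Z" for k
  proof (rule power2_le_imp_le[OF _ Z])
    have "(p ^ k * norm (X k))\<^sup>2 \<le> (\<Sum>k<Suc k. (p ^ k * norm (X k))\<^sup>2)"
      by (rule member_le_sum) auto
    then show "(p ^ k * norm (X k))\<^sup>2 \<le> Z\<^sup>2" using energy[of "Suc k"] by linarith
  qed
  \<comment> \<open>Cauchy-Schwarz separates the powers of r from the energy sum. As 1 - r^2 is at
    least a h, the geometric sum of the squares is at most 1 / (a h), uniformly in n.\<close>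
  have sum_bound: "(\<Sum>k<n. r ^ k * (p ^ k * norm (X k))) \<le> Z / sqrt (a * h)" for n
  proof -
    let ?T = "\<Sum>k<n. r ^ k * (p ^ k * norm (X k))"
    have ah: "a * h > 0" using a h by simp
    have "(1 - r\<^sup>2) * (\<Sum>k<n. (r\<^sup>2) ^ k) = 1 - (r\<^sup>2) ^ n" by (rule one_diff_power_eq[symmetric])
    moreover have "a * h * (\<Sum>k<n. (r\<^sup>2) ^ k) \<le> (1 - r\<^sup>2) * (\<Sum>k<n. (r\<^sup>2) ^ k)"
      using r2 by (intro mult_right_mono sum_nonneg) auto
    moreover have "0 \<le> (r\<^sup>2) ^ n" by simp
    ultimately have geo: "a * h * (\<Sum>k<n. (r\<^sup>2) ^ k) \<le> 1" by linarith
    have "(sqrt (a * h) * ?T)\<^sup>2 = a * h * ?T\<^sup>2" using ah by (simp add: power_mult_distrib)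
    also have "\<dots> \<le> a * h * ((\<Sum>k<n. (r ^ k)\<^sup>2) * (\<Sum>k<n. (p ^ k * norm (X k))\<^sup>2))"
      using ah by (intro mult_left_mono Cauchy_Schwarz_ineq_sum) auto
    also have "\<dots> = (a * h * (\<Sum>k<n. (r\<^sup>2) ^ k)) * (\<Sum>k<n. (p ^ k * norm (X k))\<^sup>2)"
      by (simp add: power_mult[symmetric] mult.commute mult.left_commute)
    also have "\<dots> \<le> 1 * Z\<^sup>2"
      using geo energy by (intro mult_mono sum_nonneg) auto
    finally have "(sqrt (a * h) * ?T)\<^sup>2 \<le> Z\<^sup>2" unfolding mult_1_left .
    then have "sqrt (a * h) * ?T \<le> Z" by (rule power2_le_imp_le[OF _ Z])
    then show ?thesis using ah by (simp add: pos_le_divide_eq mult.commute)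
  qed
  \<comment> \<open>\<open>D * r ^ m\<close> dominates the truncation term. The factor 1/h in D is
    harmless because h is fixed before m is chosen.\<close>
  define D where "D = inverse h * B * Z * l2_norm ?W \<xi>"
  have D: "D \<ge> 0" using h B(1) Z by (simp add: D_def)
  obtain m where m: "r ^ m < e / (2 * (D + 1))"
    using real_arch_pow_inv[OF _ pr(4), of "e / (2 * (D + 1))"] e D by auto
  have "D * r ^ m \<le> D * (e / (2 * (D + 1)))" using m D by (intro mult_left_mono) auto
  also have "\<dots> < e / 2" using D e by (simp add: field_simps)
  finally have small2: "D * r ^ m < e / 2" .
  \<comment> \<open>After n steps the boundary term involves the last computed state, which has
    index m = n - 1; a positive n also rules out the case in which it is x.\<close>
  define n where "n = Suc m"
  let ?w = "\<lambda>t. dir_deriv 1 \<xi> t - inverse h * (\<xi> t - \<xi> (t - h))"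
  have one: "(1::real) \<in> Basis" by simp
  have w_test: "test_function UNIV ?w"
    using test_function_add[OF test_function_dir_deriv[OF \<xi> one]
        test_function_bounded_linear[OF bounded_linear_mult_right[of "- inverse h"]
          test_function_add[OF \<xi> test_function_bounded_linear[OF bounded_linear_mult_right[of "- 1"]
              test_function_shift[OF \<xi>, of h]]]]]
    by (simp add: algebra_simps)
  have w_norm: "l2_norm ?W ?w \<le> h * L" by (rule L(2)[OF h h1])
  let ?F = "\<lambda>t. \<Sum>k<n. dir_deriv 1 \<xi> (t - real k * h) *\<^sub>R M0 (X k) + \<xi> (t - real k * h) *\<^sub>R (M1 (X k) + b k)"
  have F: "?F \<in> Range (evo_graph \<nu>)"
    using evo_graph_sum[of "\<lambda>k t. \<xi> (t - real k * h)" X b n \<nu>, OF test_function_shift[OF \<xi>] Xb]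
    unfolding dir_deriv_shift[OF test_function_smooth[OF \<xi>]] by (rule RangeI)
  let ?y = "inverse h *\<^sub>R M0 (X m)"
  have shift_norm: "l2_norm ?W (\<lambda>t. f (t - c) *\<^sub>R z) = exp (- \<nu> * c) * (l2_norm ?W f * norm z)"
    if "test_function UNIV f" for f :: "real \<Rightarrow> real" and c and z :: 'h
  proof -
    have "(\<lambda>t. f t *\<^sub>R z) \<in> borel_measurable borel"
      using smooth_on_UNIV_continuous[OF test_function_smooth[OF test_function_scaleR[OF that]]]
      by (rule borel_measurable_continuous_onI)
    from l2_norm_weighted_shift[OF this] show ?thesis
      by (simp add: l2_norm_def power_mult_distrib real_sqrt_mult)
  qed
  have exp_k: "exp (- \<nu> * (real k * h)) = r ^ k * p ^ k" for k
  proof -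
    have "exp (- \<nu> * (real k * h)) = exp (real k * (- a * h) + real k * (- \<nu>' * h))"
      unfolding \<nu>'(2)[symmetric] by (simp add: algebra_simps)
    then show ?thesis unfolding exp_add exp_of_nat_mult r_def p_def .
  qed
  have si_w: "square_integrable ?W (\<lambda>t. ?w (t - real k * h) *\<^sub>R z)" for k and z :: 'h
    by (rule test_function_weighted[OF test_function_scaleR[OF test_function_shift[OF w_test]]])
  have si_\<xi>: "square_integrable ?W (\<lambda>t. \<xi> (t - c) *\<^sub>R z)" for c and z :: 'h
    by (rule test_function_weighted[OF test_function_scaleR[OF test_function_shift[OF \<xi>]]])
  have part1: "l2_norm ?W (\<lambda>t. \<Sum>k<n. ?w (t - real k * h) *\<^sub>R M0 (X k)) < e / 2"
  proof -
    have "l2_norm ?W (\<lambda>t. \<Sum>k<n. ?w (t - real k * h) *\<^sub>R M0 (X k))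
        \<le> (\<Sum>k<n. l2_norm ?W (\<lambda>t. ?w (t - real k * h) *\<^sub>R M0 (X k)))"
      by (rule l2_norm_sum[OF si_w])
    also have "\<dots> \<le> (\<Sum>k<n. (h * L * B) * (r ^ k * (p ^ k * norm (X k))))"
    proof (rule sum_mono)
      fix k
      have "l2_norm ?W ?w * norm (M0 (X k)) \<le> (h * L) * (norm (X k) * B)"
        using w_norm B h L(1) by (intro mult_mono) auto
      then have "(r ^ k * p ^ k) * (l2_norm ?W ?w * norm (M0 (X k))) \<le> (r ^ k * p ^ k) * ((h * L) * (norm (X k) * B))"
        using pr by (intro mult_left_mono) auto
      then show "l2_norm ?W (\<lambda>t. ?w (t - real k * h) *\<^sub>R M0 (X k)) \<le> (h * L * B) * (r ^ k * (p ^ k * norm (X k)))"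
        unfolding shift_norm[OF w_test] exp_k by (simp only: mult.assoc mult.commute mult.left_commute)
    qed
    also have "\<dots> = (h * L * B) * (\<Sum>k<n. r ^ k * (p ^ k * norm (X k)))"
      by (simp only: sum_distrib_left)
    also have "\<dots> \<le> (h * L * B) * (Z / sqrt (a * h))"
      using sum_bound[of n] h L(1) B(1) by (intro mult_left_mono) auto
    also have "\<dots> = C * sqrt h"
    proof -
      have "h = sqrt h * sqrt h" using h by simp
      moreover have "sqrt (a * h) = sqrt a * sqrt h" by (rule real_sqrt_mult)
      ultimately show ?thesis using a h by (simp add: C_def field_simps)
    qed
    finally show ?thesis using small1 by linarith
  qed
  have part2: "l2_norm ?W (\<lambda>t. \<xi> (t - real n * h) *\<^sub>R ?y) < e / 2"
  proof -
    have "l2_norm ?W (\<lambda>t. \<xi> (t - real n * h) *\<^sub>R ?y) = (r ^ n * p ^ n) * (l2_norm ?W \<xi> * norm ?y)"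
      unfolding shift_norm[OF \<xi>] exp_k ..
    also have "\<dots> \<le> (r ^ m * p ^ m) * (l2_norm ?W \<xi> * (inverse h * (norm (X m) * B)))"
    proof (intro mult_mono)
      show "r ^ n \<le> r ^ m" "p ^ n \<le> p ^ m" unfolding n_def using pr by (auto intro: power_decreasing)
      show "norm ?y \<le> inverse h * (norm (X m) * B)" using B(2)[of "X m"] h by simp
    qed (use pr h B(1) in auto)
    also have "\<dots> = (r ^ m * (l2_norm ?W \<xi> * inverse h * B)) * (p ^ m * norm (X m))"
      by (simp only: mult.assoc mult.commute mult.left_commute)
    also have "\<dots> \<le> (r ^ m * (l2_norm ?W \<xi> * inverse h * B)) * Z"
      using single[of m] pr h B(1) by (intro mult_left_mono) auto
    also have "\<dots> = D * r ^ m" unfolding D_def by (simp only: mult.assoc mult.commute mult.left_commute)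
    finally show ?thesis using small2 by linarith
  qed
  have "l2_norm ?W (\<lambda>t. \<xi> t *\<^sub>R x - ?F t) = l2_norm ?W (\<lambda>t. ?F t - \<xi> t *\<^sub>R x)"
    by (rule l2_norm_minus_commute)
  also have "\<dots> = l2_norm ?W (\<lambda>t. (\<Sum>k<n. ?w (t - real k * h) *\<^sub>R M0 (X k)) - \<xi> (t - real n * h) *\<^sub>R ?y)"
    unfolding euler_residual[where n = n, OF eq] by (simp add: n_def)
  also have "\<dots> \<le> l2_norm ?W (\<lambda>t. \<Sum>k<n. ?w (t - real k * h) *\<^sub>R M0 (X k)) + l2_norm ?W (\<lambda>t. \<xi> (t - real n * h) *\<^sub>R ?y)"
    by (rule l2_norm_diff_le[OF square_integrable_sum[OF si_w] si_\<xi>])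
  also have "\<dots> < e" using part1 part2 by linarith
  finally show ?thesis using F by (rule bexI)
qed

text \<open>Approximate f by elements of the range. The estimate turns convergence of the right-hand
  sides into the Cauchy property of the solutions, whose limit can be chosen with all values in the
  closed set S.\<close>

lemma evo_closure_surj:
  assumes f: "f \<in> Hnu \<nu> S" and \<nu>: "\<nu>0 < \<nu>"
  obtains u where "(u, f) \<in> Hnu_closure \<nu> S (evo_graph \<nu>)"
proof -
  let ?W = "weighted \<nu>"
  have "l2_approx ?W (Range (evo_graph \<nu>)) f"
  proof (rule l2_approx_test[where D = S, OF _ _ _ _ f])
    show "square_integrable ?W g" if "g \<in> Range (evo_graph \<nu>)" for g
      using that evo_graph_subset[of \<nu>] HnuD(1) by auto
    show "(\<lambda>x. g x + h x) \<in> Range (evo_graph \<nu>)"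
      if gh: "g \<in> Range (evo_graph \<nu>)" "h \<in> Range (evo_graph \<nu>)" for g h
    proof -
      obtain u v where "(u, g) \<in> evo_graph \<nu>" "(v, h) \<in> evo_graph \<nu>" using gh by blast
      from evo_graph_add_scale[OF this, of 1] show ?thesis by (simp only: scaleR_one) (rule RangeI)
    qed
    show "\<exists>y\<in>S. norm (x - y) < e" if "x \<in> S" "e > 0" for x and e :: real
      using that by (intro bexI[of _ x]) auto
  qed (rule evo_range_dense[OF _ _ _ \<nu>])
  then have "\<exists>u g. (u, g) \<in> evo_graph \<nu> \<and> l2_norm ?W (\<lambda>t. f t - g t) < e" if "e > 0" for e
    using that unfolding l2_approx_def by blast
  then have "\<forall>n. \<exists>u g. (u, g) \<in> evo_graph \<nu> \<and> l2_norm ?W (\<lambda>t. f t - g t) < inverse (real (Suc n))"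
    by simp
  then obtain u g where ug: "\<And>n. (u n, g n) \<in> evo_graph \<nu>"
    and fg: "\<And>n. l2_norm ?W (\<lambda>t. f t - g n t) < inverse (real (Suc n))"
    by metis
  have u: "u n \<in> Hnu \<nu> S" and g: "g n \<in> Hnu \<nu> S" for n
    using ug[of n] evo_graph_subset[of \<nu>] by auto
  have g_lim: "(\<lambda>n. l2_norm ?W (\<lambda>t. g n t - f t)) \<longlonglongrightarrow> 0"
  proof (rule Lim_null_comparison[OF always_eventually LIMSEQ_inverse_real_of_nat], rule allI)
    fix n
    show "norm (l2_norm ?W (\<lambda>t. g n t - f t)) \<le> inverse (real (Suc n))"
      using fg[of n] by (subst l2_norm_minus_commute) simp
  qed
  have cau: "\<exists>N. \<forall>m\<ge>N. \<forall>n\<ge>N. l2_norm ?W (\<lambda>t. u m t - u n t) < e" if e: "e > 0" for e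
  proof -
    have "\<forall>\<^sub>F n in sequentially. l2_norm ?W (\<lambda>t. g n t - f t) < \<delta> * e / 2"
      using g_lim by (rule order_tendstoD(2)) (use e \<delta> in simp)
    then obtain M where M: "\<And>n. n \<ge> M \<Longrightarrow> l2_norm ?W (\<lambda>t. g n t - f t) < \<delta> * e / 2"
      unfolding eventually_sequentially by blast
    show ?thesis
    proof (intro exI allI impI)
      fix m n assume mn: "m \<ge> M" "n \<ge> M"
      have "(\<lambda>t. u m t - u n t, \<lambda>t. g m t - g n t) \<in> evo_graph \<nu>"
        using evo_graph_add_scale[OF ug[of m] ug[of n], of "- 1"] by simp
      from evo_graph_estimate[OF this less_imp_le[OF \<nu>]]
      have "\<delta> * l2_norm ?W (\<lambda>t. u m t - u n t) \<le> l2_norm ?W (\<lambda>t. g m t - g n t)" .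
      also have "\<dots> \<le> l2_norm ?W (\<lambda>t. g m t - f t) + l2_norm ?W (\<lambda>t. f t - g n t)"
        by (rule l2_norm_triangle_diff[OF HnuD(1)[OF g] HnuD(1)[OF f] HnuD(1)[OF g]])
      also have "l2_norm ?W (\<lambda>t. f t - g n t) = l2_norm ?W (\<lambda>t. g n t - f t)"
        by (rule l2_norm_minus_commute)
      also have "l2_norm ?W (\<lambda>t. g m t - f t) + l2_norm ?W (\<lambda>t. g n t - f t) < \<delta> * e"
        using M[OF mn(1)] M[OF mn(2)] by linarith
      finally show "l2_norm ?W (\<lambda>t. u m t - u n t) < e" using \<delta> by simp
    qed
  qed
  obtain w where w: "square_integrable ?W w" "(\<lambda>n. l2_norm ?W (\<lambda>t. u n t - w t)) \<longlonglongrightarrow> 0" "\<And>t. w t \<in> S"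
    by (rule l2_complete[OF HnuD(1)[OF u] cau closed_S S_0 HnuD(2)[OF u]]) (assumption, rule that, assumption, assumption, blast)
  have "w \<in> Hnu \<nu> S" unfolding Hnu_iff using w(1,3) by blast
  from Hnu_closureI[OF ug u g this f w(2) g_lim] show ?thesis by (rule that)
qed

theorem well_posed:
  assumes \<nu>: "\<nu>0 < \<nu>"
  shows "continuously_invertible \<nu> S (Hnu_closure \<nu> S (evo_graph \<nu>))"
proof -
  let ?G = "Hnu_closure \<nu> S (evo_graph \<nu>)"
  have sub: "?G \<subseteq> Hnu \<nu> S \<times> Hnu \<nu> S" by (auto simp: Hnu_closure_def)
  have sv: "AE t in lborel. f t = g t"
    if uf: "(u, f) \<in> ?G" and vg: "(v, g) \<in> ?G" and uv: "AE t in lborel. u t = v t" for u f v g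
  proof -
    have "AE t in lborel. u t - v t = 0" using uv by eventually_elim simp
    from evo_closure_zero[OF evo_closure_diff[OF uf vg] this]
    show ?thesis by eventually_elim simp
  qed
  have sv': "AE t in lborel. u t = v t"
    if uf: "(u, f) \<in> ?G" and vg: "(v, g) \<in> ?G" and fg: "AE t in lborel. f t = g t" for u f v g
  proof -
    have d: "(\<lambda>t. u t - v t, \<lambda>t. f t - g t) \<in> ?G" by (rule evo_closure_diff[OF uf vg])
    then have si: "square_integrable (weighted \<nu>) (\<lambda>t. u t - v t)" "square_integrable (weighted \<nu>) (\<lambda>t. f t - g t)"
      using sub HnuD(1) by blast+
    have "AE t in lborel. f t - g t = 0" using fg by eventually_elim simp
    then have "l2_norm (weighted \<nu>) (\<lambda>t. f t - g t) = 0"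
      unfolding l2_norm_eq_0_iff[OF si(2)] AE_weighted .
    then have "\<delta> * l2_norm (weighted \<nu>) (\<lambda>t. u t - v t) \<le> 0"
      using evo_closure_estimate[OF d less_imp_le[OF \<nu>]] by simp
    then have "l2_norm (weighted \<nu>) (\<lambda>t. u t - v t) = 0"
      using \<delta> l2_norm_nonneg[of "weighted \<nu>" "\<lambda>t. u t - v t"] by (simp add: mult_le_0_iff)
    then have "AE t in lborel. u t - v t = 0"
      unfolding l2_norm_eq_0_iff[OF si(1)] AE_weighted .
    then show ?thesis by eventually_elim simp
  qed
  have "single_valued_AE ?G" unfolding single_valued_AE_def using sv by blast
  moreover have "single_valued_AE (?G\<inverse>)" unfolding single_valued_AE_def using sv' by blast
  moreover have "Range ?G = Hnu \<nu> S"
  proof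
    show "Range ?G \<subseteq> Hnu \<nu> S" using sub by blast
    show "Hnu \<nu> S \<subseteq> Range ?G"
    proof
      fix f assume "f \<in> Hnu \<nu> S"
      then obtain u where "(u, f) \<in> ?G" using evo_closure_surj[OF _ \<nu>] by blast
      then show "f \<in> Range ?G" by (rule RangeI)
    qed
  qed
  moreover have "\<exists>K. \<forall>(u, f)\<in>?G. Hnu_norm \<nu> u \<le> K * Hnu_norm \<nu> f"
  proof -
    have "Hnu_norm \<nu> u \<le> inverse \<delta> * Hnu_norm \<nu> f" if uf: "(u, f) \<in> ?G" for u f
    proof -
      have "u \<in> Hnu \<nu> S" "f \<in> Hnu \<nu> S" using uf sub by auto
      then show ?thesis
        using evo_closure_estimate[OF uf less_imp_le[OF \<nu>]] \<delta> by (simp add: Hnu_norm_l2 field_simps)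
    qed
    then show ?thesis by blast
  qed
  ultimately show ?thesis unfolding continuously_invertible_def by (intro conjI)
qed

end

section \<open>Hilbert space preliminaries\<close>

text \<open>For nonzero b take t = -b / s with s larger than |c|: then the linear term outweighs the
  quadratic one and the value is negative.\<close>

lemma le_square_imp_coeff_zero:
  fixes b c :: real
  assumes "\<And>t. 0 \<le> 2 * t * b + t\<^sup>2 * c"
  shows "b = 0"
proof (rule ccontr)
  assume b: "b \<noteq> 0"
  define s where "s = \<bar>c\<bar> + 1"
  have s: "s > 0" "c < s" by (auto simp: s_def)
  have "0 \<le> 2 * (- b / s) * b + (- b / s)\<^sup>2 * c" by (rule assms)
  also have "\<dots> = (b\<^sup>2 / s) * (c / s - 2)" using s by (simp add: power2_eq_square field_simps)
  also have "\<dots> < 0"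
  proof (rule mult_pos_neg)
    show "0 < b\<^sup>2 / s" using b s by simp
    have "c / s < 1" using s by simp
    then show "c / s - 2 < 0" by linarith
  qed
  finally show False by simp
qed

text \<open>The solution minimizes the energy \<open>\<langle>w, Q w\<rangle> - 2\<langle>f, w\<rangle>\<close>; minimizing sequences are Cauchy by
  coercivity.\<close>

lemma symmetric_lax_milgram:
  fixes Q :: "'h::{real_inner, banach} \<Rightarrow> 'h"
  assumes Q: "bounded_linear Q" and W: "subspace W" "closed W"
    and sym: "\<And>x y. x \<in> W \<Longrightarrow> y \<in> W \<Longrightarrow> Q x \<bullet> y = x \<bullet> Q y"
    and \<delta>: "\<delta> > 0" and coercive: "\<And>x. x \<in> W \<Longrightarrow> \<delta> * (norm x)\<^sup>2 \<le> x \<bullet> Q x"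
  shows "\<exists>w\<in>W. \<forall>\<phi>\<in>W. Q w \<bullet> \<phi> = f \<bullet> \<phi>"
proof -
  interpret Q: bounded_linear Q by (rule Q)
  define J where "J w = w \<bullet> Q w - 2 * (f \<bullet> w)" for w
  have expand: "J (w + t *\<^sub>R \<phi>) = J w + 2 * t * (Q w \<bullet> \<phi> - f \<bullet> \<phi>) + t\<^sup>2 * (\<phi> \<bullet> Q \<phi>)"
    if "w \<in> W" "\<phi> \<in> W" for w \<phi> t
  proof -
    have "\<phi> \<bullet> Q w = Q w \<bullet> \<phi>" "w \<bullet> Q \<phi> = Q w \<bullet> \<phi>"
      using sym[OF that] by (simp_all add: inner_commute)
    then show ?thesis
      by (simp add: J_def Q.add Q.scaleR inner_add_left inner_add_right power2_eq_square algebra_simps)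
  qed
  have lower: "- (norm f)\<^sup>2 / \<delta> \<le> J w" if w: "w \<in> W" for w
  proof -
    have "0 \<le> (\<delta> * norm w - norm f)\<^sup>2 / \<delta>" using \<delta> by simp
    also have "\<dots> = \<delta> * (norm w)\<^sup>2 - 2 * (norm f * norm w) + (norm f)\<^sup>2 / \<delta>"
      using \<delta> by (simp add: power2_diff field_simps power2_eq_square)
    finally show ?thesis
      using coercive[OF w] norm_cauchy_schwarz[of f w] by (simp add: J_def)
  qed
  define d where "d = Inf (J ` W)"
  have bdd: "bdd_below (J ` W)" by (rule bdd_belowI2[OF lower])
  have d_le: "d \<le> J w" if "w \<in> W" for w unfolding d_def by (rule cINF_lower[OF bdd that])
  have "0 \<in> W" by (rule subspace_0[OF W(1)])
  have "\<exists>w\<in>W. J w < d + inverse (real (Suc n))" for n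
  proof -
    have "Inf (J ` W) < d + inverse (real (Suc n))" by (simp add: d_def)
    then show ?thesis using cInf_lessD[of "J ` W"] \<open>0 \<in> W\<close> by blast
  qed
  then obtain s where s: "\<And>n. s n \<in> W" "\<And>n. J (s n) < d + inverse (real (Suc n))" by metis
  have dist: "\<delta> * (norm (s m - s n))\<^sup>2 \<le> 2 * (inverse (real (Suc m)) + inverse (real (Suc n)))" for m n
  proof -
    let ?v = "s n - s m"
    have v: "?v \<in> W" by (rule subspace_diff[OF W(1) s(1) s(1)])
    have mid: "s m + (1/2) *\<^sub>R ?v \<in> W"
      by (rule subspace_add[OF W(1) s(1) subspace_scale[OF W(1) v]])
    have "J (s n) = J (s m + 1 *\<^sub>R ?v)" by simp
    \<comment> \<open>Parallelogram identity for the quadratic part of J. The midpoint cannot lie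
      below the infimum d, so the excesses of the two values over d bound half of the form at their
      difference.\<close>
    then have "J (s m) + J (s n) - 2 * J (s m + (1/2) *\<^sub>R ?v) = (1/2) * (?v \<bullet> Q ?v)"
      unfolding expand[OF s(1) v] by (simp add: power2_eq_square)
    then have "(1/2) * (?v \<bullet> Q ?v) \<le> inverse (real (Suc m)) + inverse (real (Suc n))"
      using d_le[OF mid] s(2)[of m] s(2)[of n] by linarith
    then show ?thesis using coercive[OF v] by (simp add: norm_minus_commute)
  qed
  have "Cauchy s"
  proof (rule CauchyI)
    fix e :: real assume e: "e > 0"
    obtain N where N: "inverse (real (Suc N)) < \<delta> * e\<^sup>2 / 4"
      using reals_Archimedean[of "\<delta> * e\<^sup>2 / 4"] \<delta> e by auto
    have "norm (s m - s n) < e" if "m \<ge> N" "n \<ge> N" for m n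
    proof -
      have inv: "inverse (real (Suc k)) \<le> inverse (real (Suc N))" if "k \<ge> N" for k
        using that by (intro le_imp_inverse_le) auto
      have combine: "A < B" if "A \<le> 2 * (a + b)" "c < B / 4" "a \<le> c" "b \<le> c" for A B a b c :: real
        using that by (simp add: field_simps)
      have "\<delta> * (norm (s m - s n))\<^sup>2 < \<delta> * e\<^sup>2"
        by (rule combine[OF dist N inv[OF \<open>m \<ge> N\<close>] inv[OF \<open>n \<ge> N\<close>]])
      then show ?thesis using \<delta> e by (simp add: power_less_imp_less_base)
    qed
    then show "\<exists>M. \<forall>m\<ge>M. \<forall>n\<ge>M. norm (s m - s n) < e" by blast
  qed
  then obtain w where w: "s \<longlonglongrightarrow> w" using Cauchy_convergent by (auto simp: convergent_def)
  have wW: "w \<in> W" by (rule closed_sequentially[OF W(2) s(1) w])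
  have "(\<lambda>n. J (s n)) \<longlonglongrightarrow> J w"
    unfolding J_def by (intro tendsto_intros w Q.tendsto)
  moreover have "(\<lambda>n. d + inverse (real (Suc n))) \<longlonglongrightarrow> d + 0"
    by (rule tendsto_add[OF tendsto_const LIMSEQ_inverse_real_of_nat])
  ultimately have "J w \<le> d + 0"
    by (rule LIMSEQ_le) (use s(2) in \<open>auto intro: less_imp_le\<close>)
  then have "0 \<le> 2 * t * (Q w \<bullet> \<phi> - f \<bullet> \<phi>) + t\<^sup>2 * (\<phi> \<bullet> Q \<phi>)" if "\<phi> \<in> W" for \<phi> t
    using d_le[OF subspace_add[OF W(1) wW subspace_scale[OF W(1) that, of t]]]
    unfolding expand[OF wW that] by linarith
  then have "Q w \<bullet> \<phi> - f \<bullet> \<phi> = 0" if "\<phi> \<in> W" for \<phi> using that by (intro le_square_imp_coeff_zero)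
  then show ?thesis using wW by (intro bexI[of _ w]) auto
qed

lemma subspace_closure:
  fixes V :: "'a::real_normed_vector set"
  assumes "subspace V" shows "subspace (closure V)"
  unfolding subspace_def
proof (intro conjI allI ballI)
  show "0 \<in> closure V" using subspace_0[OF assms] closure_subset by blast
  fix x assume x: "x \<in> closure V"
  obtain s where s: "\<And>n. s n \<in> V" "s \<longlonglongrightarrow> x" using x unfolding closure_sequential by blast
  show "c *\<^sub>R x \<in> closure V" for c
    unfolding closure_sequential using s subspace_scale[OF assms]
    by (intro exI[of _ "\<lambda>n. c *\<^sub>R s n"]) (auto intro: tendsto_intros)
  fix y assume "y \<in> closure V"
  then obtain r where r: "\<And>n. r n \<in> V" "r \<longlonglongrightarrow> y" unfolding closure_sequential by blast
  show "x + y \<in> closure V"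
    unfolding closure_sequential using s r subspace_add[OF assms]
    by (intro exI[of _ "\<lambda>n. s n + r n"]) (auto intro: tendsto_intros)
qed

text \<open>Recovers a complex pairing from two real ones, at x and at i x. An identity on a set
  invariant under multiplication by i therefore follows from its real part.\<close>

lemma cinner_eq_Complex_left: "cinner x y = Complex (x \<bullet> y) ((\<i> *\<^sub>C x) \<bullet> y)"
proof -
  have "cinner (\<i> *\<^sub>C x) y = cnj (cinner y (\<i> *\<^sub>C x))" by (rule cinner_commute)
  also have "\<dots> = - \<i> * cinner x y" unfolding cinner_scaleC_right by (subst cinner_commute) simp
  finally have "Re (cinner (\<i> *\<^sub>C x) y) = Im (cinner x y)" by simp
  then show ?thesis by (simp add: complex_eq_iff Re_cinner)
qed

section \<open>Pointwise operators on \<open>L\<^sup>2\<close>\<close>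

text \<open>T may depend on the point x so that multiplication by the indicator of \<Omega> and maps
  with constant coefficients are covered by one argument. Linearity has to be checked through
  representatives, which are only determined almost everywhere.\<close>

lemma
  fixes T :: "real^3 \<Rightarrow> 'b::{euclidean_space, complex_inner} \<Rightarrow> 'c::{euclidean_space, complex_inner}"
  assumes lin: "\<And>x. linear (T x)" and bound: "\<And>x v. norm (T x v) \<le> K * norm v"
    and meas: "\<And>f. f \<in> borel_measurable lborel \<Longrightarrow> (\<lambda>x. T x (f x)) \<in> borel_measurable lborel"
  shows sq_integrable_pointwise: "sq_integrable f \<Longrightarrow> sq_integrable (\<lambda>x. T x (f x))"
    and L2_class_pointwise: "sq_integrable f \<Longrightarrow>
      L2_class (\<lambda>x. T x (rep_L2 (L2_class f) x)) = L2_class (\<lambda>x. T x (f x))"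
    and bounded_linear_pointwise: "bounded_linear (\<lambda>F. L2_class (\<lambda>x. T x (rep_L2 F x)))"
proof -
  show sq: "sq_integrable (\<lambda>x. T x (f x))" if "sq_integrable f" for f
    by (rule sq_integrable_bound[OF that meas bound]) (use that in \<open>simp add: sq_integrable_def\<close>)
  show cls: "L2_class (\<lambda>x. T x (rep_L2 (L2_class f) x)) = L2_class (\<lambda>x. T x (f x))" if f: "sq_integrable f" for f
  proof (rule L2_class_cong[OF sq[OF sq_integrable_rep_L2] sq[OF f]])
    show "AE x in lborel. T x (rep_L2 (L2_class f) x) = T x (f x)"
      using AE_rep_L2_class[OF f] by eventually_elim simp
  qed
  note rep = sq_integrable_rep_L2
  let ?L = "\<lambda>F. L2_class (\<lambda>x. T x (rep_L2 F x))"
  show "bounded_linear ?L"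
  proof (rule bounded_linear_intro[where K = "\<bar>K\<bar>"])
    fix F G :: "'b L2" and r :: real
    have "?L (F + G) = ?L (L2_class (\<lambda>x. rep_L2 F x + rep_L2 G x))"
      by (simp add: L2_class_add[OF rep rep])
    also have "\<dots> = L2_class (\<lambda>x. T x (rep_L2 F x) + T x (rep_L2 G x))"
      unfolding cls[OF sq_integrable_add[OF rep rep]] linear_add[OF lin] ..
    also have "\<dots> = ?L F + ?L G" by (rule L2_class_add[OF sq[OF rep] sq[OF rep]])
    finally show "?L (F + G) = ?L F + ?L G" .
    have "?L (r *\<^sub>R F) = ?L (L2_class (\<lambda>x. r *\<^sub>R rep_L2 F x))"
      by (simp add: L2_class_scaleR[OF rep])
    also have "\<dots> = L2_class (\<lambda>x. r *\<^sub>R T x (rep_L2 F x))"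
      unfolding cls[OF sq_integrable_scaleR[OF rep]] linear_cmul[OF lin] ..
    also have "\<dots> = r *\<^sub>R ?L F" by (rule L2_class_scaleR[OF sq[OF rep]])
    finally show "?L (r *\<^sub>R F) = r *\<^sub>R ?L F" .
    have bd: "norm (T x v) \<le> \<bar>K\<bar> * norm v" for x v
      by (rule order_trans[OF bound mult_right_mono]) simp_all
    have "norm (?L F) \<le> \<bar>K\<bar> * norm F"
      unfolding norm_L2_class[OF sq[OF rep]] norm_L2_eq[of F]
    proof (rule l2_norm_bound)
      show "square_integrable lborel (rep_L2 F)" using rep by (simp add: sq_integrable_iff)
      show "(\<lambda>x. T x (rep_L2 F x)) \<in> borel_measurable lborel"
        using sq[OF rep] by (simp only: sq_integrable_def)
    qed (use bd in auto)
    then show "norm (?L F) \<le> norm F * \<bar>K\<bar>" by (simp add: mult.commute)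
  qed
qed

lemma
  fixes T :: "'b::{euclidean_space, complex_inner} \<Rightarrow> 'c::{euclidean_space, complex_inner}"
  assumes "linear T"
  shows sq_integrable_linear: "sq_integrable f \<Longrightarrow> sq_integrable (\<lambda>x. T (f x))"
    and L2_map_class: "sq_integrable f \<Longrightarrow> L2_map T (L2_class f) = L2_class (\<lambda>x. T (f x))"
    and bounded_linear_L2_map: "bounded_linear (L2_map T)"
proof -
  have bl: "bounded_linear T" using assms by (simp add: linear_conv_bounded_linear)
  obtain K where K: "\<And>v. norm (T v) \<le> norm v * K" using bounded_linear.bounded[OF bl] by blast
  have K': "norm (T v) \<le> K * norm v" for v using K by (simp add: mult.commute)
  show "sq_integrable f \<Longrightarrow> sq_integrable (\<lambda>x. T (f x))" for f
    by (rule sq_integrable_pointwise[where T = "\<lambda>_. T", OF assms K' measurable_bounded_linear[OF bl]])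
  show "sq_integrable f \<Longrightarrow> L2_map T (L2_class f) = L2_class (\<lambda>x. T (f x))" for f
    unfolding L2_map_def
    by (rule L2_class_pointwise[where T = "\<lambda>_. T", OF assms K' measurable_bounded_linear[OF bl]])
  show "bounded_linear (L2_map T)"
    unfolding L2_map_def[abs_def]
    by (rule bounded_linear_pointwise[where T = "\<lambda>_. T", OF assms K' measurable_bounded_linear[OF bl]])
qed

lemma inner_L2_map:
  fixes T :: "'b::{euclidean_space, complex_inner} \<Rightarrow> 'c::{euclidean_space, complex_inner}"
  assumes "linear T" "linear T'" "\<And>x y. T x \<bullet> y = x \<bullet> T' y"
  shows "L2_map T F \<bullet> G = F \<bullet> L2_map T' G"
proof -
  note rep = sq_integrable_rep_L2
  have "L2_map T F \<bullet> G = L2_class (\<lambda>x. T (rep_L2 F x)) \<bullet> L2_class (rep_L2 G)"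
    by (simp add: L2_map_def)
  also have "\<dots> = L2_class (rep_L2 F) \<bullet> L2_class (\<lambda>x. T' (rep_L2 G x))"
    unfolding inner_L2_class[OF sq_integrable_linear[OF assms(1) rep] rep]
      inner_L2_class[OF rep sq_integrable_linear[OF assms(2) rep]] assms(3) ..
  finally show ?thesis by (simp add: L2_map_def)
qed

lemma L2_map_L2_map:
  assumes "linear T" "linear T'"
  shows "L2_map T (L2_map T' F) = L2_map (\<lambda>x. T (T' x)) F"
  using L2_map_class[OF assms(1) sq_integrable_linear[OF assms(2) sq_integrable_rep_L2]]
  by (simp add: L2_map_def)

lemma L2_map_ident: "L2_map (\<lambda>x. x) F = F"
  by (simp add: L2_map_def)

lemma L2_map_scaleC:
  assumes "linear T" "\<And>x. T (a *\<^sub>C x) = a *\<^sub>C T x"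
  shows "L2_map T (a *\<^sub>C F) = a *\<^sub>C L2_map T F"
proof -
  note rep = sq_integrable_rep_L2
  have "L2_map T (a *\<^sub>C F) = L2_map T (L2_class (\<lambda>x. a *\<^sub>C rep_L2 F x))"
    by (simp add: L2_class_scaleC[OF rep])
  also have "\<dots> = L2_class (\<lambda>x. a *\<^sub>C T (rep_L2 F x))"
    unfolding L2_map_class[OF assms(1) sq_integrable_scaleC[OF rep]] assms(2) ..
  also have "\<dots> = a *\<^sub>C L2_map T F"
    unfolding L2_map_def by (rule L2_class_scaleC[OF sq_integrable_linear[OF assms(1) rep]])
  finally show ?thesis .
qed

lemma L2_map_coercive:
  assumes "linear T" and "\<And>x. e * (norm x)\<^sup>2 \<le> x \<bullet> T x"
  shows "e * (norm F)\<^sup>2 \<le> F \<bullet> L2_map T F"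
proof -
  note rep = sq_integrable_rep_L2
  have "e * (norm F)\<^sup>2 = (LINT x|lborel. e * (norm (rep_L2 F x))\<^sup>2)"
    by (simp add: norm_L2_eq l2_norm_power2)
  also have "\<dots> \<le> (LINT x|lborel. rep_L2 F x \<bullet> T (rep_L2 F x))"
    using rep[of F] integrable_inner_sq[OF rep sq_integrable_linear[OF assms(1) rep]] assms(2)
    by (intro integral_mono) (auto simp: sq_integrable_def)
  also have "\<dots> = L2_class (rep_L2 F) \<bullet> L2_class (\<lambda>x. T (rep_L2 F x))"
    by (rule inner_L2_class[OF rep sq_integrable_linear[OF assms(1) rep], symmetric])
  finally show ?thesis by (simp add: L2_map_def)
qed

text \<open>The projection whose fixed points are the fields on \<Omega>. Componentwise it provides
  the P of the abstract setting.\<close>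

definition L2_restrict :: "(real^3) set \<Rightarrow> 'b::{euclidean_space, complex_inner} L2 \<Rightarrow> 'b L2" where
  "L2_restrict \<Omega> F = L2_class (\<lambda>x. indicator \<Omega> x *\<^sub>R rep_L2 F x)"

lemma L2_class_in_L2_on:
  assumes "sq_integrable f" "\<And>x. x \<notin> \<Omega> \<Longrightarrow> f x = 0"
  shows "L2_class f \<in> L2_on \<Omega>"
  unfolding L2_on_def mem_Collect_eq
  using AE_rep_L2_class[OF assms(1)] by eventually_elim (use assms(2) in simp)

lemma emeasure_lborel_box_finite: "emeasure lborel (box a b) < \<infinity>"
  for a b :: "'a::euclidean_space"
  by (rule emeasure_bounded_finite) simp

lemma test_function_sq_integrable: "test_function U f \<Longrightarrow> sq_integrable f"
  unfolding sq_integrable_iff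
  by (rule test_function_square_integrable[OF sets_lborel emeasure_lborel_box_finite])

lemma test_function_L2_on: "test_function \<Omega> f \<Longrightarrow> L2_class f \<in> L2_on \<Omega>"
  by (rule L2_class_in_L2_on[OF test_function_sq_integrable test_function_outside])

context
  fixes \<Omega> :: "(real^3) set"
  assumes \<Omega>: "open \<Omega>"
begin

lemma
  shows sq_integrable_restrict:
      "sq_integrable (f :: real^3 \<Rightarrow> 'b::{euclidean_space, complex_inner}) \<Longrightarrow> sq_integrable (\<lambda>x. indicator \<Omega> x *\<^sub>R f x)"
    and bounded_linear_L2_restrict: "bounded_linear (L2_restrict \<Omega> :: 'b L2 \<Rightarrow> 'b L2)"
proof -
  have lin: "linear (\<lambda>v::'b. indicator \<Omega> x *\<^sub>R v)" for x
    by (rule bounded_linear.linear[OF bounded_linear_scaleR_right])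
  have bound: "norm (indicator \<Omega> x *\<^sub>R v) \<le> 1 * norm v" for x and v :: 'b
    by (auto simp: indicator_def)
  have meas: "(\<lambda>x. indicator \<Omega> x *\<^sub>R f x) \<in> borel_measurable lborel" if "f \<in> borel_measurable lborel" for f :: "real^3 \<Rightarrow> 'b"
    using that borel_open[OF \<Omega>] by (intro borel_measurable_scaleR borel_measurable_indicator) auto
  show "sq_integrable f \<Longrightarrow> sq_integrable (\<lambda>x. indicator \<Omega> x *\<^sub>R f x)" for f :: "real^3 \<Rightarrow> 'b"
    by (rule sq_integrable_pointwise[where T = "\<lambda>x v. indicator \<Omega> x *\<^sub>R v", OF lin bound meas])
  show "bounded_linear (L2_restrict \<Omega> :: 'b L2 \<Rightarrow> 'b L2)"
    unfolding L2_restrict_def[abs_def]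
    by (rule bounded_linear_pointwise[where T = "\<lambda>x v. indicator \<Omega> x *\<^sub>R v", OF lin bound meas])
qed

lemma L2_restrict_in: "L2_restrict \<Omega> F \<in> L2_on \<Omega>"
  unfolding L2_restrict_def
  by (rule L2_class_in_L2_on[OF sq_integrable_restrict[OF sq_integrable_rep_L2]]) simp

lemma L2_restrict_id:
  assumes "F \<in> L2_on \<Omega>" shows "L2_restrict \<Omega> F = F"
proof -
  have "L2_restrict \<Omega> F = L2_class (rep_L2 F)"
    unfolding L2_restrict_def
  proof (rule L2_class_cong[OF sq_integrable_restrict[OF sq_integrable_rep_L2] sq_integrable_rep_L2])
    show "AE x in lborel. indicator \<Omega> x *\<^sub>R rep_L2 F x = rep_L2 F x"
      using assms unfolding L2_on_def mem_Collect_eq by eventually_elim (auto simp: indicator_def)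
  qed
  then show ?thesis by simp
qed

lemma L2_on_eq: "L2_on \<Omega> = {F. L2_restrict \<Omega> F = F}"
  using L2_restrict_in L2_restrict_id by (metis (mono_tags) mem_Collect_eq set_eqI)

lemma closed_L2_on: "closed (L2_on \<Omega> :: 'b::{euclidean_space, complex_inner} L2 set)"
  unfolding L2_on_eq
  by (rule closed_Collect_eq[OF linear_continuous_on[OF bounded_linear_L2_restrict] continuous_on_id])

lemma subspace_L2_on: "subspace (L2_on \<Omega> :: 'b::{euclidean_space, complex_inner} L2 set)"
proof -
  interpret R: bounded_linear "L2_restrict \<Omega> :: 'b L2 \<Rightarrow> 'b L2" by (rule bounded_linear_L2_restrict)
  show ?thesis unfolding L2_on_eq by (auto simp: subspace_def R.add R.scaleR R.zero)
qed

lemma L2_map_in_L2_on: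
  assumes "linear T" "F \<in> L2_on \<Omega>" shows "L2_map T F \<in> L2_on \<Omega>"
proof -
  have "AE x in lborel. rep_L2 (L2_map T F) x = T (rep_L2 F x)"
    unfolding L2_map_def by (rule AE_rep_L2_class[OF sq_integrable_linear[OF assms(1) sq_integrable_rep_L2]])
  moreover have "AE x in lborel. x \<notin> \<Omega> \<longrightarrow> rep_L2 F x = 0" using assms(2) by (simp add: L2_on_def)
  ultimately show ?thesis
    unfolding L2_on_def mem_Collect_eq
    by eventually_elim (simp add: linear_0[OF assms(1)])
qed

lemma test_functions_dense:
  fixes F :: "'b::{euclidean_space, complex_inner} L2"
  assumes F: "F \<in> L2_on \<Omega>" and e: "e > 0"
  shows "\<exists>\<eta>. test_function \<Omega> \<eta> \<and> norm (F - L2_class \<eta>) < e"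
proof -
  \<comment> \<open>A representative of F vanishes outside \<Omega> only almost everywhere; cutting
    it off makes this hold at every point, as \<open>l2_approx_boxes\<close> requires.\<close>
  let ?f = "\<lambda>x. indicator \<Omega> x *\<^sub>R rep_L2 F x"
  let ?G = "{\<eta> :: real^3 \<Rightarrow> 'b. test_function \<Omega> \<eta>}"
  have sf: "sq_integrable ?f" by (rule sq_integrable_restrict[OF sq_integrable_rep_L2])
  have "l2_approx lborel ?G ?f"
  proof (rule l2_approx_boxes[where \<Omega> = \<Omega> and P = "\<lambda>x. x" and D = UNIV])
    show "square_integrable lborel g" if "g \<in> ?G" for g
      using that test_function_sq_integrable unfolding sq_integrable_iff by blast
    show "(\<lambda>x. g x + h x) \<in> ?G" if "g \<in> ?G" "h \<in> ?G" for g h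
      using that test_function_add by blast
    show "\<exists>g\<in>?G. l2_norm lborel (\<lambda>x. indicator (box a b) x *\<^sub>R y - g x) < e"
      if ab: "box a b \<subseteq> \<Omega>" and e: "e > 0" for a b and y :: 'b and e :: real
    proof -
      obtain n where n: "n > 0" "l2_norm lborel (\<lambda>x. bump a b n x *\<^sub>R y - indicator (box a b) x *\<^sub>R y) < e"
        by (rule bump_l2_approx[OF sets_lborel emeasure_lborel_box_finite e])
      show ?thesis
      proof (rule bexI[of _ "\<lambda>x. bump a b n x *\<^sub>R y"])
        show "l2_norm lborel (\<lambda>x. indicator (box a b) x *\<^sub>R y - bump a b n x *\<^sub>R y) < e"
          using n(2) by (subst l2_norm_minus_commute)
        show "(\<lambda>x. bump a b n x *\<^sub>R y) \<in> ?G"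
          using test_function_scaleR[OF test_function_bump[OF ab n(1)]] by simp
      qed
    qed
    show "\<exists>z\<in>UNIV. norm (y - z) < e" if "e > 0" for y :: 'b and e :: real
      using that by (intro bexI[of _ y]) auto
  qed (use \<Omega> sf emeasure_lborel_box_finite in \<open>auto simp: sq_integrable_iff\<close>)
  then obtain \<eta> where \<eta>: "test_function \<Omega> \<eta>" "l2_norm lborel (\<lambda>x. ?f x - \<eta> x) < e"
    using e unfolding l2_approx_def by blast
  have "F = L2_class ?f" using L2_restrict_id[OF F] by (simp add: L2_restrict_def)
  then have "norm (F - L2_class \<eta>) < e"
    using norm_L2_class_diff[OF sf test_function_sq_integrable[OF \<eta>(1)]] \<eta>(2) by simp
  then show ?thesis using \<eta>(1) by blast
qed

text \<open>By density some test function is close to F, and F is orthogonal to it; so |F|^2 is at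
  most |F| times an arbitrarily small distance.\<close>

lemma weakly_zero_L2:
  fixes F :: "'b::{euclidean_space, complex_inner} L2"
  assumes F: "F \<in> L2_on \<Omega>" and zero: "\<And>\<eta>. test_function \<Omega> \<eta> \<Longrightarrow> F \<bullet> L2_class \<eta> = 0"
  shows "F = 0"
proof -
  have "norm F \<le> 0 + e" if e: "e > 0" for e
  proof -
    obtain \<eta> where \<eta>: "test_function \<Omega> \<eta>" "norm (F - L2_class \<eta>) < e"
      using test_functions_dense[OF F e] by blast
    have "norm F * norm F = F \<bullet> (F - L2_class \<eta>)"
      using zero[OF \<eta>(1)] by (simp add: inner_diff_right norm_eq_sqrt_inner)
    also have "\<dots> \<le> norm F * norm (F - L2_class \<eta>)" by (rule norm_cauchy_schwarz)
    also have "\<dots> \<le> norm F * e" using \<eta>(2) by (intro mult_left_mono) auto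
    finally show ?thesis by (cases "F = 0") (use e in auto)
  qed
  then have "norm F \<le> 0" by (rule field_le_epsilon)
  then show ?thesis by simp
qed

end

section \<open>The spatial operator\<close>

lemma bounded_linear_scaleC: "bounded_linear (\<lambda>x::'a::complex_inner. a *\<^sub>C x)"
  by (rule bounded_linear.intro[OF linear_scaleC])
    (auto simp: bounded_linear_axioms_def norm_scaleC mult.commute intro!: exI[of _ "cmod a"])

definition column_of :: "3 \<Rightarrow> complex^3^3 \<Rightarrow> complex^3" where
  "column_of k M = (\<chi> i. M $ i $ k)"

text \<open>The adjoint of \<open>column_of\<close>. With this pair the Jacobian and the row
  divergence become sums over k of a constant linear map applied to the k-th partial derivative,
  which reduces their adjointness to integration by parts in one direction.\<close>

definition of_column :: "3 \<Rightarrow> complex^3 \<Rightarrow> complex^3^3" where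
  "of_column k v = (\<chi> i j. if j = k then v $ i else 0)"

lemma bounded_linear_column_of: "bounded_linear (column_of k)"
  unfolding linear_conv_bounded_linear[symmetric]
  by (rule linearI) (simp_all add: column_of_def vec_eq_iff)

lemma bounded_linear_of_column: "bounded_linear (of_column k)"
  unfolding linear_conv_bounded_linear[symmetric]
  by (rule linearI) (simp_all add: of_column_def vec_eq_iff)

lemma inner_of_column: "of_column k v \<bullet> M = v \<bullet> column_of k M"
proof -
  have "(\<Sum>j\<in>UNIV. (if j = k then v $ i else 0) \<bullet> M $ i $ j) = v $ i \<bullet> M $ i $ k" for i
  proof -
    have "(\<Sum>j\<in>UNIV. (if j = k then v $ i else 0) \<bullet> M $ i $ j) = (\<Sum>j\<in>UNIV. if j = k then v $ i \<bullet> M $ i $ j else 0)"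
      by (intro sum.cong refl) auto
    then show ?thesis by simp
  qed
  then show ?thesis by (simp add: inner_vec_def of_column_def column_of_def)
qed

lemma jacobi_matrix_eq: "jacobi_matrix \<phi> = (\<lambda>x. \<Sum>k\<in>UNIV. of_column k (pderiv_at k \<phi> x))"
  by (auto simp: jacobi_matrix_def of_column_def vec_eq_iff fun_eq_iff)

lemma row_divergence_eq: "row_divergence \<eta> = (\<lambda>x. \<Sum>k\<in>UNIV. column_of k (pderiv_at k \<eta> x))"
  by (auto simp: row_divergence_def column_of_def vec_eq_iff fun_eq_iff)

lemma linear_trace: "linear (trace :: complex^3^3 \<Rightarrow> complex)"
  by (rule linearI) (simp_all add: trace_def sum.distrib scaleR_sum_right)

lemma linear_mat: "linear (mat :: complex \<Rightarrow> complex^3^3)"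
  by (rule linearI) (auto simp: mat_def vec_eq_iff)

lemma inner_trace: "trace M \<bullet> z = M \<bullet> mat z" for M :: "complex^3^3"
proof -
  have "(\<Sum>j\<in>UNIV. M $ i $ j \<bullet> (if i = j then z else 0)) = M $ i $ i \<bullet> z" for i
  proof -
    have "(\<Sum>j\<in>UNIV. M $ i $ j \<bullet> (if i = j then z else 0)) = (\<Sum>j\<in>UNIV. if i = j then M $ i $ j \<bullet> z else 0)"
      by (intro sum.cong refl) auto
    then show ?thesis by simp
  qed
  then show ?thesis by (simp add: inner_vec_def mat_def trace_def inner_sum_left)
qed

lemma trace_scaleC: "trace (a *\<^sub>C M) = a *\<^sub>C trace M" for M :: "complex^3^3"
  by (simp add: trace_def scaleC_vec_def scaleC_complex_def sum_distrib_left)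

lemma test_function_pderiv: "test_function U f \<Longrightarrow> test_function U (pderiv_at k f)"
  unfolding pderiv_at_def by (rule test_function_dir_deriv) simp_all

lemma pderiv_bounded_linear:
  "bounded_linear L \<Longrightarrow> smooth_on UNIV f \<Longrightarrow> pderiv_at k (\<lambda>x. L (f x)) = (\<lambda>x. L (pderiv_at k f x))"
  unfolding pderiv_at_def by (rule dir_deriv_bounded_linear)

lemma test_function_jacobi: "test_function U \<phi> \<Longrightarrow> test_function U (jacobi_matrix \<phi>)"
  unfolding jacobi_matrix_eq
  by (rule test_function_sum, rule test_function_bounded_linear[OF bounded_linear_of_column test_function_pderiv])

lemma test_function_row_divergence: "test_function U \<eta> \<Longrightarrow> test_function U (row_divergence \<eta>)"
  unfolding row_divergence_eq
  by (rule test_function_sum, rule test_function_bounded_linear[OF bounded_linear_column_of test_function_pderiv])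

lemma jacobi_matrix_add:
  assumes "smooth_on UNIV \<phi>" "smooth_on UNIV \<psi>"
  shows "jacobi_matrix (\<lambda>x. \<phi> x + \<psi> x) = (\<lambda>x. jacobi_matrix \<phi> x + jacobi_matrix \<psi> x)"
  by (auto simp: jacobi_matrix_def pderiv_at_def dir_deriv_add[OF assms] vec_eq_iff fun_eq_iff)

lemma scaleC_nth: "(a *\<^sub>C v) $ i = a *\<^sub>C (v $ i)"
  by (simp add: scaleC_vec_def)

lemma jacobi_matrix_scaleC:
  assumes "smooth_on UNIV \<phi>"
  shows "jacobi_matrix (\<lambda>x. a *\<^sub>C \<phi> x) = (\<lambda>x. a *\<^sub>C jacobi_matrix \<phi> x)"
  by (simp add: jacobi_matrix_def pderiv_bounded_linear[OF bounded_linear_scaleC assms] scaleC_nth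
      vec_eq_iff fun_eq_iff)

lemma smooth_integral_by_parts:
  fixes f g :: "'a::euclidean_space \<Rightarrow> 'b::real_inner"
  assumes f: "test_function U f" and g: "smooth_on UNIV g" and v: "v \<in> Basis"
  shows "(LINT x|lborel. dir_deriv v f x \<bullet> g x) = - (LINT x|lborel. f x \<bullet> dir_deriv v g x)"
proof -
  obtain K where K: "smooth_on UNIV f" "compact K" "K \<subseteq> U" "\<And>x. x \<notin> K \<Longrightarrow> f x = 0"
    by (rule test_functionE[OF f]) blast
  show ?thesis
    unfolding dir_deriv_def
    by (rule integral_by_parts_inner[where v = v and f' = "\<lambda>x. frechet_derivative f (at x)"
          and g' = "\<lambda>x. frechet_derivative g (at x)", OF smooth_on_UNIV_has_derivative[OF K(1)] _
          smooth_on_UNIV_has_derivative[OF g] _ K(2,4)])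
      (use smooth_on_UNIV_continuous[OF smooth_on_UNIV_dir_deriv[OF K(1) v], of UNIV]
        smooth_on_UNIV_continuous[OF smooth_on_UNIV_dir_deriv[OF g v], of UNIV] in \<open>simp_all add: dir_deriv_def[abs_def]\<close>)
qed

lemma jacobi_row_divergence:
  assumes \<phi>: "test_function U \<phi>" and \<eta>: "test_function U \<eta>"
  shows "L2_class (jacobi_matrix \<phi>) \<bullet> L2_class \<eta> = - (L2_class \<phi> \<bullet> L2_class (row_divergence \<eta>))"
proof -
  note sq = test_function_sq_integrable
  let ?c = "\<lambda>k x. column_of k (\<eta> x)"
  have tc: "test_function U (?c k)" for k by (rule test_function_bounded_linear[OF bounded_linear_column_of \<eta>])
  have parts: "(LINT x|lborel. pderiv_at k \<phi> x \<bullet> ?c k x) = - (LINT x|lborel. \<phi> x \<bullet> column_of k (pderiv_at k \<eta> x))" for k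
    using smooth_integral_by_parts[OF \<phi> test_function_smooth[OF tc[of k]], of "axis k 1"]
    unfolding pderiv_at_def[symmetric] pderiv_bounded_linear[OF bounded_linear_column_of test_function_smooth[OF \<eta>]]
    by simp
  have int1: "integrable lborel (\<lambda>x. pderiv_at k \<phi> x \<bullet> ?c k x)" for k
    by (rule integrable_inner_sq[OF sq[OF test_function_pderiv[OF \<phi>]] sq[OF tc]])
  have int2: "integrable lborel (\<lambda>x. \<phi> x \<bullet> column_of k (pderiv_at k \<eta> x))" for k
    by (rule integrable_inner_sq[OF sq[OF \<phi>] sq[OF test_function_bounded_linear[OF bounded_linear_column_of test_function_pderiv[OF \<eta>]]]])
  have "L2_class (jacobi_matrix \<phi>) \<bullet> L2_class \<eta> = (LINT x|lborel. (\<Sum>k\<in>UNIV. pderiv_at k \<phi> x \<bullet> ?c k x))"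
    unfolding inner_L2_class[OF sq[OF test_function_jacobi[OF \<phi>]] sq[OF \<eta>]]
    unfolding jacobi_matrix_eq
    by (simp add: inner_sum_left inner_of_column)
  also have "\<dots> = (\<Sum>k\<in>UNIV. LINT x|lborel. pderiv_at k \<phi> x \<bullet> ?c k x)"
    by (rule Bochner_Integration.integral_sum[OF int1])
  also have "\<dots> = - (\<Sum>k\<in>UNIV. LINT x|lborel. \<phi> x \<bullet> column_of k (pderiv_at k \<eta> x))"
    unfolding parts sum_negf ..
  also have "(\<Sum>k\<in>UNIV. LINT x|lborel. \<phi> x \<bullet> column_of k (pderiv_at k \<eta> x)) =
      (LINT x|lborel. (\<Sum>k\<in>UNIV. \<phi> x \<bullet> column_of k (pderiv_at k \<eta> x)))"
    by (rule Bochner_Integration.integral_sum[OF int2, symmetric])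
  also have "\<dots> = L2_class \<phi> \<bullet> L2_class (row_divergence \<eta>)"
    unfolding inner_L2_class[OF sq[OF \<phi>] sq[OF test_function_row_divergence[OF \<eta>]]]
    unfolding row_divergence_eq
    by (simp add: inner_sum_right)
  finally show ?thesis .
qed

section \<open>The closed gradient and the structure of the operator \<open>A\<close>\<close>

context
  fixes \<Omega> :: "(real^3) set"
  assumes \<Omega>: "open \<Omega>"
begin

lemma grad0_graph_test:
  "test_function \<Omega> \<phi> \<Longrightarrow> (L2_class \<phi>, L2_class (jacobi_matrix \<phi>)) \<in> grad0_graph \<Omega>"
  unfolding grad0_graph_def by (rule subsetD[OF closure_subset]) blast

text \<open>A condition that is closed in both components needs to be checked only for test
  functions. Passages from test functions to the domain of \<open>grad0\<close> go through this
  rule.\<close>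

lemma grad0_graph_induct:
  assumes "(\<psi>, \<Psi>) \<in> grad0_graph \<Omega>" "closed X"
    and "\<And>\<phi>. test_function \<Omega> \<phi> \<Longrightarrow> (L2_class \<phi>, L2_class (jacobi_matrix \<phi>)) \<in> X"
  shows "(\<psi>, \<Psi>) \<in> X"
proof -
  have "grad0_graph \<Omega> \<subseteq> X"
    unfolding grad0_graph_def by (rule closure_minimal[OF _ assms(2)]) (use assms(3) in blast)
  then show ?thesis using assms(1) by blast
qed

lemma closed_grad0_graph: "closed (grad0_graph \<Omega>)"
  by (simp add: grad0_graph_def)

text \<open>Applied with the scalar i, this is what reduces the complex identity defining
  \<open>A_graph\<close> to a real one.\<close>

lemma grad0_graph_scaleC:
  assumes "(\<psi>, \<Psi>) \<in> grad0_graph \<Omega>"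
  shows "(a *\<^sub>C \<psi>, a *\<^sub>C \<Psi>) \<in> grad0_graph \<Omega>"
proof -
  let ?s = "\<lambda>z :: (complex^3) L2 \<times> (complex^3^3) L2. a *\<^sub>C z"
  have "closed (?s -` grad0_graph \<Omega>)"
    by (rule continuous_closed_vimage[OF closed_grad0_graph])
      (use linear_continuous_at[OF bounded_linear_scaleC] in blast)
  with assms have "(\<psi>, \<Psi>) \<in> ?s -` grad0_graph \<Omega>"
  proof (rule grad0_graph_induct)
    fix \<phi> :: "real^3 \<Rightarrow> complex^3" assume \<phi>: "test_function \<Omega> \<phi>"
    have "test_function \<Omega> (\<lambda>x. a *\<^sub>C \<phi> x)" by (rule test_function_bounded_linear[OF bounded_linear_scaleC \<phi>])
    from grad0_graph_test[OF this]
    show "(L2_class \<phi>, L2_class (jacobi_matrix \<phi>)) \<in> ?s -` grad0_graph \<Omega>"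
      unfolding jacobi_matrix_scaleC[OF test_function_smooth[OF \<phi>]]
        L2_class_scaleC[OF test_function_sq_integrable[OF \<phi>]]
        L2_class_scaleC[OF test_function_sq_integrable[OF test_function_jacobi[OF \<phi>]]]
      by (simp add: scaleC_prod_def)
  qed
  then show ?thesis by (simp add: scaleC_prod_def)
qed

lemma subspace_grad0_graph: "subspace (grad0_graph \<Omega>)"
  unfolding grad0_graph_def
proof (rule subspace_closure)
  let ?C = "{(L2_class \<phi>, L2_class (jacobi_matrix \<phi>)) | \<phi>. test_function \<Omega> \<phi>}"
  note sq = test_function_sq_integrable
  have add: "x + y \<in> ?C" if "x \<in> ?C" "y \<in> ?C" for x y
  proof -
    obtain \<phi> \<psi> where \<phi>: "x = (L2_class \<phi>, L2_class (jacobi_matrix \<phi>))" "test_function \<Omega> \<phi>"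
      and \<psi>: "y = (L2_class \<psi>, L2_class (jacobi_matrix \<psi>))" "test_function \<Omega> \<psi>"
      using \<open>x \<in> ?C\<close> \<open>y \<in> ?C\<close> by blast
    have "x + y = (L2_class (\<lambda>x. \<phi> x + \<psi> x), L2_class (jacobi_matrix (\<lambda>x. \<phi> x + \<psi> x)))"
      unfolding \<phi>(1) \<psi>(1) jacobi_matrix_add[OF test_function_smooth[OF \<phi>(2)] test_function_smooth[OF \<psi>(2)]]
        L2_class_add[OF sq[OF \<phi>(2)] sq[OF \<psi>(2)]]
        L2_class_add[OF sq[OF test_function_jacobi[OF \<phi>(2)]] sq[OF test_function_jacobi[OF \<psi>(2)]]]
      by simp
    then show ?thesis using test_function_add[OF \<phi>(2) \<psi>(2)] by blast
  qed
  have scale: "c *\<^sub>R x \<in> ?C" if "x \<in> ?C" for x c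
  proof -
    obtain \<phi> where \<phi>: "x = (L2_class \<phi>, L2_class (jacobi_matrix \<phi>))" "test_function \<Omega> \<phi>"
      using \<open>x \<in> ?C\<close> by blast
    let ?\<phi> = "\<lambda>x. complex_of_real c *\<^sub>C \<phi> x"
    have "c *\<^sub>R x = (L2_class ?\<phi>, L2_class (jacobi_matrix ?\<phi>))"
      unfolding \<phi>(1) jacobi_matrix_scaleC[OF test_function_smooth[OF \<phi>(2)]]
        L2_class_scaleC[OF sq[OF \<phi>(2)]] L2_class_scaleC[OF sq[OF test_function_jacobi[OF \<phi>(2)]]]
      by (simp add: scaleC_of_real)
    moreover have "test_function \<Omega> ?\<phi>" by (rule test_function_bounded_linear[OF bounded_linear_scaleC \<phi>(2)])
    ultimately show ?thesis by blast
  qed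
  have "(L2_class (\<lambda>_. 0), L2_class (jacobi_matrix (\<lambda>_. 0))) \<in> ?C" using test_function_zero by blast
  from scale[OF this, of 0] have "0 \<in> ?C" by (simp only: scaleR_zero_left)
  then show "subspace ?C" unfolding subspace_def using add scale by blast
qed

lemma grad0_graph_L2_on:
  assumes "(\<psi>, \<Psi>) \<in> grad0_graph \<Omega>" shows "\<psi> \<in> L2_on \<Omega>" "\<Psi> \<in> L2_on \<Omega>"
proof -
  have "(\<psi>, \<Psi>) \<in> L2_on \<Omega> \<times> L2_on \<Omega>"
    using assms closed_Times[OF closed_L2_on[OF \<Omega>] closed_L2_on[OF \<Omega>]]
  proof (rule grad0_graph_induct)
    fix \<phi> :: "real^3 \<Rightarrow> complex^3" assume "test_function \<Omega> \<phi>"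
    then show "(L2_class \<phi>, L2_class (jacobi_matrix \<phi>)) \<in> L2_on \<Omega> \<times> L2_on \<Omega>"
      by (intro SigmaI test_function_L2_on test_function_jacobi)
  qed
  then show "\<psi> \<in> L2_on \<Omega>" "\<Psi> \<in> L2_on \<Omega>" by auto
qed

lemma grad0_graph_weak:
  assumes "(\<psi>, \<Psi>) \<in> grad0_graph \<Omega>" and \<eta>: "test_function \<Omega> \<eta>"
  shows "\<Psi> \<bullet> L2_class \<eta> = - (\<psi> \<bullet> L2_class (row_divergence \<eta>))"
proof -
  let ?X = "{z. snd z \<bullet> L2_class \<eta> = - (fst z \<bullet> L2_class (row_divergence \<eta>))}"
  have "closed ?X" by (intro closed_Collect_eq continuous_intros)
  with assms(1) have "(\<psi>, \<Psi>) \<in> ?X"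
    by (rule grad0_graph_induct) (simp add: jacobi_row_divergence[OF _ \<eta>])
  then show ?thesis by simp
qed

text \<open>Closability of the Jacobian, which justifies the definite description in
  \<open>grad0\<close>: if 0 is mapped to a field, the weak identity makes that field orthogonal to
  every matrix-valued test function.\<close>

lemma grad0_graph_unique:
  assumes "(\<psi>, \<Psi>) \<in> grad0_graph \<Omega>" "(\<psi>, \<Psi>') \<in> grad0_graph \<Omega>"
  shows "\<Psi> = \<Psi>'"
proof -
  have d: "(0, \<Psi> - \<Psi>') \<in> grad0_graph \<Omega>"
    using subspace_diff[OF subspace_grad0_graph assms] by simp
  have "\<Psi> - \<Psi>' = 0"
    by (rule weakly_zero_L2[OF \<Omega> grad0_graph_L2_on(2)[OF d]]) (simp add: grad0_graph_weak[OF d])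
  then show ?thesis by simp
qed

lemma grad0_eq: "(\<psi>, \<Psi>) \<in> grad0_graph \<Omega> \<Longrightarrow> grad0 \<Omega> \<psi> = \<Psi>"
  unfolding grad0_def by (rule the_equality) (auto intro: grad0_graph_unique)

text \<open>A purely real description. The conjugate-linear identity of functionals follows from its
  real part, inserted at \<phi> and at i \<phi>; the pair (\<phi>, \<Phi>) in the graph replaces the
  values of \<open>grad0\<close>, so no definite description remains.\<close>

lemma A_graph_iff:
  "((\<psi>1, \<psi>2, \<psi>3), (g, d, m)) \<in> A_graph \<Omega> \<longleftrightarrow>
    \<psi>2 \<in> L2_on \<Omega> \<and> \<psi>3 \<in> L2_on \<Omega> \<and> g \<in> L2_on \<Omega> \<and>
    (\<exists>\<Phi>. (\<psi>1, \<Phi>) \<in> grad0_graph \<Omega> \<and> d = L2_map trace \<Phi> \<and> m = - \<Phi>) \<and>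
    (\<forall>\<phi> \<Phi>. (\<phi>, \<Phi>) \<in> grad0_graph \<Omega> \<longrightarrow> \<phi> \<bullet> g = \<Phi> \<bullet> \<psi>3 - L2_map trace \<Phi> \<bullet> \<psi>2)"
proof -
  have weak: "(\<forall>\<phi>\<in>dom_grad0 \<Omega>. cinner \<phi> g = dist_grad \<Omega> \<psi>2 \<phi> - dist_div \<Omega> \<psi>3 \<phi>) \<longleftrightarrow>
      (\<forall>\<phi> \<Phi>. (\<phi>, \<Phi>) \<in> grad0_graph \<Omega> \<longrightarrow> \<phi> \<bullet> g = \<Phi> \<bullet> \<psi>3 - L2_map trace \<Phi> \<bullet> \<psi>2)" (is "?l \<longleftrightarrow> ?r")
  proof
    assume l: ?l
    show ?r
    proof (intro allI impI)
      fix \<phi> \<Phi> assume \<phi>: "(\<phi>, \<Phi>) \<in> grad0_graph \<Omega>"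
      then have "\<phi> \<in> dom_grad0 \<Omega>" by (auto simp: dom_grad0_def)
      with l have "cinner \<phi> g = cinner \<Phi> \<psi>3 - cinner (L2_map trace \<Phi>) \<psi>2"
        by (simp add: dist_grad_def dist_div_def div0_def grad0_eq[OF \<phi>])
      from arg_cong[OF this, of Re] show "\<phi> \<bullet> g = \<Phi> \<bullet> \<psi>3 - L2_map trace \<Phi> \<bullet> \<psi>2"
        by (simp add: Re_cinner)
    qed
  next
    assume r: ?r
    show ?l
    proof
      fix \<phi> assume "\<phi> \<in> dom_grad0 \<Omega>"
      then obtain \<Phi> where \<phi>: "(\<phi>, \<Phi>) \<in> grad0_graph \<Omega>" by (auto simp: dom_grad0_def)
      have "cinner \<phi> g = cinner \<Phi> \<psi>3 - cinner (L2_map trace \<Phi>) \<psi>2"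
        using r[rule_format, OF \<phi>] r[rule_format, OF grad0_graph_scaleC[OF \<phi>, of \<i>]]
        unfolding cinner_eq_Complex_left L2_map_scaleC[OF linear_trace trace_scaleC]
        by (simp add: complex_eq_iff)
      then show "cinner \<phi> g = dist_grad \<Omega> \<psi>2 \<phi> - dist_div \<Omega> \<psi>3 \<phi>"
        by (simp add: dist_grad_def dist_div_def div0_def grad0_eq[OF \<phi>])
    qed
  qed
  have dom: "\<psi>1 \<in> dom_grad0 \<Omega> \<and> d = div0 \<Omega> \<psi>1 \<and> m = - grad0 \<Omega> \<psi>1 \<longleftrightarrow>
      (\<exists>\<Phi>. (\<psi>1, \<Phi>) \<in> grad0_graph \<Omega> \<and> d = L2_map trace \<Phi> \<and> m = - \<Phi>)"
    using grad0_eq by (auto simp: dom_grad0_def div0_def)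
  have "((\<psi>1, \<psi>2, \<psi>3), (g, d, m)) \<in> A_graph \<Omega> \<longleftrightarrow>
      (\<psi>1 \<in> L2_on \<Omega> \<and> \<psi>2 \<in> L2_on \<Omega> \<and> \<psi>3 \<in> L2_on \<Omega>) \<and> g \<in> L2_on \<Omega> \<and>
      (\<psi>1 \<in> dom_grad0 \<Omega> \<and> d = div0 \<Omega> \<psi>1 \<and> m = - grad0 \<Omega> \<psi>1) \<and>
      (\<forall>\<phi>\<in>dom_grad0 \<Omega>. cinner \<phi> g = dist_grad \<Omega> \<psi>2 \<phi> - dist_div \<Omega> \<psi>3 \<phi>)"
    unfolding A_graph_def state_space_def by auto
  then show ?thesis unfolding weak dom using grad0_graph_L2_on(1) by blast
qed

lemma A_graph_subset: "A_graph \<Omega> \<subseteq> state_space \<Omega> \<times> state_space \<Omega>"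
proof
  fix z assume z: "z \<in> A_graph \<Omega>"
  obtain \<psi>1 \<psi>2 \<psi>3 g d m where eq: "z = ((\<psi>1, \<psi>2, \<psi>3), (g, d, m))" by (metis prod.exhaust)
  obtain \<Phi> where \<Phi>: "(\<psi>1, \<Phi>) \<in> grad0_graph \<Omega>" "d = L2_map trace \<Phi>" "m = - \<Phi>"
    and *: "\<psi>2 \<in> L2_on \<Omega>" "\<psi>3 \<in> L2_on \<Omega>" "g \<in> L2_on \<Omega>"
    using z unfolding eq A_graph_iff by blast
  note L = grad0_graph_L2_on[OF \<Phi>(1)]
  show "z \<in> state_space \<Omega> \<times> state_space \<Omega>"
    using L * L2_map_in_L2_on[OF \<Omega> linear_trace L(2)] subspace_neg[OF subspace_L2_on[OF \<Omega>] L(2)]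
    by (simp add: eq state_space_def \<Phi>(2,3))
qed

text \<open>Each weak identity is tested with the first component of the other element. The two
  right-hand sides are then the pairings of the remaining components.\<close>

lemma A_graph_skew:
  assumes "(x, a) \<in> A_graph \<Omega>" "(y, b) \<in> A_graph \<Omega>" shows "a \<bullet> y = - (x \<bullet> b)"
proof -
  obtain x1 x2 x3 a1 a2 a3 y1 y2 y3 b1 b2 b3 where
    eq: "x = (x1, x2, x3)" "a = (a1, a2, a3)" "y = (y1, y2, y3)" "b = (b1, b2, b3)" by (metis prod.exhaust)
  obtain \<Phi> where \<Phi>: "(x1, \<Phi>) \<in> grad0_graph \<Omega>" "a2 = L2_map trace \<Phi>" "a3 = - \<Phi>"
    and x: "\<And>\<phi> \<Phi>. (\<phi>, \<Phi>) \<in> grad0_graph \<Omega> \<Longrightarrow> \<phi> \<bullet> a1 = \<Phi> \<bullet> x3 - L2_map trace \<Phi> \<bullet> x2"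
    using assms(1) unfolding eq A_graph_iff by blast
  obtain \<Psi> where \<Psi>: "(y1, \<Psi>) \<in> grad0_graph \<Omega>" "b2 = L2_map trace \<Psi>" "b3 = - \<Psi>"
    and y: "\<And>\<phi> \<Phi>. (\<phi>, \<Phi>) \<in> grad0_graph \<Omega> \<Longrightarrow> \<phi> \<bullet> b1 = \<Phi> \<bullet> y3 - L2_map trace \<Phi> \<bullet> y2"
    using assms(2) unfolding eq A_graph_iff by blast
  show ?thesis using x[OF \<Psi>(1)] y[OF \<Phi>(1)]
    by (simp add: eq \<Phi>(2,3) \<Psi>(2,3) inner_commute)
qed

lemma subspace_A_graph: "subspace (A_graph \<Omega>)"
proof -
  interpret tr: bounded_linear "L2_map trace :: (complex^3^3) L2 \<Rightarrow> complex L2"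
    by (rule bounded_linear_L2_map[OF linear_trace])
  note subs = subspace_L2_on[OF \<Omega>]
  have lin: "z + c *\<^sub>R z' \<in> A_graph \<Omega>" if z: "z \<in> A_graph \<Omega>" and z': "z' \<in> A_graph \<Omega>" for z z' c
  proof -
    obtain x1 x2 x3 a1 a2 a3 y1 y2 y3 b1 b2 b3 where
      eq: "z = ((x1, x2, x3), (a1, a2, a3))" "z' = ((y1, y2, y3), (b1, b2, b3))" by (metis prod.exhaust)
    obtain \<Phi> where \<Phi>: "(x1, \<Phi>) \<in> grad0_graph \<Omega>" "a2 = L2_map trace \<Phi>" "a3 = - \<Phi>"
      and x: "\<And>\<phi> \<Phi>. (\<phi>, \<Phi>) \<in> grad0_graph \<Omega> \<Longrightarrow> \<phi> \<bullet> a1 = \<Phi> \<bullet> x3 - L2_map trace \<Phi> \<bullet> x2"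
      and xL: "x2 \<in> L2_on \<Omega>" "x3 \<in> L2_on \<Omega>" "a1 \<in> L2_on \<Omega>"
      using z unfolding eq A_graph_iff by blast
    obtain \<Psi> where \<Psi>: "(y1, \<Psi>) \<in> grad0_graph \<Omega>" "b2 = L2_map trace \<Psi>" "b3 = - \<Psi>"
      and y: "\<And>\<phi> \<Phi>. (\<phi>, \<Phi>) \<in> grad0_graph \<Omega> \<Longrightarrow> \<phi> \<bullet> b1 = \<Phi> \<bullet> y3 - L2_map trace \<Phi> \<bullet> y2"
      and yL: "y2 \<in> L2_on \<Omega>" "y3 \<in> L2_on \<Omega>" "b1 \<in> L2_on \<Omega>"
      using z' unfolding eq A_graph_iff by blast
    have "(x1 + c *\<^sub>R y1, \<Phi> + c *\<^sub>R \<Psi>) \<in> grad0_graph \<Omega>"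
      using subspace_add[OF subspace_grad0_graph \<Phi>(1) subspace_scale[OF subspace_grad0_graph \<Psi>(1)]] by simp
    moreover have "a2 + c *\<^sub>R b2 = L2_map trace (\<Phi> + c *\<^sub>R \<Psi>)" "a3 + c *\<^sub>R b3 = - (\<Phi> + c *\<^sub>R \<Psi>)"
      by (simp_all add: \<Phi>(2,3) \<Psi>(2,3) tr.add tr.scaleR)
    moreover have "\<phi> \<bullet> (a1 + c *\<^sub>R b1) = \<Theta> \<bullet> (x3 + c *\<^sub>R y3) - L2_map trace \<Theta> \<bullet> (x2 + c *\<^sub>R y2)"
      if "(\<phi>, \<Theta>) \<in> grad0_graph \<Omega>" for \<phi> \<Theta>
      unfolding inner_add_right inner_scaleR_right x[OF that] y[OF that] by (simp add: algebra_simps)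
    moreover have "x2 + c *\<^sub>R y2 \<in> L2_on \<Omega>" "x3 + c *\<^sub>R y3 \<in> L2_on \<Omega>" "a1 + c *\<^sub>R b1 \<in> L2_on \<Omega>"
      using xL yL by (auto intro: subspace_add[OF subs] subspace_scale[OF subs])
    ultimately have "((x1 + c *\<^sub>R y1, x2 + c *\<^sub>R y2, x3 + c *\<^sub>R y3), (a1 + c *\<^sub>R b1, a2 + c *\<^sub>R b2, a3 + c *\<^sub>R b3)) \<in> A_graph \<Omega>"
      unfolding A_graph_iff by blast
    then show ?thesis by (simp add: eq)
  qed
  have "((0, 0, 0), (0, 0, 0)) \<in> A_graph \<Omega>"
    unfolding A_graph_iff
    using subspace_0[OF subs] subspace_0[OF subs] subspace_0[OF subspace_grad0_graph] tr.zero
    by (auto simp: zero_prod_def intro!: exI[of _ 0] subspace_0[OF subs])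
  then have zero: "0 \<in> A_graph \<Omega>" by (simp add: zero_prod_def)
  show ?thesis
    unfolding subspace_def
  proof (intro conjI ballI allI zero)
    fix x y assume "x \<in> A_graph \<Omega>" "y \<in> A_graph \<Omega>"
    from lin[OF this, of 1] show "x + y \<in> A_graph \<Omega>" by (simp only: scaleR_one)
  next
    fix c x assume "x \<in> A_graph \<Omega>"
    from lin[OF zero this, of c] show "c *\<^sub>R x \<in> A_graph \<Omega>" by (simp only: add_0_left)
  qed
qed

text \<open>Triples of test functions are dense and lie in the domain of A: their combination of
  gradient and divergence is again a smooth compactly supported field.\<close>

lemma A_graph_dense:
  assumes x: "x \<in> state_space \<Omega>" and e: "e > 0"
  shows "\<exists>y\<in>Domain (A_graph \<Omega>). norm (x - y) < e"
proof -
  obtain x1 x2 x3 where eq: "x = (x1, x2, x3)" by (metis prod.exhaust)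
  have xL: "x1 \<in> L2_on \<Omega>" "x2 \<in> L2_on \<Omega>" "x3 \<in> L2_on \<Omega>" using x by (auto simp: eq state_space_def)
  have e3: "e / 3 > 0" using e by simp
  obtain \<eta>1 where \<eta>1: "test_function \<Omega> \<eta>1" "norm (x1 - L2_class \<eta>1) < e / 3"
    using test_functions_dense[OF \<Omega> xL(1) e3] by blast
  obtain \<eta>2 where \<eta>2: "test_function \<Omega> \<eta>2" "norm (x2 - L2_class \<eta>2) < e / 3"
    using test_functions_dense[OF \<Omega> xL(2) e3] by blast
  obtain \<eta>3 where \<eta>3: "test_function \<Omega> \<eta>3" "norm (x3 - L2_class \<eta>3) < e / 3"
    using test_functions_dense[OF \<Omega> xL(3) e3] by blast
  \<comment> \<open>The row divergence of a scalar field times the identity matrix is its gradient.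
    Hence grad \<eta>2 - div \<eta>3 is minus the row divergence of this single field.\<close>
  let ?\<zeta> = "\<lambda>x. \<eta>3 x - mat (\<eta>2 x)"
  have mat\<eta>: "test_function \<Omega> (\<lambda>x. mat (\<eta>2 x) :: complex^3^3)"
    using linear_mat \<eta>2(1) unfolding linear_conv_bounded_linear by (rule test_function_bounded_linear)
  have \<zeta>: "test_function \<Omega> ?\<zeta>"
    using test_function_add[OF \<eta>3(1) test_function_bounded_linear[OF bounded_linear_scaleR_right[of "- 1"] mat\<eta>]]
    by simp
  have \<zeta>_class: "L2_class ?\<zeta> = L2_class \<eta>3 - L2_map mat (L2_class \<eta>2)"
    using L2_class_diff[OF test_function_sq_integrable[OF \<eta>3(1)] test_function_sq_integrable[OF mat\<eta>]]
      L2_map_class[OF linear_mat test_function_sq_integrable[OF \<eta>2(1)]] by simp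
  let ?g = "- L2_class (row_divergence ?\<zeta>)"
  have "\<phi> \<bullet> ?g = \<Phi> \<bullet> L2_class \<eta>3 - L2_map trace \<Phi> \<bullet> L2_class \<eta>2" if "(\<phi>, \<Phi>) \<in> grad0_graph \<Omega>" for \<phi> \<Phi>
    using grad0_graph_weak[OF that \<zeta>] inner_L2_map[OF linear_trace linear_mat inner_trace, of \<Phi> "L2_class \<eta>2"]
    by (simp add: \<zeta>_class inner_diff_right)
  moreover have "?g \<in> L2_on \<Omega>"
    by (rule subspace_neg[OF subspace_L2_on[OF \<Omega>] test_function_L2_on[OF test_function_row_divergence[OF \<zeta>]]])
  ultimately have "((L2_class \<eta>1, L2_class \<eta>2, L2_class \<eta>3),
      (?g, L2_map trace (L2_class (jacobi_matrix \<eta>1)), - L2_class (jacobi_matrix \<eta>1))) \<in> A_graph \<Omega>"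
    unfolding A_graph_iff
    using test_function_L2_on[OF \<eta>2(1)] test_function_L2_on[OF \<eta>3(1)] grad0_graph_test[OF \<eta>1(1)] by blast
  then have "(L2_class \<eta>1, L2_class \<eta>2, L2_class \<eta>3) \<in> Domain (A_graph \<Omega>)" by blast
  moreover have "norm (x - (L2_class \<eta>1, L2_class \<eta>2, L2_class \<eta>3)) < e"
    using norm_Pair_le[of "x1 - L2_class \<eta>1" "(x2 - L2_class \<eta>2, x3 - L2_class \<eta>3)"]
      norm_Pair_le[of "x2 - L2_class \<eta>2" "x3 - L2_class \<eta>3"] \<eta>1(2) \<eta>2(2) \<eta>3(2)
    by (simp add: eq)
  ultimately show ?thesis by blast
qed

section \<open>The elliptic problem behind the Euler step, and bounded inverses\<close>

text \<open>Eliminating \<open>\<psi>2\<close> and \<open>\<psi>3\<close> from the implicit Euler step leaves a symmetric coercive problem for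
  \<open>\<psi>1\<close> on the graph of \<open>grad0\<close>.\<close>

lemma grad0_elliptic:
  fixes C :: "complex^3^3 \<Rightarrow> complex^3^3" and D :: "complex L2 \<Rightarrow> complex L2"
  assumes \<alpha>: "\<alpha> > 0" and \<beta>: "\<beta> \<ge> 0" and \<gamma>: "\<gamma> > 0"
    and C: "linear C" "\<And>x y. C x \<bullet> y = x \<bullet> C y" "\<And>x. \<gamma> * (norm x)\<^sup>2 \<le> x \<bullet> C x"
    and D: "bounded_linear D" "\<And>x y. x \<in> L2_on \<Omega> \<Longrightarrow> y \<in> L2_on \<Omega> \<Longrightarrow> D x \<bullet> y = x \<bullet> D y"
      "\<And>x. x \<in> L2_on \<Omega> \<Longrightarrow> 0 \<le> x \<bullet> D x"
  shows "\<exists>\<psi> \<Psi>. (\<psi>, \<Psi>) \<in> grad0_graph \<Omega> \<and> (\<forall>\<phi> \<Phi>. (\<phi>, \<Phi>) \<in> grad0_graph \<Omega> \<longrightarrow>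
    \<phi> \<bullet> (f1 - \<alpha> *\<^sub>R \<psi>) = \<Phi> \<bullet> L2_map C (f3 + \<Psi>) - L2_map trace \<Phi> \<bullet> (\<beta> *\<^sub>R D (f2 - L2_map trace \<Psi>)))"
proof -
  let ?tr = "L2_map trace :: (complex^3^3) L2 \<Rightarrow> complex L2" and ?mat = "L2_map mat :: complex L2 \<Rightarrow> (complex^3^3) L2"
  note bl_tr = bounded_linear_L2_map[OF linear_trace] and bl_mat = bounded_linear_L2_map[OF linear_mat]
    and bl_C = bounded_linear_L2_map[OF C(1)]
  interpret C: bounded_linear "L2_map C" by (rule bl_C)
  interpret D: bounded_linear D by (rule D)
  have adj: "?tr F \<bullet> G = F \<bullet> ?mat G" for F G by (rule inner_L2_map[OF linear_trace linear_mat inner_trace])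
  have C_sym: "L2_map C F \<bullet> G = F \<bullet> L2_map C G" for F G by (rule inner_L2_map[OF C(1) C(1) C(2)])
  \<comment> \<open>The unknown is the pair (\<psi>, \<Psi>) in the closed graph rather than \<psi>
    alone. Thus Q is bounded, and the \<alpha> and C terms alone are coercive in the product norm;
    the term with D is nonnegative.\<close>
  define Q where "Q z = (\<alpha> *\<^sub>R fst z, L2_map C (snd z) + \<beta> *\<^sub>R ?mat (D (?tr (snd z))))"
    for z :: "(complex^3) L2 \<times> (complex^3^3) L2"
  have "bounded_linear (\<lambda>z :: (complex^3) L2 \<times> (complex^3^3) L2. \<beta> *\<^sub>R ?mat (D (?tr (snd z))))"
    by (rule bounded_linear_compose[OF bounded_linear_scaleR_right
          bounded_linear_compose[OF bl_mat bounded_linear_compose[OF D(1) bounded_linear_compose[OF bl_tr bounded_linear_snd]]]])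
  then have Q_bl: "bounded_linear Q"
    unfolding Q_def[abs_def]
    by (intro bounded_linear_Pair bounded_linear_add bounded_linear_compose[OF bounded_linear_scaleR_right bounded_linear_fst]
        bounded_linear_compose[OF bl_C bounded_linear_snd])
  have Q_inner: "Q (\<psi>, \<Psi>) \<bullet> (\<phi>, \<Phi>) = \<alpha> * (\<psi> \<bullet> \<phi>) + L2_map C \<Psi> \<bullet> \<Phi> + \<beta> * (D (?tr \<Psi>) \<bullet> ?tr \<Phi>)" for \<psi> \<Psi> \<phi> \<Phi>
  proof -
    have "?mat (D (?tr \<Psi>)) \<bullet> \<Phi> = D (?tr \<Psi>) \<bullet> ?tr \<Phi>"
      using adj[of \<Phi> "D (?tr \<Psi>)"] by (simp add: inner_commute)
    then show ?thesis by (simp add: Q_def inner_add_left)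
  qed
  have tr_L2: "?tr \<Phi> \<in> L2_on \<Omega>" if "(\<phi>, \<Phi>) \<in> grad0_graph \<Omega>" for \<phi> \<Phi>
    by (rule L2_map_in_L2_on[OF \<Omega> linear_trace grad0_graph_L2_on(2)[OF that]])
  \<comment> \<open>The second component of the functional collects the known data:
    \<open>f2\<close> enters through the adjoint \<open>mat\<close> of the trace, and
    \<open>f3\<close> with the sign it gets when moved across the equation.\<close>
  have "\<exists>w\<in>grad0_graph \<Omega>. \<forall>z\<in>grad0_graph \<Omega>. Q w \<bullet> z = (f1, \<beta> *\<^sub>R ?mat (D f2) - L2_map C f3) \<bullet> z"
  proof (rule symmetric_lax_milgram[OF Q_bl subspace_grad0_graph closed_grad0_graph])
    show "0 < min \<alpha> \<gamma>" using \<alpha> \<gamma> by simp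
    fix x assume x: "x \<in> grad0_graph \<Omega>"
    obtain \<psi> \<Psi> where xe: "x = (\<psi>, \<Psi>)" by (cases x)
    have "min \<alpha> \<gamma> * (norm x)\<^sup>2 = min \<alpha> \<gamma> * (norm \<psi>)\<^sup>2 + min \<alpha> \<gamma> * (norm \<Psi>)\<^sup>2"
      by (simp add: xe norm_Pair distrib_left)
    also have "\<dots> \<le> \<alpha> * (norm \<psi>)\<^sup>2 + \<gamma> * (norm \<Psi>)\<^sup>2"
      by (intro add_mono mult_right_mono) auto
    also have "\<gamma> * (norm \<Psi>)\<^sup>2 \<le> \<Psi> \<bullet> L2_map C \<Psi>" by (rule L2_map_coercive[OF C(1,3)])
    also have "\<alpha> * (norm \<psi>)\<^sup>2 + \<Psi> \<bullet> L2_map C \<Psi> \<le> x \<bullet> Q x"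
    proof -
      have "0 \<le> ?tr \<Psi> \<bullet> D (?tr \<Psi>)" by (rule D(3)[OF tr_L2[OF x[unfolded xe]]])
      then have "0 \<le> \<beta> * (D (?tr \<Psi>) \<bullet> ?tr \<Psi>)" using \<beta> by (simp add: inner_commute)
      then show ?thesis
        unfolding inner_commute[of x] unfolding xe Q_inner
        by (simp add: power2_norm_eq_inner inner_commute)
    qed
    finally show "min \<alpha> \<gamma> * (norm x)\<^sup>2 \<le> x \<bullet> Q x" by simp
  next
    fix x y assume x: "x \<in> grad0_graph \<Omega>" and y: "y \<in> grad0_graph \<Omega>"
    obtain \<psi> \<Psi> where xe: "x = (\<psi>, \<Psi>)" by (cases x)
    obtain \<phi> \<Phi> where ye: "y = (\<phi>, \<Phi>)" by (cases y)
    have "D (?tr \<Psi>) \<bullet> ?tr \<Phi> = D (?tr \<Phi>) \<bullet> ?tr \<Psi>"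
      using D(2)[OF tr_L2[OF x[unfolded xe]] tr_L2[OF y[unfolded ye]]] by (simp add: inner_commute)
    moreover have "L2_map C \<Psi> \<bullet> \<Phi> = L2_map C \<Phi> \<bullet> \<Psi>" using C_sym[of \<Psi> \<Phi>] by (simp add: inner_commute)
    ultimately show "Q x \<bullet> y = x \<bullet> Q y"
      unfolding inner_commute[of x] unfolding xe ye Q_inner by (simp add: inner_commute)
  qed
  then obtain \<psi> \<Psi> where w: "(\<psi>, \<Psi>) \<in> grad0_graph \<Omega>"
    and eq: "\<And>\<phi> \<Phi>. (\<phi>, \<Phi>) \<in> grad0_graph \<Omega> \<Longrightarrow> Q (\<psi>, \<Psi>) \<bullet> (\<phi>, \<Phi>) = (f1, \<beta> *\<^sub>R ?mat (D f2) - L2_map C f3) \<bullet> (\<phi>, \<Phi>)"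
    by (metis prod.exhaust)
  have "\<phi> \<bullet> (f1 - \<alpha> *\<^sub>R \<psi>) = \<Phi> \<bullet> L2_map C (f3 + \<Psi>) - ?tr \<Phi> \<bullet> (\<beta> *\<^sub>R D (f2 - ?tr \<Psi>))"
    if "(\<phi>, \<Phi>) \<in> grad0_graph \<Omega>" for \<phi> \<Phi>
  proof -
    have "?mat (D f2) \<bullet> \<Phi> = ?tr \<Phi> \<bullet> D f2" using adj[of \<Phi> "D f2"] by (simp add: inner_commute)
    then have "\<alpha> * (\<psi> \<bullet> \<phi>) + L2_map C \<Psi> \<bullet> \<Phi> + \<beta> * (D (?tr \<Psi>) \<bullet> ?tr \<Phi>) =
        f1 \<bullet> \<phi> + \<beta> * (?tr \<Phi> \<bullet> D f2) - L2_map C f3 \<bullet> \<Phi>"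
      using eq[OF that] unfolding Q_inner by (simp add: inner_diff_left)
    then show ?thesis
      by (simp add: C.add D.diff inner_diff_right inner_add_right inner_commute algebra_simps)
  qed
  with w show ?thesis by blast
qed

end

text \<open>The variational solution satisfies Q w = R x only against W; but Q w - R x itself lies
  in W, so it is orthogonal to itself. Solving for R x instead of x makes D a bounded linear map on
  the whole type, as required of the pseudo-inverse N.\<close>

lemma inverse_on_subspace:
  fixes Q :: "'h::{real_inner, banach} \<Rightarrow> 'h"
  assumes Q: "bounded_linear Q" and W: "subspace W" "closed W" and QW: "\<And>x. x \<in> W \<Longrightarrow> Q x \<in> W"
    and sym: "\<And>x y. x \<in> W \<Longrightarrow> y \<in> W \<Longrightarrow> Q x \<bullet> y = x \<bullet> Q y"
    and \<delta>: "\<delta> > 0" and coercive: "\<And>x. x \<in> W \<Longrightarrow> \<delta> * (norm x)\<^sup>2 \<le> x \<bullet> Q x"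
    and R: "bounded_linear R" "\<And>x. R x \<in> W" "\<And>x. x \<in> W \<Longrightarrow> R x = x"
  obtains D where "bounded_linear D" "\<And>x. D x \<in> W" "\<And>x. x \<in> W \<Longrightarrow> Q (D x) = x"
    "\<And>x y. x \<in> W \<Longrightarrow> y \<in> W \<Longrightarrow> D x \<bullet> y = x \<bullet> D y" "\<And>x. x \<in> W \<Longrightarrow> 0 \<le> x \<bullet> D x"
proof -
  interpret Q: bounded_linear Q by (rule Q)
  interpret R: bounded_linear R by (rule R)
  have inj: "x = y" if "x \<in> W" "y \<in> W" "Q x = Q y" for x y
  proof -
    have "\<delta> * (norm (x - y))\<^sup>2 \<le> (x - y) \<bullet> Q (x - y)" by (rule coercive[OF subspace_diff[OF W(1) that(1,2)]])
    also have "\<dots> = 0" by (simp add: Q.diff that(3))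
    finally have "(norm (x - y))\<^sup>2 \<le> 0" using \<delta> by (simp add: mult_le_0_iff)
    then show ?thesis by simp
  qed
  have "\<exists>w. w \<in> W \<and> Q w = R x" for x
  proof -
    obtain w where w: "w \<in> W" "\<And>\<phi>. \<phi> \<in> W \<Longrightarrow> Q w \<bullet> \<phi> = R x \<bullet> \<phi>"
      using symmetric_lax_milgram[OF Q W sym \<delta> coercive] by blast
    have "Q w - R x \<in> W" by (rule subspace_diff[OF W(1) QW[OF w(1)] R(2)])
    from w(2)[OF this] have "(Q w - R x) \<bullet> (Q w - R x) = 0" by (simp add: inner_diff_left)
    then show ?thesis using w(1) by auto
  qed
  then obtain D where D: "\<And>x. D x \<in> W" "\<And>x. Q (D x) = R x" by metis
  have bl: "bounded_linear D"
  proof -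
    obtain K where K: "K \<ge> 0" "\<And>x. norm (R x) \<le> norm x * K" using R.nonneg_bounded by blast
    show ?thesis
    proof (rule bounded_linear_intro[where K = "K / \<delta>"])
      show "D (x + y) = D x + D y" for x y
        by (rule inj[OF D(1) subspace_add[OF W(1) D(1) D(1)]]) (simp add: Q.add D(2) R.add)
      show "D (r *\<^sub>R x) = r *\<^sub>R D x" for r x
        by (rule inj[OF D(1) subspace_scale[OF W(1) D(1)]]) (simp add: Q.scaleR D(2) R.scaleR)
      show "norm (D x) \<le> norm x * (K / \<delta>)" for x
      proof -
        have "\<delta> * (norm (D x))\<^sup>2 \<le> D x \<bullet> R x" using coercive[OF D(1)[of x]] by (simp add: D(2))
        also have "\<dots> \<le> norm (D x) * (norm x * K)"
          by (rule order_trans[OF norm_cauchy_schwarz mult_left_mono[OF K(2)]]) simp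
        finally have *: "norm (D x) * (\<delta> * norm (D x)) \<le> norm (D x) * (norm x * K)"
          by (simp add: power2_eq_square algebra_simps)
        show ?thesis
        proof (cases "norm (D x) = 0")
          case False
          then have "\<delta> * norm (D x) \<le> norm x * K" using * by simp
          then show ?thesis using \<delta> by (simp add: field_simps)
        qed (use K \<delta> in simp)
      qed
    qed
  qed
  have QD: "Q (D x) = x" if "x \<in> W" for x using D(2) R(3)[OF that] by simp
  have sym': "D x \<bullet> y = x \<bullet> D y" if "x \<in> W" "y \<in> W" for x y
    using sym[OF D(1)[of x] D(1)[of y]] QD[OF that(1)] QD[OF that(2)] by simp
  have nonneg: "0 \<le> x \<bullet> D x" if "x \<in> W" for x
  proof -
    have "0 \<le> \<delta> * (norm (D x))\<^sup>2" using \<delta> by simp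
    also have "\<dots> \<le> D x \<bullet> Q (D x)" by (rule coercive[OF D(1)])
    finally show ?thesis using QD[OF that] by (simp add: inner_commute)
  qed
  show ?thesis by (rule that[OF bl D(1) QD sym' nonneg])
qed

section \<open>The evolutionary system\<close>

definition diag3 :: "('a \<Rightarrow> 'a) \<Rightarrow> ('b \<Rightarrow> 'b) \<Rightarrow> ('c \<Rightarrow> 'c) \<Rightarrow> 'a \<times> 'b \<times> 'c \<Rightarrow> 'a \<times> 'b \<times> 'c" where
  "diag3 f g h x = (f (fst x), g (fst (snd x)), h (snd (snd x)))"

lemma diag3_simp [simp]: "diag3 f g h (a, b, c) = (f a, g b, h c)"
  by (simp add: diag3_def)

lemma bounded_linear_diag3:
  assumes "bounded_linear f" "bounded_linear g" "bounded_linear h"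
  shows "bounded_linear (diag3 f g h)"
  unfolding diag3_def[abs_def]
  by (intro bounded_linear_Pair bounded_linear_compose[OF assms(1) bounded_linear_fst]
      bounded_linear_compose[OF assms(2) bounded_linear_compose[OF bounded_linear_fst bounded_linear_snd]]
      bounded_linear_compose[OF assms(3) bounded_linear_compose[OF bounded_linear_snd bounded_linear_snd]])

lemma state_spaceE:
  assumes "x \<in> state_space \<Omega>"
  obtains a b c where "x = (a, b, c)" "a \<in> L2_on \<Omega>" "b \<in> L2_on \<Omega>" "c \<in> L2_on \<Omega>"
  using assms that by (cases x) (auto simp: state_space_def)

lemma state_space_iff: "(a, b, c) \<in> state_space \<Omega> \<longleftrightarrow> a \<in> L2_on \<Omega> \<and> b \<in> L2_on \<Omega> \<and> c \<in> L2_on \<Omega>"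
  by (simp add: state_space_def)

text \<open>The hypotheses on c speak only about \<open>L2_on \<Omega>\<close>, while the abstract
  setting works with maps that are bounded and linear on a whole type. Precomposing with the
  projection achieves this and leaves c unchanged on the subspace.\<close>

lemma bounded_op_on_restrict:
  assumes \<Omega>: "open \<Omega>" and c: "bounded_op_on (L2_on \<Omega>) c"
  shows "bounded_linear (\<lambda>F. c (L2_restrict \<Omega> F))"
proof -
  interpret R: bounded_linear "L2_restrict \<Omega> :: 'a L2 \<Rightarrow> 'a L2" by (rule bounded_linear_L2_restrict[OF \<Omega>])
  obtain K where K: "\<And>x. x \<in> L2_on \<Omega> \<Longrightarrow> norm (c x) \<le> K * norm x"
    and add: "\<And>x y. x \<in> L2_on \<Omega> \<Longrightarrow> y \<in> L2_on \<Omega> \<Longrightarrow> c (x + y) = c x + c y"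
    and scale: "\<And>a x. x \<in> L2_on \<Omega> \<Longrightarrow> c (a *\<^sub>C x) = a *\<^sub>C c x"
    using c unfolding bounded_op_on_def by blast
  obtain B where B: "B \<ge> 0" "\<And>F. norm (L2_restrict \<Omega> F :: 'a L2) \<le> norm F * B" using R.nonneg_bounded by blast
  note R_in = L2_restrict_in[OF \<Omega>]
  show ?thesis
  proof (rule bounded_linear_intro[where K = "B * \<bar>K\<bar>"])
    show "c (L2_restrict \<Omega> (x + y)) = c (L2_restrict \<Omega> x) + c (L2_restrict \<Omega> y)" for x y
      unfolding R.add by (rule add[OF R_in R_in])
    show "c (L2_restrict \<Omega> (r *\<^sub>R x)) = r *\<^sub>R c (L2_restrict \<Omega> x)" for r x
      using scale[OF R_in, of "complex_of_real r"] by (simp add: R.scaleR scaleC_of_real)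
    show "norm (c (L2_restrict \<Omega> x)) \<le> norm x * (B * \<bar>K\<bar>)" for x
    proof -
      have "norm (c (L2_restrict \<Omega> x)) \<le> K * norm (L2_restrict \<Omega> x)" by (rule K[OF R_in])
      also have "\<dots> \<le> \<bar>K\<bar> * norm (L2_restrict \<Omega> x)" by (rule mult_right_mono) simp_all
      also have "\<dots> \<le> \<bar>K\<bar> * (norm x * B)" by (rule mult_left_mono[OF B(2)]) simp
      finally show ?thesis by (simp add: mult.commute mult.left_commute)
    qed
  qed
qed

text \<open>Injectivity comes from coercivity and surjectivity from finite dimension. For the
  inverse put y = C x: the pairing of y with \<open>inv C y\<close> is x \<bullet> C x, at least
  \<gamma> |x|^2, and |y| \<le> k |x| turns this into \<gamma> / k^2 times |y|^2. Taking the maximum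
  with 1 makes k positive.\<close>

lemma real_positive_definite_matrix_op:
  fixes C :: "complex^3^3 \<Rightarrow> complex^3^3"
  assumes "bounded_op_on UNIV C" "selfadjoint_on UNIV C" "strictly_pos_def_on UNIV C"
  obtains \<gamma> e where "linear C" "\<And>x y. C x \<bullet> y = x \<bullet> C y" "\<gamma> > 0" "\<And>x. \<gamma> * (norm x)\<^sup>2 \<le> x \<bullet> C x"
    "linear (inv C)" "\<And>x. inv C (C x) = x" "e > 0" "\<And>x. e * (norm x)\<^sup>2 \<le> x \<bullet> inv C x"
proof -
  have C_add: "C (x + y) = C x + C y" and C_scale: "C (a *\<^sub>C x) = a *\<^sub>C C x" for x y a
    using assms(1) by (auto simp: bounded_op_on_def)
  obtain K where K: "\<And>x. norm (C x) \<le> K * norm x" using assms(1) by (auto simp: bounded_op_on_def)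
  have lin: "linear C"
    by (rule linearI) (simp add: C_add, metis C_scale scaleC_of_real)
  have sym: "C x \<bullet> y = x \<bullet> C y" for x y
    using assms(2) unfolding selfadjoint_on_def Re_cinner[symmetric] by simp
  obtain \<gamma> where \<gamma>: "\<gamma> > 0" "\<And>x. \<gamma> * (norm x)\<^sup>2 \<le> x \<bullet> C x"
    using assms(3) unfolding strictly_pos_def_on_def Re_cinner by blast
  have inj: "inj C"
  proof (rule injI)
    fix x y assume "C x = C y"
    then have "C (x - y) = 0" by (simp add: linear_diff[OF lin])
    with \<gamma>(2)[of "x - y"] have "\<gamma> * (norm (x - y))\<^sup>2 \<le> 0" by simp
    then have "(norm (x - y))\<^sup>2 \<le> 0" using \<gamma>(1) by (simp add: mult_le_0_iff)
    then show "x = y" by simp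
  qed
  have surj: "surj C" by (rule linear_inj_imp_surj[OF lin inj])
  have inv1: "inv C (C x) = x" for x by (rule inv_f_f[OF inj])
  have inv2: "C (inv C y) = y" for y by (rule surj_f_inv_f[OF surj])
  have lin_inv: "linear (inv C)"
  proof (rule linearI)
    show "inv C (x + y) = inv C x + inv C y" for x y
      by (rule injD[OF inj]) (simp add: inv2 linear_add[OF lin])
    show "inv C (r *\<^sub>R x) = r *\<^sub>R inv C x" for r x
      by (rule injD[OF inj]) (simp add: inv2 linear_cmul[OF lin])
  qed
  define k where "k = max K 1"
  have k: "k > 0" "\<And>x. norm (C x) \<le> k * norm x"
    using K by (auto simp: k_def intro: order_trans[OF K mult_right_mono])
  have "\<gamma> / k\<^sup>2 * (norm y)\<^sup>2 \<le> y \<bullet> inv C y" for y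
  proof -
    define x where "x = inv C y"
    have "(norm y)\<^sup>2 \<le> (k * norm x)\<^sup>2"
      using k(2)[of x] by (intro power_mono) (simp_all add: x_def inv2)
    then have "\<gamma> / k\<^sup>2 * (norm y)\<^sup>2 \<le> \<gamma> / k\<^sup>2 * (k\<^sup>2 * (norm x)\<^sup>2)"
      using \<gamma>(1) by (intro mult_left_mono) (auto simp: power_mult_distrib)
    also have "\<dots> = \<gamma> * (norm x)\<^sup>2" using k(1) by simp
    also have "\<dots> \<le> x \<bullet> C x" by (rule \<gamma>(2))
    also have "\<dots> = y \<bullet> inv C y" by (simp add: x_def inv2 inner_commute)
    finally show ?thesis .
  qed
  moreover have "\<gamma> / k\<^sup>2 > 0" using \<gamma>(1) k(1) by simp
  ultimately show ?thesis using that[OF lin sym \<gamma> lin_inv inv1] by blast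
qed

text \<open>N inverts \<open>M0\<close> in the first two components and is 0 in the third, where
  \<open>M0\<close> vanishes. Working on all of L2 and projecting to \<Omega> lets type class
  instances provide completeness and separability.\<close>

lemma state_system_evolutionary:
  fixes C :: "complex^3^3 \<Rightarrow> complex^3^3" and c :: "complex L2 \<Rightarrow> complex L2"
  assumes pos: "\<tau>0 > 0" "\<rho> > 0" "\<kappa> > 0" and \<Omega>: "open \<Omega>"
    and C: "bounded_op_on UNIV C" "selfadjoint_on UNIV C" "strictly_pos_def_on UNIV C"
    and c: "bounded_op_on (L2_on \<Omega>) c" "selfadjoint_on (L2_on \<Omega>) c" "strictly_pos_def_on (L2_on \<Omega>) c"
  shows "\<exists>D \<delta>. evolutionary
    (diag3 (L2_restrict \<Omega>) (L2_restrict \<Omega>) (L2_restrict \<Omega>))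
    (diag3 (\<lambda>x. (\<tau>0 * inverse \<kappa>) *\<^sub>R x) (\<lambda>x. \<rho> *\<^sub>R c (L2_restrict \<Omega> x)) (\<lambda>_. 0))
    (diag3 (\<lambda>x. inverse \<kappa> *\<^sub>R x) (\<lambda>_. 0) (L2_map (inv C)))
    (diag3 (\<lambda>x. (\<kappa> / \<tau>0) *\<^sub>R x) (\<lambda>x. inverse \<rho> *\<^sub>R D x) (\<lambda>_. 0))
    (state_space \<Omega>) (A_graph \<Omega>) 1 \<delta>"
proof -
  let ?R = "L2_restrict \<Omega>"
  obtain \<gamma> e where linC: "linear C" and symC: "\<And>x y. C x \<bullet> y = x \<bullet> C y" and \<gamma>: "\<gamma> > 0" "\<And>x. \<gamma> * (norm x)\<^sup>2 \<le> x \<bullet> C x"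
    and linI: "linear (inv C)" and invC: "\<And>x. inv C (C x) = x" and e: "e > 0" "\<And>x. e * (norm x)\<^sup>2 \<le> x \<bullet> inv C x"
    by (rule real_positive_definite_matrix_op[OF C]) blast
  define c' where "c' x = c (L2_restrict \<Omega> x)" for x
  have c'_eq: "c' x = c x" if "x \<in> L2_on \<Omega>" for x by (simp add: c'_def L2_restrict_id[OF \<Omega> that])
  have c'_bl: "bounded_linear c'" unfolding c'_def[abs_def] by (rule bounded_op_on_restrict[OF \<Omega> c(1)])
  have c'_in: "c' x \<in> L2_on \<Omega>" for x
    using c(1) L2_restrict_in[OF \<Omega>] unfolding c'_def bounded_op_on_def by blast
  have c'_sym: "c' x \<bullet> y = x \<bullet> c' y" if "x \<in> L2_on \<Omega>" "y \<in> L2_on \<Omega>" for x y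
    unfolding c'_eq[OF that(1)] c'_eq[OF that(2)] Re_cinner[symmetric]
    using c(2) that by (simp add: selfadjoint_on_def)
  obtain d where d: "d > 0" "\<And>x. x \<in> L2_on \<Omega> \<Longrightarrow> d * (norm x)\<^sup>2 \<le> x \<bullet> c' x"
    using c(3) c'_eq unfolding strictly_pos_def_on_def Re_cinner by metis
  note sub = subspace_L2_on[OF \<Omega>] and cl = closed_L2_on[OF \<Omega>]
  obtain D where D: "bounded_linear D" "\<And>x. D x \<in> L2_on \<Omega>" "\<And>x. x \<in> L2_on \<Omega> \<Longrightarrow> c' (D x) = x"
    "\<And>x y. x \<in> L2_on \<Omega> \<Longrightarrow> y \<in> L2_on \<Omega> \<Longrightarrow> D x \<bullet> y = x \<bullet> D y" "\<And>x. x \<in> L2_on \<Omega> \<Longrightarrow> 0 \<le> x \<bullet> D x"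
    by (rule inverse_on_subspace[OF c'_bl sub cl c'_in c'_sym d bounded_linear_L2_restrict[OF \<Omega>]
          L2_restrict_in[OF \<Omega>] L2_restrict_id[OF \<Omega>]]) (assumption+, blast)
  interpret c': bounded_linear c' by (rule c'_bl)
  let ?P = "diag3 ?R ?R ?R :: state \<Rightarrow> state"
  let ?M0 = "diag3 (\<lambda>x. (\<tau>0 * inverse \<kappa>) *\<^sub>R x) (\<lambda>x. \<rho> *\<^sub>R c' x) (\<lambda>_. 0) :: state \<Rightarrow> state"
  let ?M1 = "diag3 (\<lambda>x. inverse \<kappa> *\<^sub>R x) (\<lambda>_. 0) (L2_map (inv C)) :: state \<Rightarrow> state"
  let ?N = "diag3 (\<lambda>x. (\<kappa> / \<tau>0) *\<^sub>R x) (\<lambda>x. inverse \<rho> *\<^sub>R D x) (\<lambda>_. 0) :: state \<Rightarrow> state"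
  let ?S = "state_space \<Omega>"
  \<comment> \<open>The three constants come from \<open>M1\<close> on the first component,
    \<open>M0\<close> on the second and \<open>M1\<close> on the third; the nonnegative part of
    \<open>M0\<close> on the first component is dropped.\<close>
  define \<delta> where "\<delta> = min (inverse \<kappa>) (min (\<rho> * d) e)"
  note scale = subspace_scale[OF sub]
  have "evolutionary ?P ?M0 ?M1 ?N ?S (A_graph \<Omega>) 1 \<delta>"
  proof (rule evolutionary.intro)
    show "bounded_linear ?P" by (intro bounded_linear_diag3 bounded_linear_L2_restrict[OF \<Omega>])
    show "?P x \<in> ?S" for x by (cases x) (simp add: state_space_iff L2_restrict_in[OF \<Omega>])
    show "?P x = x" if "x \<in> ?S" for x
      using that by (rule state_spaceE) (simp add: L2_restrict_id[OF \<Omega>])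
    show "bounded_linear ?M0"
      by (intro bounded_linear_diag3 bounded_linear_scaleR_right bounded_linear_zero
          bounded_linear_compose[OF bounded_linear_scaleR_right c'_bl])
    show "?M0 x \<in> ?S" if "x \<in> ?S" for x
      using that by (rule state_spaceE) (simp add: state_space_iff scale c'_in subspace_0[OF sub])
    show "?M0 x \<bullet> y = x \<bullet> ?M0 y" if x: "x \<in> ?S" and y: "y \<in> ?S" for x y
    proof -
      obtain x1 x2 x3 where xe: "x = (x1, x2, x3)" "x2 \<in> L2_on \<Omega>" using x by (rule state_spaceE) blast
      obtain y1 y2 y3 where ye: "y = (y1, y2, y3)" "y2 \<in> L2_on \<Omega>" using y by (rule state_spaceE) blast
      show ?thesis by (simp add: xe(1) ye(1) c'_sym[OF xe(2) ye(2)])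
    qed
    show "0 \<le> x \<bullet> ?M0 x" if x: "x \<in> ?S" for x
    proof -
      obtain x1 x2 x3 where xe: "x = (x1, x2, x3)" "x2 \<in> L2_on \<Omega>" using x by (rule state_spaceE) blast
      have "0 \<le> d * (norm x2)\<^sup>2" using d(1) by simp
      then have "0 \<le> x2 \<bullet> c' x2" using d(2)[OF xe(2)] by linarith
      then show ?thesis using pos by (simp add: xe(1))
    qed
    show "bounded_linear ?M1"
      by (intro bounded_linear_diag3 bounded_linear_scaleR_right bounded_linear_zero bounded_linear_L2_map linI)
    show "?M1 x \<in> ?S" if "x \<in> ?S" for x
      using that by (rule state_spaceE)
        (simp add: state_space_iff scale L2_map_in_L2_on[OF \<Omega> linI] subspace_0[OF sub])
    show "bounded_linear ?N"
      by (intro bounded_linear_diag3 bounded_linear_scaleR_right bounded_linear_zero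
          bounded_linear_compose[OF bounded_linear_scaleR_right D(1)])
    show "?N x \<in> ?S" if "x \<in> ?S" for x
      using that by (rule state_spaceE) (simp add: state_space_iff scale D(2) subspace_0[OF sub])
    show "?N x \<bullet> y = x \<bullet> ?N y" if x: "x \<in> ?S" and y: "y \<in> ?S" for x y
    proof -
      obtain x1 x2 x3 where xe: "x = (x1, x2, x3)" "x2 \<in> L2_on \<Omega>" using x by (rule state_spaceE) blast
      obtain y1 y2 y3 where ye: "y = (y1, y2, y3)" "y2 \<in> L2_on \<Omega>" using y by (rule state_spaceE) blast
      show ?thesis by (simp add: xe(1) ye(1) D(4)[OF xe(2) ye(2)])
    qed
    show "?M0 (?N (?M0 x)) = ?M0 x" if x: "x \<in> ?S" for x
    proof -
      obtain x1 x2 x3 where xe: "x = (x1, x2, x3)" using x by (rule state_spaceE) blast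
      have "c' (D (\<rho> *\<^sub>R c' x2)) = \<rho> *\<^sub>R c' x2" by (rule D(3)[OF scale[OF c'_in]])
      then show ?thesis using pos by (simp add: xe c'.scaleR)
    qed
    show "A_graph \<Omega> \<subseteq> ?S \<times> ?S" by (rule A_graph_subset[OF \<Omega>])
    show "subspace (A_graph \<Omega>)" by (rule subspace_A_graph[OF \<Omega>])
    show "a \<bullet> y = - (x \<bullet> b)" if "(x, a) \<in> A_graph \<Omega>" "(y, b) \<in> A_graph \<Omega>" for x a y b
      by (rule A_graph_skew[OF \<Omega> that])
    show "\<exists>y\<in>Domain (A_graph \<Omega>). norm (x - y) < e" if "x \<in> ?S" "e > 0" for x e
      by (rule A_graph_dense[OF \<Omega> that])
    show "\<exists>x a. (x, a) \<in> A_graph \<Omega> \<and> inverse h *\<^sub>R ?M0 x + ?M1 x + a = f" if h: "h > 0" and f: "f \<in> ?S" for h f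
    proof -
      obtain f1 f2 f3 where fe: "f = (f1, f2, f3)" and fL: "f1 \<in> L2_on \<Omega>" "f2 \<in> L2_on \<Omega>" "f3 \<in> L2_on \<Omega>"
        using f by (rule state_spaceE) blast
      \<comment> \<open>\<alpha> is the total coefficient of \<psi> in the first row. The second
        row, \<rho> c \<psi>2 / h + trace \<Psi> = f2, gives \<psi>2 = \<beta> D (f2 - trace \<Psi>)
        with \<beta> = h / \<rho>; the third, \<open>inv C\<close> \<psi>3 - \<Psi> = f3, gives
        \<psi>3 = C (f3 + \<Psi>).\<close>
      define \<alpha> where "\<alpha> = inverse h * (\<tau>0 * inverse \<kappa>) + inverse \<kappa>"
      define \<beta> where "\<beta> = h / \<rho>"
      have \<alpha>: "\<alpha> > 0" and \<beta>: "\<beta> \<ge> 0" using h pos by (auto simp: \<alpha>_def \<beta>_def intro!: add_pos_pos mult_pos_pos)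
      obtain \<psi> \<Psi> where \<psi>: "(\<psi>, \<Psi>) \<in> grad0_graph \<Omega>"
        and weak: "\<And>\<phi> \<Phi>. (\<phi>, \<Phi>) \<in> grad0_graph \<Omega> \<Longrightarrow> \<phi> \<bullet> (f1 - \<alpha> *\<^sub>R \<psi>) =
          \<Phi> \<bullet> L2_map C (f3 + \<Psi>) - L2_map trace \<Phi> \<bullet> (\<beta> *\<^sub>R D (f2 - L2_map trace \<Psi>))"
        using grad0_elliptic[OF \<Omega> \<alpha> \<beta> \<gamma>(1) linC symC \<gamma>(2) D(1,4,5), of f1 f3 f2] by blast
      note L = grad0_graph_L2_on[OF \<Omega> \<psi>]
      let ?\<psi>2 = "\<beta> *\<^sub>R D (f2 - L2_map trace \<Psi>)" and ?\<psi>3 = "L2_map C (f3 + \<Psi>)"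
      have trL: "L2_map trace \<Psi> \<in> L2_on \<Omega>" by (rule L2_map_in_L2_on[OF \<Omega> linear_trace L(2)])
      have "((\<psi>, ?\<psi>2, ?\<psi>3), (f1 - \<alpha> *\<^sub>R \<psi>, L2_map trace \<Psi>, - \<Psi>)) \<in> A_graph \<Omega>"
        unfolding A_graph_iff[OF \<Omega>]
        using weak \<psi> scale[OF D(2)] L2_map_in_L2_on[OF \<Omega> linC subspace_add[OF sub fL(3) L(2)]]
          subspace_diff[OF sub fL(1) scale[OF L(1)]] by blast
      moreover have "inverse h *\<^sub>R ?M0 (\<psi>, ?\<psi>2, ?\<psi>3) + ?M1 (\<psi>, ?\<psi>2, ?\<psi>3) + (f1 - \<alpha> *\<^sub>R \<psi>, L2_map trace \<Psi>, - \<Psi>) = f"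
      proof -
        have "c' ?\<psi>2 = \<beta> *\<^sub>R (f2 - L2_map trace \<Psi>)"
          unfolding c'.scaleR D(3)[OF subspace_diff[OF sub fL(2) trL]] ..
        moreover have "L2_map (inv C) ?\<psi>3 = f3 + \<Psi>"
          unfolding L2_map_L2_map[OF linI linC] invC by (rule L2_map_ident)
        ultimately show ?thesis using h pos
          by (simp add: fe \<alpha>_def \<beta>_def scaleR_add_left)
      qed
      ultimately show ?thesis by blast
    qed
    show "(0::real) < 1" by simp
    show "0 < \<delta>" using pos d(1) e(1) by (simp add: \<delta>_def)
    show "\<delta> * (norm x)\<^sup>2 \<le> 1 * (x \<bullet> ?M0 x) + x \<bullet> ?M1 x" if x: "x \<in> ?S" for x
    proof -
      obtain x1 x2 x3 where xe: "x = (x1, x2, x3)" "x2 \<in> L2_on \<Omega>" using x by (rule state_spaceE) blast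
      have le: "\<delta> \<le> inverse \<kappa>" "\<delta> \<le> \<rho> * d" "\<delta> \<le> e" by (auto simp: \<delta>_def)
      have "\<delta> * (norm x)\<^sup>2 = \<delta> * (norm x1)\<^sup>2 + \<delta> * (norm x2)\<^sup>2 + \<delta> * (norm x3)\<^sup>2"
        by (simp add: xe(1) norm_Pair distrib_left)
      also have "\<dots> \<le> inverse \<kappa> * (norm x1)\<^sup>2 + (\<rho> * d) * (norm x2)\<^sup>2 + e * (norm x3)\<^sup>2"
        using le by (intro add_mono mult_right_mono) auto
      also have "(\<rho> * d) * (norm x2)\<^sup>2 \<le> \<rho> * (x2 \<bullet> c' x2)"
        using mult_left_mono[OF d(2)[OF xe(2)], of \<rho>] pos by (simp add: mult.assoc)
      also have "e * (norm x3)\<^sup>2 \<le> x3 \<bullet> L2_map (inv C) x3" by (rule L2_map_coercive[OF linI e(2)])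
      also have "inverse \<kappa> * (norm x1)\<^sup>2 + \<rho> * (x2 \<bullet> c' x2) + x3 \<bullet> L2_map (inv C) x3
          \<le> 1 * (x \<bullet> ?M0 x) + x \<bullet> ?M1 x"
      proof -
        have "0 \<le> (\<tau>0 * inverse \<kappa>) * (x1 \<bullet> x1)" using pos by simp
        then show ?thesis by (simp add: xe(1) power2_norm_eq_inner)
      qed
      finally show ?thesis by simp
    qed
  qed
  then show ?thesis unfolding c'_def by blast
qed

theorem theorem2p7:
  fixes \<tau>0 \<rho> \<kappa> \<mu>1 \<mu>2 :: real
    and \<Omega> :: "(real^3) set"
    and C :: "complex^3^3 \<Rightarrow> complex^3^3"
    and c :: "complex L2 \<Rightarrow> complex L2"
  assumes "\<tau>0 > 0" and "\<rho> > 0" and "\<kappa> > 0"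
    and "\<mu>2 > - \<mu>1"
    and "open \<Omega>" and "\<Omega> \<noteq> {}"
    and "bounded_op_on UNIV C" and "selfadjoint_on UNIV C" and "strictly_pos_def_on UNIV C"
    and "\<And>\<phi> x. smooth_up_to_boundary \<Omega> \<phi> \<Longrightarrow> x \<in> \<Omega> \<Longrightarrow>
           (inverse \<kappa> * \<mu>1) *\<^sub>R laplacian \<phi> x +
           (inverse \<kappa> * \<mu>2) *\<^sub>R gradient (divergence \<phi>) x =
           row_divergence (\<lambda>y. C (jacobi_matrix \<phi> y)) x"
    and "bounded_op_on (L2_on \<Omega>) c" and "selfadjoint_on (L2_on \<Omega>) c"
    and "strictly_pos_def_on (L2_on \<Omega>) c"
  shows "\<forall>\<^sub>F \<nu> in at_top. continuously_invertible \<nu> (state_space \<Omega>)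
           (Hnu_closure \<nu> (state_space \<Omega>) (T_graph \<tau>0 \<rho> \<kappa> C c \<Omega> \<nu>))"
proof -
  let ?M0 = "diag3 (\<lambda>x. (\<tau>0 * inverse \<kappa>) *\<^sub>R x) (\<lambda>x. \<rho> *\<^sub>R c (L2_restrict \<Omega> x)) (\<lambda>_. 0) :: state \<Rightarrow> state"
  let ?M1 = "diag3 (\<lambda>x. inverse \<kappa> *\<^sub>R x) (\<lambda>_. 0) (L2_map (inv C)) :: state \<Rightarrow> state"
  obtain D \<delta> where evo: "evolutionary
    (diag3 (L2_restrict \<Omega>) (L2_restrict \<Omega>) (L2_restrict \<Omega>)) ?M0 ?M1
    (diag3 (\<lambda>x. (\<kappa> / \<tau>0) *\<^sub>R x) (\<lambda>x. inverse \<rho> *\<^sub>R D x) (\<lambda>_. 0)) (state_space \<Omega>) (A_graph \<Omega>) 1 \<delta>"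
    using state_system_evolutionary[OF assms(1-3,5,7-9,11-13)] by blast
  interpret evolutionary "diag3 (L2_restrict \<Omega>) (L2_restrict \<Omega>) (L2_restrict \<Omega>)" ?M0 ?M1
    "diag3 (\<lambda>x. (\<kappa> / \<tau>0) *\<^sub>R x) (\<lambda>x. inverse \<rho> *\<^sub>R D x) (\<lambda>_. 0)" "state_space \<Omega>" "A_graph \<Omega>" 1 \<delta>
    by (rule evo)
  \<comment> \<open>The two versions of \<open>M0\<close> are compared on the state space, where the
    projection before c is the identity. That is enough, because members of \<open>Hnu\<close> take
    their values there at every time.\<close>
  have M0_eq: "Defs.M0 \<tau>0 \<rho> \<kappa> c x = ?M0 x" if "x \<in> state_space \<Omega>" for x
    using that by (rule state_spaceE) (simp add: Defs.M0_def L2_restrict_id[OF assms(5)])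
  have M1_eq: "Defs.M1 \<kappa> C x = ?M1 x" for x by (cases x) (simp add: Defs.M1_def)
  have "T_graph \<tau>0 \<rho> \<kappa> C c \<Omega> \<nu> = evo_graph \<nu>" for \<nu>
  proof -
    have "(\<lambda>t. Defs.M0 \<tau>0 \<rho> \<kappa> c (u t)) = (\<lambda>t. ?M0 (u t))" if "u \<in> Hnu \<nu> (state_space \<Omega>)" for u
      using M0_eq HnuD(2)[OF that] by blast
    then show ?thesis unfolding T_graph_def evo_graph_def M1_eq by (auto simp del: diag3_simp)
  qed
  then show ?thesis
    using well_posed by (auto intro: eventually_mono[OF eventually_gt_at_top[of 1]])
qed

end
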